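(* Consider the Bayesian elliptic inverse problem described in the context, with prior $\mu_0^J=\bigotimes_{j=1}^J\mathcal U(-1,1)$ on $[-1,1]^J$ and posterior $\mu_J$, for $J\in\mathbb N\cup\{\infty\}$. There is a constant $C>0$, not depending on $J$, such that the following holds. Let $Q$ be a Markov kernel on $[-1,1]$ that is reversible with respect to $\mathcal U(-1,1)$ and has an $L^2_{\mathcal U(-1,1)}$-spectral gap $1-\beta_{\mathrm{prop}}>0$. For $J\in\mathbb N\cup\{\infty\}$ let $Q_J(u,d\tilde u)=\bigotimes_{j=1}^J Q(u_j,d\tilde u_j)$, and let $P_J$ be the Metropolis-Hastings transition kernel for the target $\mu_J$ with proposal $Q_J$. Then the lazy version $\frac12 I+\frac12P_J$ of $P_J$ has an $L^2_{\mu_J}$-spectral gap $1-\beta_J$, and it satisfies the $J$-independent lower bound $$1-\beta_J\;\ge\;\frac12\exp\left(-8C^2\,\|\Gamma^{-1}\|\,N^2\left(\max_{i}\|l_i\|_{H^{-1}}\right)^2a_\star^{-2}\right)(1-\beta_{\mathrm{prop}})^2 .$$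
   Context: Forward problem. Let $D\subset\mathbb R^d$ be a bounded domain and $g\in H^{-1}(D)$. For $a\in L^\infty(D)$ with $\operatorname{ess\,inf}_D a>0$, let $p(\cdot;a)\in H_0^1(D)$ be the unique weak solution of $-\nabla\cdot(a\nabla p)=g$ in $D$, $p=0$ on $\partial D$. Let $l_1,\dots,l_N\in H^{-1}(D)$ and $\mathcal G(a)=(l_1(p(\cdot;a)),\dots,l_N(p(\cdot;a)))\in\mathbb R^N$. Prior. Fix $\bar a\in L^\infty(D)$, functions $\psi_j$ with $\|\psi_j\|_{L^\infty}=1$, and weights $\gamma_j$, $j\in\mathbb N$. For $J\in\mathbb N\cup\{\infty\}$ and $u\in[-1,1]^J$ set $a(u)(x)=\bar a(x)+\sum_{j=1}^J\gamma_ju_j\psi_j(x)$. It is assumed that this is well defined in $L^\infty(D)$ and that there is $a_\star>0$, independent of $J$ and $u$, with $a(u)(x)\ge a_\star$ for almost every $x\in D$. The prior is $\mu_0^J=\bigotimes_{j=1}^J\mathcal U(-1,1)$, with $\mathcal U(-1,1)$ the uniform distribution on $[-1,1]$. Posterior. Data $y\in\mathbb R^N$ (fixed, the same for all $J$) is modelled by $y=\mathcal G(a(u))+\eta$ with $\eta\sim\mathcal N(0,\Gamma)$, $\Gamma$ a positive definite $N\times N$ covariance matrix. The posterior $\mu_J$ is the probability measure on $[-1,1]^J$ with $$\frac{d\mu_J}{d\mu_0^J}(u)\propto L(u):=\exp\left(-\tfrac12\|y-\mathcal G(a(u))\|_\Gamma^2\right),\qquad \|v\|_\Gamma=|\Gamma^{-1/2}v|.$$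 The constant $C$ may depend on the fixed data of the problem (such as $D$, $g$, $N$, $y$) but not on $J$. Markov kernels. A Markov kernel $P$ acts by $Pf(x)=\int f(y)P(x,dy)$, and is reversible w.r.t. $\nu$ if $\nu(dx)P(x,dy)=\nu(dy)P(y,dx)$. It has an $L^2_\nu$-spectral gap $1-\beta$ if $\beta=\sup\{\|Pf\|_{L^2(\nu)}/\|f\|_{L^2(\nu)}:0\ne f\in L^2(\nu),\int f\,d\nu=0\}<1$. The Metropolis-Hastings kernel for $\mu_J$ with proposal $Q_J$ (which is reversible w.r.t. $\mu_0^J$) is $$P_J(u,dv)=\alpha(u,v)Q_J(u,dv)+\delta_u(dv)\left(1-\int\alpha(u,w)Q_J(u,dw)\right),\qquad \alpha(u,v)=\min\left(1,\frac{L(v)}{L(u)}\right).$$ *)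

theory Defs
  imports "HOL-Probability.Probability" "HOL-Probability.Essential_Supremum"
begin

text \<open>Elements of function spaces are represented by functions; the notions
  below do not depend on the representative.\<close>

definition L2_space :: "'a measure \<Rightarrow> ('a \<Rightarrow> 'b::euclidean_space) set" where
  "L2_space M = {f \<in> borel_measurable M. integrable M (\<lambda>x. (norm (f x))\<^sup>2)}"

definition L2_norm :: "'a measure \<Rightarrow> ('a \<Rightarrow> 'b::euclidean_space) \<Rightarrow> real" where
  "L2_norm M f = sqrt (\<integral>x. (norm (f x))\<^sup>2 \<partial>M)"

definition Linf_norm :: "'a measure \<Rightarrow> ('a \<Rightarrow> real) \<Rightarrow> ereal" where
  "Linf_norm M f = esssup M (\<lambda>x. ereal \<bar>f x\<bar>)"

definition Linf_space :: "'a measure \<Rightarrow> ('a \<Rightarrow> real) set" where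
  "Linf_space M = {f \<in> borel_measurable M. Linf_norm M f < \<infinity>}"

fun Ck_fun :: "nat \<Rightarrow> ('a::euclidean_space \<Rightarrow> real) \<Rightarrow> bool" where
  "Ck_fun 0 f \<longleftrightarrow> continuous_on UNIV f"
| "Ck_fun (Suc k) f \<longleftrightarrow> (\<forall>x. f differentiable (at x)) \<and>
     (\<forall>b\<in>Basis. Ck_fun k (\<lambda>x. frechet_derivative f (at x) b))"

definition test_function :: "'a::euclidean_space set \<Rightarrow> ('a \<Rightarrow> real) \<Rightarrow> bool" where
  "test_function D \<phi> \<longleftrightarrow> (\<forall>k. Ck_fun k \<phi>) \<and>
     compact (closure {x. \<phi> x \<noteq> 0}) \<and> closure {x. \<phi> x \<noteq> 0} \<subseteq> D"

definition is_weak_gradient ::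
    "'a::euclidean_space set \<Rightarrow> ('a \<Rightarrow> real) \<Rightarrow> ('a \<Rightarrow> 'a) \<Rightarrow> bool" where
  "is_weak_gradient D v F \<longleftrightarrow> F \<in> L2_space (lebesgue_on D) \<and>
     (\<forall>\<phi> b. test_function D \<phi> \<and> b \<in> Basis \<longrightarrow>
        (\<integral>x. v x * frechet_derivative \<phi> (at x) b \<partial>lebesgue_on D)
          = - (\<integral>x. (F x \<bullet> b) * \<phi> x \<partial>lebesgue_on D))"

definition H1_space :: "'a::euclidean_space set \<Rightarrow> ('a \<Rightarrow> real) set" where
  "H1_space D = {v \<in> L2_space (lebesgue_on D). \<exists>F. is_weak_gradient D v F}"

text \<open>The weak gradient is unique up to null sets.\<close>

definition weak_gradient :: "'a::euclidean_space set \<Rightarrow> ('a \<Rightarrow> real) \<Rightarrow> 'a \<Rightarrow> 'a" where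
  "weak_gradient D v = (SOME F. is_weak_gradient D v F)"

definition H1_norm :: "'a::euclidean_space set \<Rightarrow> ('a \<Rightarrow> real) \<Rightarrow> real" where
  "H1_norm D v = sqrt ((L2_norm (lebesgue_on D) v)\<^sup>2
     + (L2_norm (lebesgue_on D) (weak_gradient D v))\<^sup>2)"

definition H10_space :: "'a::euclidean_space set \<Rightarrow> ('a \<Rightarrow> real) set" where
  "H10_space D = {v \<in> H1_space D. \<exists>\<phi>. (\<forall>n. test_function D (\<phi> n)) \<and>
     (\<lambda>n. H1_norm D (\<lambda>x. v x - \<phi> n x)) \<longlonglongrightarrow> 0}"

text \<open>The dual of \<open>H\<^sup>1\<^sub>0\<close>. Only the values of a functional on \<^term>\<open>H10_space D\<close> matter;
  boundedness makes it constant on almost-everywhere equality classes.\<close>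

definition Hm1_space :: "'a::euclidean_space set \<Rightarrow> (('a \<Rightarrow> real) \<Rightarrow> real) set" where
  "Hm1_space D = {l.
     (\<forall>v\<in>H10_space D. \<forall>w\<in>H10_space D. l (\<lambda>x. v x + w x) = l v + l w) \<and>
     (\<forall>v\<in>H10_space D. \<forall>c. l (\<lambda>x. c * v x) = c * l v) \<and>
     (\<exists>K. \<forall>v\<in>H10_space D. \<bar>l v\<bar> \<le> K * H1_norm D v)}"

definition Hm1_norm :: "'a::euclidean_space set \<Rightarrow> (('a \<Rightarrow> real) \<Rightarrow> real) \<Rightarrow> real" where
  "Hm1_norm D l = Sup {\<bar>l v\<bar> | v. v \<in> H10_space D \<and> H1_norm D v \<le> 1}"

definition is_weak_solution :: "'a::euclidean_space set \<Rightarrow> (('a \<Rightarrow> real) \<Rightarrow> real) \<Rightarrow>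
    ('a \<Rightarrow> real) \<Rightarrow> ('a \<Rightarrow> real) \<Rightarrow> bool" where
  "is_weak_solution D g a p \<longleftrightarrow> p \<in> H10_space D \<and>
     (\<forall>v\<in>H10_space D.
        (\<integral>x. a x * (weak_gradient D p x \<bullet> weak_gradient D v x) \<partial>lebesgue_on D) = g v)"

text \<open>A representative of the weak solution, which is unique up to null sets.\<close>

definition weak_solution :: "'a::euclidean_space set \<Rightarrow> (('a \<Rightarrow> real) \<Rightarrow> real) \<Rightarrow>
    ('a \<Rightarrow> real) \<Rightarrow> 'a \<Rightarrow> real" where
  "weak_solution D g a = (SOME p. is_weak_solution D g a p)"

definition forward_map :: "'a::euclidean_space set \<Rightarrow> (('a \<Rightarrow> real) \<Rightarrow> real) \<Rightarrow>
    ('n \<Rightarrow> ('a \<Rightarrow> real) \<Rightarrow> real) \<Rightarrow> ('a \<Rightarrow> real) \<Rightarrow> real ^ 'n" where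
  "forward_map D g l a = (\<chi> i. l i (weak_solution D g a))"

text \<open>Coordinates are numbered from \<open>0\<close>.\<close>

definition coords :: "enat \<Rightarrow> nat set" where
  "coords J = {j. enat j < J}"

definition coefficient :: "('a \<Rightarrow> real) \<Rightarrow> (nat \<Rightarrow> real) \<Rightarrow> (nat \<Rightarrow> 'a \<Rightarrow> real) \<Rightarrow>
    enat \<Rightarrow> (nat \<Rightarrow> real) \<Rightarrow> 'a \<Rightarrow> real" where
  "coefficient abar \<gamma> \<psi> J u x = abar x +
     (case J of enat n \<Rightarrow> (\<Sum>j<n. \<gamma> j * u j * \<psi> j x) | \<infinity> \<Rightarrow> (\<Sum>j. \<gamma> j * u j * \<psi> j x))"

definition unif :: "real measure" where
  "unif = uniform_measure (restrict_space lborel {-1..1}) {-1..1}"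

definition prior :: "enat \<Rightarrow> (nat \<Rightarrow> real) measure" where
  "prior J = PiM (coords J) (\<lambda>_. unif)"

definition pos_def_matrix :: "real ^ 'n ^ 'n \<Rightarrow> bool" where
  "pos_def_matrix A \<longleftrightarrow> transpose A = A \<and> (\<forall>v. v \<noteq> 0 \<longrightarrow> v \<bullet> (A *v v) > 0)"

text \<open>\<open>\<Gamma>\<^sup>-\<^sup>1\<^sup>/\<^sup>2\<close>: the (unique) positive definite square root of \<open>\<Gamma>\<^sup>-\<^sup>1\<close>.\<close>

definition inv_sqrt_matrix :: "real ^ 'n ^ 'n \<Rightarrow> real ^ 'n ^ 'n" where
  "inv_sqrt_matrix \<Gamma> = (SOME S. pos_def_matrix S \<and> S ** S = matrix_inv \<Gamma>)"

definition cov_norm :: "real ^ 'n ^ 'n \<Rightarrow> real ^ 'n \<Rightarrow> real" where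
  "cov_norm \<Gamma> v = norm (inv_sqrt_matrix \<Gamma> *v v)"

definition likelihood :: "(('a \<Rightarrow> real) \<Rightarrow> real ^ 'n) \<Rightarrow> real ^ 'n ^ 'n \<Rightarrow> real ^ 'n \<Rightarrow>
    ('u \<Rightarrow> 'a \<Rightarrow> real) \<Rightarrow> 'u \<Rightarrow> real" where
  "likelihood G \<Gamma> y a u = exp (- (1/2) * (cov_norm \<Gamma> (y - G (a u)))\<^sup>2)"

definition posterior :: "'u measure \<Rightarrow> ('u \<Rightarrow> real) \<Rightarrow> 'u measure" where
  "posterior \<mu>0 L = density \<mu>0 (\<lambda>u. ennreal (L u / (\<integral>w. L w \<partial>\<mu>0)))"

definition markov_kernel :: "'u measure \<Rightarrow> ('u \<Rightarrow> 'u measure) \<Rightarrow> bool" where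
  "markov_kernel M P \<longleftrightarrow> P \<in> M \<rightarrow>\<^sub>M prob_algebra M"

text \<open>The measure \<open>\<nu>(dx) P(x, dy)\<close> on the product space.\<close>

definition kernel_joint :: "'u measure \<Rightarrow> ('u \<Rightarrow> 'u measure) \<Rightarrow> ('u \<times> 'u) measure" where
  "kernel_joint \<nu> P = \<nu> \<bind> (\<lambda>x. distr (P x) (\<nu> \<Otimes>\<^sub>M \<nu>) (\<lambda>y. (x, y)))"

definition reversible :: "'u measure \<Rightarrow> ('u \<Rightarrow> 'u measure) \<Rightarrow> bool" where
  "reversible \<nu> P \<longleftrightarrow>
     kernel_joint \<nu> P = distr (kernel_joint \<nu> P) (\<nu> \<Otimes>\<^sub>M \<nu>) (\<lambda>(x, y). (y, x))"

definition kernel_op :: "('u \<Rightarrow> 'u measure) \<Rightarrow> ('u \<Rightarrow> real) \<Rightarrow> 'u \<Rightarrow> real" where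
  "kernel_op P f x = (\<integral>y. f y \<partial>P x)"

text \<open>For a \<open>\<nu>\<close>-reversible Markov kernel the set is bounded by \<open>1\<close>, and it is nonempty as soon as
  \<open>L\<^sup>2(\<nu>)\<close> contains a nonconstant function, so the real supremum is the actual one.\<close>

definition L2_beta :: "'u measure \<Rightarrow> ('u \<Rightarrow> 'u measure) \<Rightarrow> real" where
  "L2_beta \<nu> P = Sup {L2_norm \<nu> (kernel_op P f) / L2_norm \<nu> f | f.
     f \<in> L2_space \<nu> \<and> L2_norm \<nu> f \<noteq> 0 \<and> (\<integral>x. f x \<partial>\<nu>) = 0}"

definition has_L2_spectral_gap :: "'u measure \<Rightarrow> ('u \<Rightarrow> 'u measure) \<Rightarrow> bool" where
  "has_L2_spectral_gap \<nu> P \<longleftrightarrow> markov_kernel \<nu> P \<and> L2_beta \<nu> P < 1"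

definition product_kernel ::
    "enat \<Rightarrow> (real \<Rightarrow> real measure) \<Rightarrow> (nat \<Rightarrow> real) \<Rightarrow> (nat \<Rightarrow> real) measure" where
  "product_kernel J Q u = PiM (coords J) (\<lambda>j. Q (u j))"

definition MH_accept :: "('u \<Rightarrow> real) \<Rightarrow> 'u \<Rightarrow> 'u \<Rightarrow> real" where
  "MH_accept L u v = min 1 (L v / L u)"

text \<open>The first argument only supplies the measurable space.\<close>

definition MH_kernel ::
    "'u measure \<Rightarrow> ('u \<Rightarrow> real) \<Rightarrow> ('u \<Rightarrow> 'u measure) \<Rightarrow> 'u \<Rightarrow> 'u measure" where
  "MH_kernel M L Q u = measure_of (space M) (sets M) (\<lambda>A.
     (\<integral>\<^sup>+v. ennreal (MH_accept L u v) * indicator A v \<partial>Q u)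
     + indicator A u * (1 - (\<integral>\<^sup>+w. ennreal (MH_accept L u w) \<partial>Q u)))"

definition lazy_kernel :: "'u measure \<Rightarrow> ('u \<Rightarrow> 'u measure) \<Rightarrow> 'u \<Rightarrow> 'u measure" where
  "lazy_kernel M P u = measure_of (space M) (sets M) (\<lambda>A.
     ennreal (1/2) * indicator A u + ennreal (1/2) * emeasure (P u) A)"

end

theory Submission
  imports Defs
begin

text \<open>The proof compares Dirichlet forms. Write \<open>\<nu>\<close> for the prior, \<open>Q\<close> for the product proposal, \<open>\<mu>\<close> for the
  posterior and \<open>P\<close> for the Metropolis-Hastings kernel, and let \<open>\<beta>\<close> be the norm of the one-dimensional
  proposal on mean-zero functions. For every reversible kernel, one minus the largest
  spectral value on mean-zero functions is the best constant in the Poincare inequality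
  \<open>\<delta> Var(f) \<le> E(f)\<close>, where \<open>E(f)\<close> is half the integral of \<open>(f(u) - f(v))\<^sup>2\<close> over the joint law of a
  stationary pair \<open>(u, v)\<close>. Three facts give the result.

  First, the Poincare inequality with constant \<open>1 - \<beta>\<close> passes from the one-dimensional proposal to the
  product, whatever the number of factors. Its bilinear form, a bound on the covariance of
  \<open>f(u)\<close> and \<open>h(v)\<close> by \<open>\<beta>\<close> times the average of the variances of \<open>f\<close> and \<open>h\<close>, is stable under adding one
  coordinate because of the law of total variance (\<open>tensor_correlation\<close>). For infinitely many factors it extends
  from functions of finitely many coordinates to \<open>L\<^sup>2\<close> by density
  (\<open>cylinder_dense\<close>, \<open>Poincare_product\<close>).

  Second, if the likelihood takes values in \<open>[m, M]\<close> with \<open>m > 0\<close>, the stationary pairs of \<open>P\<close> that move have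
  the density \<open>min(L(u), L(v)) / Z\<close> with respect to those of \<open>Q\<close>. Hence the Dirichlet form of \<open>P\<close> is at
  least \<open>m / Z\<close> times that of \<open>Q\<close>, while variances under \<open>\<mu>\<close> are at most \<open>M / Z\<close> times variances under
  \<open>\<nu>\<close>. So \<open>P\<close> satisfies a Poincare inequality with constant \<open>(m / M) (1 - \<beta>)\<close> (\<open>Dirichlet_comparison\<close>).
  The lazy kernel \<open>(I + P) / 2\<close> is a positive operator, so its norm is its largest spectral
  value, and its spectral gap is at least half that constant (\<open>lazy_spectral_gap\<close>).

  Third, the likelihood is measurable and its oscillation is bounded uniformly in the number of coordinates.
  Both follow from the elliptic problem: ellipticity and the Poincare inequality bound the solution
  uniformly, and the solution is Lipschitz in the coefficient with respect to the \<open>L\<^sup>\<infinity>\<close>-norm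
  (\<open>observation_bounds\<close>), so that the likelihood is a limit of functions that are continuous in
  finitely many coordinates. Existence is obtained by minimising the energy, which needs the
  completeness of \<open>H\<^sup>1\<^sub>0\<close>; the uniqueness of weak gradients, on which linearity rests, comes from the
  fundamental lemma of the calculus of variations.

  The constant \<open>C\<close> of the theorem is chosen so that the exponential factor lies below \<open>m / M\<close>. This is
  possible as soon as some functional \<open>l i\<close> has nonzero norm; if all norms vanish, the likelihood is constant and
  \<open>m = M\<close>. Finally \<open>(1 - \<beta>)\<^sup>2 \<le> 1 - \<beta>\<close>, because \<open>0 \<le> \<beta> < 1\<close>.\<close>

section \<open>Square-integrable functions\<close>

lemma L2_spaceD:
  assumes "f \<in> L2_space M"
  shows "f \<in> borel_measurable M" "integrable M (\<lambda>x. (norm (f x))\<^sup>2)"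
  using assms by (auto simp: L2_space_def)

lemma L2_norm_nonneg [simp]: "0 \<le> L2_norm M f"
  by (simp add: L2_norm_def)

lemma L2_norm_power2: "(L2_norm M f)\<^sup>2 = (\<integral>x. (norm (f x))\<^sup>2 \<partial>M)"
  by (simp add: L2_norm_def)

lemma L2_norm_cong_AE:
  assumes "AE x in M. f x = g x" "f \<in> borel_measurable M" "g \<in> borel_measurable M"
  shows "L2_norm M f = L2_norm M g"
  unfolding L2_norm_def
  by (intro arg_cong[where f=sqrt] integral_cong_AE) (use assms in auto)

lemma L2_space_cmult:
  fixes f :: "'a \<Rightarrow> 'b::euclidean_space"
  assumes "f \<in> L2_space M"
  shows "(\<lambda>x. c *\<^sub>R f x) \<in> L2_space M"
  using assms by (auto simp: L2_space_def power_mult_distrib)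

lemma L2_norm_cmult: "L2_norm M (\<lambda>x. c *\<^sub>R f x) = \<bar>c\<bar> * L2_norm M f"
  by (simp add: L2_norm_def power_mult_distrib real_sqrt_mult)

lemma L2_space_add:
  fixes f g :: "'a \<Rightarrow> 'b::euclidean_space"
  assumes "f \<in> L2_space M" "g \<in> L2_space M"
  shows "(\<lambda>x. f x + g x) \<in> L2_space M"
proof -
  have [measurable]: "f \<in> borel_measurable M" "g \<in> borel_measurable M"
    using assms by (auto simp: L2_space_def)
  have "integrable M (\<lambda>x. 2 * (norm (f x))\<^sup>2 + 2 * (norm (g x))\<^sup>2)"
    using assms by (auto simp: L2_space_def)
  then have "integrable M (\<lambda>x. (norm (f x + g x))\<^sup>2)"
  proof (rule Bochner_Integration.integrable_bound)
    show "AE x in M. norm ((norm (f x + g x))\<^sup>2) \<le> norm (2 * (norm (f x))\<^sup>2 + 2 * (norm (g x))\<^sup>2)"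
    proof (rule AE_I2)
      fix x
      have "(norm (f x + g x))\<^sup>2 \<le> (norm (f x) + norm (g x))\<^sup>2"
        by (intro power_mono norm_triangle_ineq) auto
      also have "\<dots> \<le> 2 * (norm (f x))\<^sup>2 + 2 * (norm (g x))\<^sup>2"
        using sum_squares_bound[of "norm (f x)" "norm (g x)"] by (simp add: power2_sum)
      finally show "norm ((norm (f x + g x))\<^sup>2) \<le> norm (2 * (norm (f x))\<^sup>2 + 2 * (norm (g x))\<^sup>2)" by simp
    qed
  qed auto
  then show ?thesis by (auto simp: L2_space_def)
qed

lemma L2_space_diff:
  fixes f g :: "'a \<Rightarrow> 'b::euclidean_space"
  assumes "f \<in> L2_space M" "g \<in> L2_space M"
  shows "(\<lambda>x. f x - g x) \<in> L2_space M"
  using L2_space_add[OF assms(1) L2_space_cmult[OF assms(2), of "-1"]] by simp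

lemma L2_inner_integrable:
  fixes f g :: "'a \<Rightarrow> 'b::euclidean_space"
  assumes "f \<in> L2_space M" "g \<in> L2_space M"
  shows "integrable M (\<lambda>x. f x \<bullet> g x)"
proof -
  have [measurable]: "f \<in> borel_measurable M" "g \<in> borel_measurable M"
    using assms by (auto simp: L2_space_def)
  have "integrable M (\<lambda>x. (norm (f x))\<^sup>2 + (norm (g x))\<^sup>2)"
    using assms by (auto simp: L2_space_def)
  then show ?thesis
  proof (rule Bochner_Integration.integrable_bound)
    show "AE x in M. norm (f x \<bullet> g x) \<le> norm ((norm (f x))\<^sup>2 + (norm (g x))\<^sup>2)"
    proof (rule AE_I2)
      fix x
      have "\<bar>f x \<bullet> g x\<bar> \<le> norm (f x) * norm (g x)" by (rule Cauchy_Schwarz_ineq2)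
      also have "\<dots> \<le> (norm (f x))\<^sup>2 + (norm (g x))\<^sup>2"
        using sum_squares_bound[of "norm (f x)" "norm (g x)"]
          mult_nonneg_nonneg[OF norm_ge_zero[of "f x"] norm_ge_zero[of "g x"]] by linarith
      finally show "norm (f x \<bullet> g x) \<le> norm ((norm (f x))\<^sup>2 + (norm (g x))\<^sup>2)" by simp
    qed
  qed auto
qed

text \<open>The square norm of \<open>f + t g\<close> is a nonnegative quadratic polynomial in \<open>t\<close>, so its discriminant is not positive.\<close>

lemma L2_Cauchy_Schwarz:
  fixes f g :: "'a \<Rightarrow> 'b::euclidean_space"
  assumes f: "f \<in> L2_space M" and g: "g \<in> L2_space M"
  shows "\<bar>\<integral>x. f x \<bullet> g x \<partial>M\<bar> \<le> L2_norm M f * L2_norm M g"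
proof -
  define A B C where "A = (\<integral>x. (norm (f x))\<^sup>2 \<partial>M)" and "B = (\<integral>x. f x \<bullet> g x \<partial>M)"
    and "C = (\<integral>x. (norm (g x))\<^sup>2 \<partial>M)"
  note ints = L2_inner_integrable[OF f g] L2_spaceD(2)[OF f] L2_spaceD(2)[OF g]
  have q: "A + 2 * t * B + t\<^sup>2 * C \<ge> 0" for t
  proof -
    have "0 \<le> (\<integral>x. (norm (f x + t *\<^sub>R g x))\<^sup>2 \<partial>M)" by simp
    also have "(\<lambda>x. (norm (f x + t *\<^sub>R g x))\<^sup>2)
        = (\<lambda>x. (norm (f x))\<^sup>2 + 2 * t * (f x \<bullet> g x) + t\<^sup>2 * (norm (g x))\<^sup>2)"
      unfolding power2_norm_eq_inner
      by (auto simp: inner_add_left inner_add_right inner_commute power2_eq_square algebra_simps)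
    finally show ?thesis using ints unfolding A_def B_def C_def by simp
  qed
  have "C \<ge> 0" "A \<ge> 0" by (auto simp: C_def A_def)
  have "B\<^sup>2 \<le> A * C"
  proof (cases "C = 0")
    case True
    have "B = 0"
    proof (rule ccontr)
      assume "B \<noteq> 0"
      then show False using q[of "- (A + 1) / (2 * B)"] True \<open>A \<ge> 0\<close> by (simp add: field_simps)
    qed
    then show ?thesis using True by simp
  next
    case False
    then have "C > 0" using \<open>C \<ge> 0\<close> by simp
    have "C * (A + 2 * (-B/C) * B + (-B/C)\<^sup>2 * C) = A * C - B\<^sup>2"
      using False by (simp add: field_simps power2_eq_square)
    then show ?thesis using mult_nonneg_nonneg[OF \<open>C \<ge> 0\<close> q[of "-B/C"]] by simp
  qed
  then have "sqrt (B\<^sup>2) \<le> sqrt (A * C)" by (rule real_sqrt_le_mono)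
  then show ?thesis by (simp add: A_def B_def C_def L2_norm_def real_sqrt_mult)
qed

lemma L2_triangle:
  fixes f g :: "'a \<Rightarrow> 'b::euclidean_space"
  assumes f: "f \<in> L2_space M" and g: "g \<in> L2_space M"
  shows "L2_norm M (\<lambda>x. f x + g x) \<le> L2_norm M f + L2_norm M g"
proof -
  note ints = L2_inner_integrable[OF f g] L2_spaceD(2)[OF f] L2_spaceD(2)[OF g]
  have "(L2_norm M (\<lambda>x. f x + g x))\<^sup>2 = (\<integral>x. (norm (f x))\<^sup>2 + 2 * (f x \<bullet> g x) + (norm (g x))\<^sup>2 \<partial>M)"
    unfolding L2_norm_power2
    by (intro Bochner_Integration.integral_cong)
       (auto simp: power2_norm_eq_inner inner_add_left inner_add_right inner_commute)
  also have "\<dots> = (L2_norm M f)\<^sup>2 + 2 * (\<integral>x. f x \<bullet> g x \<partial>M) + (L2_norm M g)\<^sup>2"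
    unfolding L2_norm_power2 using ints by simp
  also have "\<dots> \<le> (L2_norm M f + L2_norm M g)\<^sup>2"
    using L2_Cauchy_Schwarz[OF f g] by (simp add: power2_sum)
  finally show ?thesis
    by (rule power2_le_imp_le) simp
qed

lemma L2_norm_minus_commute:
  fixes f g :: "'a \<Rightarrow> 'b::euclidean_space"
  shows "L2_norm M (\<lambda>x. f x - g x) = L2_norm M (\<lambda>x. g x - f x)"
  by (simp add: L2_norm_def norm_minus_commute)

lemma L2_triangle_diff:
  fixes f g h :: "'a \<Rightarrow> 'b::euclidean_space"
  assumes "f \<in> L2_space M" "g \<in> L2_space M" "h \<in> L2_space M"
  shows "L2_norm M (\<lambda>x. f x - h x) \<le> L2_norm M (\<lambda>x. f x - g x) + L2_norm M (\<lambda>x. g x - h x)"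
  using L2_triangle[OF L2_space_diff[OF assms(1,2)] L2_space_diff[OF assms(2,3)]] by simp

lemma L2_norm_le_add:
  fixes f g :: "'a \<Rightarrow> 'b::euclidean_space"
  assumes "f \<in> L2_space M" "g \<in> L2_space M"
  shows "L2_norm M f \<le> L2_norm M g + L2_norm M (\<lambda>x. f x - g x)"
  using L2_triangle[OF assms(2) L2_space_diff[OF assms]] by simp

lemma L2_space_bounded:
  fixes f :: "'a \<Rightarrow> 'b::euclidean_space"
  assumes "finite_measure M" "f \<in> borel_measurable M" "\<And>x. x \<in> space M \<Longrightarrow> norm (f x) \<le> B"
  shows "f \<in> L2_space M"
proof -
  interpret finite_measure M by fact
  have "integrable M (\<lambda>x. (norm (f x))\<^sup>2)"
    using assms by (intro integrable_const_bound[where B="B\<^sup>2"])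
      (auto intro!: power_mono)
  then show ?thesis using assms by (auto simp: L2_space_def)
qed

lemma L2_dominated:
  fixes f :: "'a \<Rightarrow> 'b::euclidean_space"
  assumes [measurable]: "f \<in> borel_measurable M" and g: "integrable M g" "AE x in M. (norm (f x))\<^sup>2 \<le> g x"
  shows "f \<in> L2_space M"
proof -
  have "integrable M (\<lambda>x. (norm (f x))\<^sup>2)"
    by (rule Bochner_Integration.integrable_bound[OF g(1)]) (use g(2) in auto)
  then show ?thesis by (auto simp: L2_space_def)
qed

lemma L2_space_integrable:
  fixes f :: "'a \<Rightarrow> real"
  assumes "finite_measure M" "f \<in> L2_space M"
  shows "integrable M f"
proof -
  interpret finite_measure M by fact
  have "(\<lambda>x. 1::real) \<in> L2_space M" by (auto simp: L2_space_def)
  from L2_inner_integrable[OF assms(2) this] show ?thesis by simp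
qed

lemma L2_dominated_convergence:
  fixes f :: "'a \<Rightarrow> 'b::euclidean_space"
  assumes [measurable]: "f \<in> borel_measurable M" "\<And>n. s n \<in> borel_measurable M"
    and g: "integrable M g" and lim: "AE x in M. (\<lambda>n. s n x) \<longlonglongrightarrow> f x"
    and bd: "\<And>n. AE x in M. (norm (s n x - f x))\<^sup>2 \<le> g x"
  shows "(\<lambda>n. L2_norm M (\<lambda>x. s n x - f x)) \<longlonglongrightarrow> 0"
proof -
  have "(\<lambda>n. \<integral>x. (norm (s n x - f x))\<^sup>2 \<partial>M) \<longlonglongrightarrow> (\<integral>x. 0 \<partial>M)"
  proof (rule integral_dominated_convergence[where w=g])
    show "AE x in M. (\<lambda>n. (norm (s n x - f x))\<^sup>2) \<longlonglongrightarrow> 0"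
      using lim
    proof eventually_elim
      case (elim x)
      then have "(\<lambda>n. s n x - f x) \<longlonglongrightarrow> 0" by (simp add: LIM_zero)
      then show ?case by (intro tendsto_null_power) (auto intro: tendsto_norm_zero)
    qed
  qed (use g bd in auto)
  from tendsto_real_sqrt[OF this] show ?thesis by (simp add: L2_norm_def)
qed

lemma le_suminf_ennreal:
  fixes q :: "nat \<Rightarrow> ennreal"
  shows "q n \<le> suminf q"
  using sum_le_suminf[OF summableI, of "{n}" q] by simp

text \<open>A subsequence whose increments have squared norms at most \<open>8\<^sup>-\<^sup>n\<close> converges almost everywhere: the sum
  of \<open>4\<^sup>n\<close> times the squared increments has a finite integral, so almost everywhere the increments
  decay like \<open>2\<^sup>-\<^sup>n\<close>. Fatou's lemma turns the pointwise limit into an \<open>L\<^sup>2\<close>-limit of the whole sequence.\<close>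

lemma L2_complete:
  fixes f :: "nat \<Rightarrow> 'a \<Rightarrow> 'b::euclidean_space"
  assumes f: "\<And>n. f n \<in> L2_space M"
    and cauchy: "\<And>e. e > 0 \<Longrightarrow> \<exists>N. \<forall>m\<ge>N. \<forall>n\<ge>N. L2_norm M (\<lambda>x. f m x - f n x) < e"
  obtains F where "F \<in> L2_space M" "(\<lambda>n. L2_norm M (\<lambda>x. f n x - F x)) \<longlonglongrightarrow> 0"
proof -
  have [measurable]: "f n \<in> borel_measurable M" for n using f by (auto simp: L2_space_def)
  have nn: "(\<integral>\<^sup>+x. ennreal ((norm (f m x - f n x))\<^sup>2) \<partial>M) = ennreal ((L2_norm M (\<lambda>x. f m x - f n x))\<^sup>2)" for m n
    unfolding L2_norm_power2 by (intro nn_integral_eq_integral L2_spaceD(2)[OF L2_space_diff[OF f f]]) auto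
  obtain N where N: "\<And>k m n. m \<ge> N k \<Longrightarrow> n \<ge> N k \<Longrightarrow> L2_norm M (\<lambda>x. f m x - f n x) < sqrt ((1/8)^k)"
    using cauchy[of "sqrt ((1/8)^k)" for k] by (metis real_sqrt_gt_0_iff zero_less_divide_1_iff zero_less_numeral zero_less_power)
  \<comment> \<open>The sum makes \<open>r\<close> monotone and the summand \<open>n\<close> makes it tend to infinity.\<close>
  define r where "r n = n + (\<Sum>k\<le>n. N k)" for n
  have rN: "r n \<ge> N n" for n
    using member_le_sum[of n "{..n}" N] by (auto simp: r_def)
  have rS: "r (Suc n) \<ge> r n" for n by (auto simp: r_def)
  have rn: "r n \<ge> n" for n by (auto simp: r_def)
  define d where "d n x = f (r (Suc n)) x - f (r n) x" for n x
  have [measurable]: "d n \<in> borel_measurable M" for n unfolding d_def by measurable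
  have dn: "(\<integral>\<^sup>+x. ennreal (4^n * (norm (d n x))\<^sup>2) \<partial>M) \<le> ennreal ((1/2)^n)" for n
  proof -
    have "(L2_norm M (\<lambda>x. f (r (Suc n)) x - f (r n) x))\<^sup>2 \<le> (sqrt ((1/8)^n))\<^sup>2"
      using N[of n "r (Suc n)" "r n"] rN[of n] rS[of n] by (intro power_mono) auto
    then have le: "(L2_norm M (\<lambda>x. f (r (Suc n)) x - f (r n) x))\<^sup>2 \<le> (1/8)^n" by simp
    have "(\<integral>\<^sup>+x. ennreal (4^n * (norm (d n x))\<^sup>2) \<partial>M) = ennreal (4^n) * (\<integral>\<^sup>+x. ennreal ((norm (d n x))\<^sup>2) \<partial>M)"
      by (subst nn_integral_cmult[symmetric]) (auto simp: ennreal_mult)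
    also have "\<dots> = ennreal (4^n * (L2_norm M (\<lambda>x. f (r (Suc n)) x - f (r n) x))\<^sup>2)"
      unfolding d_def nn by (simp add: ennreal_mult)
    also have "\<dots> \<le> ennreal (4^n * (1/8)^n)"
      using le by (intro ennreal_leI mult_left_mono) auto
    also have "(4::real)^n * (1/8)^n = (1/2)^n" by (simp add: power_mult_distrib[symmetric])
    finally show ?thesis .
  qed
  have "(\<integral>\<^sup>+x. (\<Sum>n. ennreal (4^n * (norm (d n x))\<^sup>2)) \<partial>M) = (\<Sum>n. \<integral>\<^sup>+x. ennreal (4^n * (norm (d n x))\<^sup>2) \<partial>M)"
    by (rule nn_integral_suminf) auto
  also have "\<dots> \<le> (\<Sum>n. ennreal ((1/2)^n))"
    by (rule suminf_le[OF dn]) auto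
  also have "\<dots> < \<infinity>"
    by (subst suminf_ennreal2) (auto intro!: summable_geometric)
  finally have "AE x in M. (\<Sum>n. ennreal (4^n * (norm (d n x))\<^sup>2)) \<noteq> \<infinity>"
    by (intro nn_integral_PInf_AE) auto
  then have conv: "AE x in M. convergent (\<lambda>n. f (r n) x)"
  proof eventually_elim
    case (elim x)
    define S where "S = enn2real (\<Sum>n. ennreal (4^n * (norm (d n x))\<^sup>2))"
    have "ennreal (4^n * (norm (d n x))\<^sup>2) \<le> (\<Sum>n. ennreal (4^n * (norm (d n x))\<^sup>2))" for n
      by (rule le_suminf_ennreal)
    then have "ennreal (4^n * (norm (d n x))\<^sup>2) \<le> ennreal S" for n
      using elim by (simp add: S_def ennreal_enn2real_if)
    then have S: "4^n * (norm (d n x))\<^sup>2 \<le> S" for n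
      by (subst (asm) ennreal_le_iff) (auto simp: S_def)
    have "norm (d n x) \<le> sqrt S * (1/2)^n" for n
    proof -
      have "sqrt (4^n * (norm (d n x))\<^sup>2) \<le> sqrt S" using S by (rule real_sqrt_le_mono)
      moreover have "sqrt ((4::real)^n) = 2^n" by (simp add: real_sqrt_power)
      ultimately have "2^n * norm (d n x) \<le> sqrt S" by (simp add: real_sqrt_mult)
      then have "(1/2)^n * (2^n * norm (d n x)) \<le> (1/2)^n * sqrt S" by (intro mult_left_mono) auto
      moreover have "(1/2)^n * (2^n * norm (d n x)) = norm (d n x)"
        unfolding mult.assoc[symmetric] power_mult_distrib[symmetric] by simp
      ultimately show ?thesis by (metis mult.commute)
    qed
    then have "summable (\<lambda>n. d n x)"
      by (rule summable_comparison_test'[rotated]) (rule summable_mult[OF summable_geometric], simp)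
    then have "convergent (\<lambda>n. \<Sum>k<n. d k x)" by (simp add: summable_iff_convergent)
    moreover have "(\<Sum>k<n. d k x) = f (r n) x - f (r 0) x" for n
      by (induction n) (auto simp: d_def)
    ultimately have "convergent (\<lambda>n. f (r n) x - f (r 0) x)" by simp
    from convergent_add[OF this convergent_const[of "f (r 0) x"]] show ?case by simp
  qed
  define F where "F x = lim (\<lambda>n. f (r n) x)" for x
  have [measurable]: "F \<in> borel_measurable M" unfolding F_def by measurable
  have lim: "AE x in M. (\<lambda>n. f (r n) x) \<longlonglongrightarrow> F x"
    using conv by eventually_elim (simp add: F_def convergent_LIMSEQ_iff)
  have fatou: "(\<integral>\<^sup>+x. ennreal ((norm (f m x - F x))\<^sup>2) \<partial>M) \<le> ennreal (e\<^sup>2)"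
    if e: "e > 0" "\<forall>m\<ge>K. \<forall>n\<ge>K. L2_norm M (\<lambda>x. f m x - f n x) < e" and "m \<ge> K" for e K m
  proof -
    have "(\<integral>\<^sup>+x. ennreal ((norm (f m x - F x))\<^sup>2) \<partial>M)
        = (\<integral>\<^sup>+x. liminf (\<lambda>n. ennreal ((norm (f m x - f (r n) x))\<^sup>2)) \<partial>M)"
    proof (rule nn_integral_cong_AE)
      show "AE x in M. ennreal ((norm (f m x - F x))\<^sup>2) = liminf (\<lambda>n. ennreal ((norm (f m x - f (r n) x))\<^sup>2))"
        using lim
      proof eventually_elim
        case (elim x)
        then have "(\<lambda>n. ennreal ((norm (f m x - f (r n) x))\<^sup>2)) \<longlonglongrightarrow> ennreal ((norm (f m x - F x))\<^sup>2)"
          by (intro tendsto_ennrealI tendsto_power tendsto_norm tendsto_diff tendsto_const)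
        then show ?case by (intro lim_imp_Liminf[symmetric]) auto
      qed
    qed
    also have "\<dots> \<le> liminf (\<lambda>n. \<integral>\<^sup>+x. ennreal ((norm (f m x - f (r n) x))\<^sup>2) \<partial>M)"
      by (rule nn_integral_liminf) auto
    also have "\<dots> \<le> ennreal (e\<^sup>2)"
    proof -
      have "eventually (\<lambda>n. (\<integral>\<^sup>+x. ennreal ((norm (f m x - f (r n) x))\<^sup>2) \<partial>M) \<le> ennreal (e\<^sup>2)) sequentially"
        unfolding nn using eventually_ge_at_top[of K]
      proof eventually_elim
        case (elim n)
        then have "L2_norm M (\<lambda>x. f m x - f (r n) x) < e" using that rn[of n] by auto
        then show ?case by (intro ennreal_leI power_mono) auto
      qed
      then show ?thesis by (intro Liminf_le) auto
    qed
    finally show ?thesis .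
  qed
  have mem: "(\<lambda>x. f m x - F x) \<in> L2_space M"
    and bnd: "L2_norm M (\<lambda>x. f m x - F x) \<le> e"
    if e: "e > 0" "\<forall>m\<ge>K. \<forall>n\<ge>K. L2_norm M (\<lambda>x. f m x - f n x) < e" and "m \<ge> K" for e K m
  proof -
    have i: "integrable M (\<lambda>x. (norm (f m x - F x))\<^sup>2)"
      using fatou[OF that] by (intro integrableI_bounded) (auto simp: le_less_trans)
    then show "(\<lambda>x. f m x - F x) \<in> L2_space M" by (auto simp: L2_space_def)
    have "ennreal (\<integral>x. (norm (f m x - F x))\<^sup>2 \<partial>M) \<le> ennreal (e\<^sup>2)"
      using fatou[OF that] by (subst (asm) nn_integral_eq_integral[OF i]) auto
    then have "(\<integral>x. (norm (f m x - F x))\<^sup>2 \<partial>M) \<le> e\<^sup>2" by simp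
    then show "L2_norm M (\<lambda>x. f m x - F x) \<le> e"
      unfolding L2_norm_def using e by (intro real_le_lsqrt) auto
  qed
  obtain K where K: "\<forall>m\<ge>K. \<forall>n\<ge>K. L2_norm M (\<lambda>x. f m x - f n x) < 1" using cauchy[of 1] by auto
  have "(\<lambda>x. f K x - (f K x - F x)) \<in> L2_space M"
    by (rule L2_space_diff[OF f mem[OF _ K]]) auto
  then have F: "F \<in> L2_space M" by simp
  have "(\<lambda>n. L2_norm M (\<lambda>x. f n x - F x)) \<longlonglongrightarrow> 0"
  proof (rule LIMSEQ_I)
    fix e :: real assume "e > 0"
    then obtain K where "\<forall>m\<ge>K. \<forall>n\<ge>K. L2_norm M (\<lambda>x. f m x - f n x) < e/2" using cauchy[of "e/2"] by auto
    then have "L2_norm M (\<lambda>x. f n x - F x) < e" if "n \<ge> K" for n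
      using bnd[of "e/2" K n] that \<open>e > 0\<close> by auto
    then show "\<exists>K. \<forall>n\<ge>K. norm (L2_norm M (\<lambda>x. f n x - F x) - 0) < e" by auto
  qed
  with F show ?thesis by (rule that)
qed

section \<open>Smooth bump functions and the fundamental lemma of the calculus of variations\<close>

text \<open>The functions \<open>exp(-1/t) / t\<^sup>m\<close>, extended by zero, together with all their derivatives: differentiation
  leads from \<open>m\<close> to \<open>m + 1\<close> and \<open>m + 2\<close>.\<close>

definition flat_exp :: "nat \<Rightarrow> real \<Rightarrow> real" where
  "flat_exp m t = (if t > 0 then exp (- (1 / t)) / t ^ m else 0)"

lemma flat_exp_quotient_tendsto_0: "((\<lambda>t. flat_exp m t / t) \<longlongrightarrow> 0) (at 0)"
proof (rule filterlim_split_at)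
  show "((\<lambda>t. flat_exp m t / t) \<longlongrightarrow> 0) (at_left 0)"
  proof (rule Lim_transform_eventually[OF tendsto_const])
    show "\<forall>\<^sub>F t in at_left 0. 0 = flat_exp m t / t"
      by (simp add: eventually_at_filter flat_exp_def)
  qed
  have "((\<lambda>t. (inverse t) ^ Suc m / exp (inverse t)) \<longlongrightarrow> 0) (at_right (0::real))"
    by (rule filterlim_compose[OF tendsto_power_div_exp_0 filterlim_inverse_at_top_right])
  then show "((\<lambda>t. flat_exp m t / t) \<longlongrightarrow> 0) (at_right 0)"
  proof (rule Lim_transform_eventually)
    show "\<forall>\<^sub>F t in at_right 0. inverse t ^ Suc m / exp (inverse t) = flat_exp m t / t"
      by (simp add: eventually_at_filter flat_exp_def field_simps exp_minus)
  qed
qed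

lemma flat_exp_has_derivative:
  "(flat_exp m has_real_derivative (- real m * flat_exp (Suc m) t + flat_exp (Suc (Suc m)) t)) (at t)"
proof -
  consider "t > 0" | "t < 0" | "t = 0" by linarith
  then show ?thesis
  proof cases
    case 1
    have "((\<lambda>t. exp (- (1 / t)) / t ^ m) has_real_derivative
        (- real m * flat_exp (Suc m) t + flat_exp (Suc (Suc m)) t)) (at t)"
    proof (cases m)
      case 0
      then show ?thesis using 1
        by (auto intro!: derivative_eq_intros simp: flat_exp_def field_simps power2_eq_square)
    next
      case (Suc k)
      have "((\<lambda>t. exp (- (1 / t))) has_real_derivative exp (- (1 / t)) / t\<^sup>2) (at t)"
        using 1 by (auto intro!: derivative_eq_intros simp: field_simps power2_eq_square)
      moreover have "((\<lambda>t. t ^ Suc k) has_real_derivative real (Suc k) * t ^ k) (at t)"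
        using DERIV_pow[of "Suc k" t] by simp
      ultimately show ?thesis
        unfolding Suc by (rule DERIV_cong[OF DERIV_divide])
          (use 1 in \<open>auto simp: flat_exp_def field_simps power2_eq_square\<close>)
    qed
    then show ?thesis
      by (rule has_field_derivative_transform_within_open[where S="{0<..}"])
         (use 1 in \<open>auto simp: flat_exp_def\<close>)
  next
    case 2
    have "((\<lambda>t. 0) has_real_derivative 0) (at t)" by simp
    then show ?thesis
      by (rule has_field_derivative_transform_within_open[where S="{..<0}", THEN DERIV_cong])
         (use 2 in \<open>auto simp: flat_exp_def\<close>)
  next
    case 3
    then show ?thesis
      using flat_exp_quotient_tendsto_0[of m]
      by (simp add: has_field_derivative_iff flat_exp_def)
  qed
qed

lemma flat_exp_0_bounds: "0 \<le> flat_exp 0 t" "flat_exp 0 t \<le> 1"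
  by (auto simp: flat_exp_def)

lemma flat_exp_0_tendsto:
  assumes "s > 0"
  shows "(\<lambda>n. flat_exp 0 (real n * s - 1)) \<longlonglongrightarrow> 1"
proof -
  have "filterlim (\<lambda>n. real n * s - 1) at_top sequentially"
    using filterlim_tendsto_add_at_top[OF tendsto_const[of "- 1"]
        filterlim_tendsto_pos_mult_at_top[OF tendsto_const assms filterlim_real_sequentially]]
    by (simp add: algebra_simps)
  then have "(\<lambda>n. inverse (real n * s - 1)) \<longlonglongrightarrow> 0"
    by (rule tendsto_inverse_0_at_top)
  then have "(\<lambda>n. exp (- inverse (real n * s - 1))) \<longlonglongrightarrow> exp (- 0)"
    by (intro tendsto_intros)
  then have "(\<lambda>n. exp (- inverse (real n * s - 1))) \<longlonglongrightarrow> 1" by simp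
  then show ?thesis
  proof (rule Lim_transform_eventually)
    have "\<forall>\<^sub>F n in sequentially. real n * s - 1 > 0"
      using \<open>filterlim (\<lambda>n. real n * s - 1) at_top sequentially\<close> unfolding filterlim_at_top_dense by blast
    then show "\<forall>\<^sub>F n in sequentially. exp (- inverse (real n * s - 1)) = flat_exp 0 (real n * s - 1)"
      by eventually_elim (simp add: flat_exp_def divide_inverse)
  qed
qed

text \<open>An algebra of functions that is closed under partial derivatives. This makes all its members infinitely
  differentiable without any bookkeeping of derivatives of a given order.\<close>

inductive_set flat_alg :: "('a::euclidean_space \<Rightarrow> real) set" where
  const: "(\<lambda>x. c) \<in> flat_alg"
| flat_exp: "(\<lambda>x. flat_exp m (c + x \<bullet> w)) \<in> flat_alg"
| add: "f \<in> flat_alg \<Longrightarrow> g \<in> flat_alg \<Longrightarrow> (\<lambda>x. f x + g x) \<in> flat_alg"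
| mult: "f \<in> flat_alg \<Longrightarrow> g \<in> flat_alg \<Longrightarrow> (\<lambda>x. f x * g x) \<in> flat_alg"

lemma flat_alg_derivative:
  assumes "f \<in> flat_alg"
  shows "\<exists>f'. (\<forall>x. (f has_derivative f' x) (at x)) \<and> (\<forall>b. (\<lambda>x. f' x b) \<in> flat_alg)"
  using assms
proof induction
  case (const c)
  then show ?case by (intro exI[of _ "\<lambda>_ _. 0"]) (auto intro: flat_alg.const)
next
  case (flat_exp m c w)
  let ?d = "\<lambda>x. - real m * flat_exp (Suc m) (c + x \<bullet> w) + flat_exp (Suc (Suc m)) (c + x \<bullet> w)"
  have "((\<lambda>x. flat_exp m (c + x \<bullet> w)) has_derivative (\<lambda>h. (h \<bullet> w) * ?d x)) (at x)" for x
  proof -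
    have 1: "((\<lambda>x. c + x \<bullet> w) has_derivative (\<lambda>h. h \<bullet> w)) (at x)"
      by (auto intro!: derivative_eq_intros)
    have 2: "(flat_exp m has_derivative (\<lambda>h. h * ?d x)) (at (c + x \<bullet> w))"
      using flat_exp_has_derivative[of m "c + x \<bullet> w"] unfolding has_field_derivative_def
      by (rule has_derivative_eq_rhs) (auto simp: fun_eq_iff)
    show ?thesis by (rule has_derivative_compose[OF 1 2])
  qed
  moreover have "(\<lambda>x. (b \<bullet> w) * ?d x) \<in> flat_alg" for b
    by (intro flat_alg.intros)
  ultimately show ?case by (intro exI[of _ "\<lambda>x h. (h \<bullet> w) * ?d x"]) auto
next
  case (add f g)
  then obtain f' g' where
    f: "\<And>x. (f has_derivative f' x) (at x)" "\<And>b. (\<lambda>x. f' x b) \<in> flat_alg" and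
    g: "\<And>x. (g has_derivative g' x) (at x)" "\<And>b. (\<lambda>x. g' x b) \<in> flat_alg" by blast
  show ?case
    by (intro exI[of _ "\<lambda>x h. f' x h + g' x h"] conjI allI has_derivative_add f g flat_alg.add)
next
  case (mult f g)
  then obtain f' g' where
    f: "\<And>x. (f has_derivative f' x) (at x)" "\<And>b. (\<lambda>x. f' x b) \<in> flat_alg" and
    g: "\<And>x. (g has_derivative g' x) (at x)" "\<And>b. (\<lambda>x. g' x b) \<in> flat_alg" by blast
  show ?case
    by (intro exI[of _ "\<lambda>x h. f x * g' x h + f' x h * g x"] conjI allI has_derivative_mult f g flat_alg.intros mult.hyps)
qed

lemma flat_alg_Ck_fun: "f \<in> flat_alg \<Longrightarrow> Ck_fun k f"
proof (induction k arbitrary: f)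
  case 0
  then show ?case using flat_alg_derivative[OF 0]
    by (auto intro!: continuous_at_imp_continuous_on dest: has_derivative_continuous)
next
  case (Suc k)
  from flat_alg_derivative[OF Suc.prems] obtain f' where
    f: "\<And>x. (f has_derivative f' x) (at x)" "\<And>b. (\<lambda>x. f' x b) \<in> flat_alg" by blast
  have "frechet_derivative f (at x) = f' x" for x using frechet_derivative_at[OF f(1)] by simp
  then show ?case using f Suc.IH by (auto simp: differentiable_def)
qed

lemma flat_alg_prod:
  assumes "finite I" "\<And>i. i \<in> I \<Longrightarrow> f i \<in> flat_alg"
  shows "(\<lambda>x. \<Prod>i\<in>I. f i x) \<in> flat_alg"
  using assms by (induction I rule: finite_induct) (auto intro: flat_alg.intros)

text \<open>The shift by one inside \<open>flat_exp\<close> keeps the support at distance \<open>1/n\<close> from the boundary of the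
  box, and the factor \<open>n\<close> drives the values inside the box to one.\<close>

definition box_bump :: "'a::euclidean_space \<Rightarrow> 'a \<Rightarrow> nat \<Rightarrow> 'a \<Rightarrow> real" where
  "box_bump a c n x = (\<Prod>b\<in>Basis. flat_exp 0 (real n * (x \<bullet> b - a \<bullet> b) - 1) * flat_exp 0 (real n * (c \<bullet> b - x \<bullet> b) - 1))"

lemma box_bump_flat_alg: "box_bump a c n \<in> flat_alg"
proof -
  have "(\<lambda>x. flat_exp 0 (real n * (x \<bullet> b - a \<bullet> b) - 1) * flat_exp 0 (real n * (c \<bullet> b - x \<bullet> b) - 1)) \<in> flat_alg" for b
    using flat_alg.mult[OF flat_alg.flat_exp[of 0 "- real n * (a \<bullet> b) - 1" "real n *\<^sub>R b"]
       flat_alg.flat_exp[of 0 "real n * (c \<bullet> b) - 1" "- real n *\<^sub>R b"]]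
    by (simp add: algebra_simps)
  from flat_alg_prod[OF finite_Basis this] show ?thesis
    by (simp add: box_bump_def[abs_def])
qed

lemma box_bump_bounds: "0 \<le> box_bump a c n x" "box_bump a c n x \<le> 1"
  by (auto simp: box_bump_def intro!: prod_nonneg prod_le_1 mult_nonneg_nonneg mult_le_one flat_exp_0_bounds)

lemma box_bump_support:
  "\<exists>K. compact K \<and> K \<subseteq> box a c \<and> {x. box_bump a c n x \<noteq> 0} \<subseteq> K"
proof (cases "n = 0")
  case True
  have "box_bump a c n x = 0" for x
    using nonempty_Basis True by (auto simp: box_bump_def flat_exp_def)
  then show ?thesis by (intro exI[of _ "{}"]) auto
next
  case False
  let ?K = "cbox (a + (1 / real n) *\<^sub>R One) (c - (1 / real n) *\<^sub>R One)"
  have "a \<bullet> b < x \<bullet> b \<and> x \<bullet> b < c \<bullet> b" if "b \<in> Basis" "x \<in> ?K" for x b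
  proof -
    have "a \<bullet> b + 1 / real n \<le> x \<bullet> b" "x \<bullet> b \<le> c \<bullet> b - 1 / real n"
      using that by (auto simp: mem_box inner_add_left inner_diff_left)
    moreover have "1 / real n > 0" using False by simp
    ultimately show ?thesis by linarith
  qed
  then have "?K \<subseteq> box a c" by (auto simp: mem_box(1))
  moreover have "x \<in> ?K" if "box_bump a c n x \<noteq> 0" for x
  proof -
    have "a \<bullet> b + 1 / real n \<le> x \<bullet> b \<and> x \<bullet> b \<le> c \<bullet> b - 1 / real n" if b: "b \<in> Basis" for b
    proof -
      have "flat_exp 0 (real n * (x \<bullet> b - a \<bullet> b) - 1) \<noteq> 0" "flat_exp 0 (real n * (c \<bullet> b - x \<bullet> b) - 1) \<noteq> 0"
        using \<open>box_bump a c n x \<noteq> 0\<close> b by (auto simp: box_bump_def)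
      then have "real n * (x \<bullet> b - a \<bullet> b) > 1" "real n * (c \<bullet> b - x \<bullet> b) > 1"
        by (auto simp: flat_exp_def split: if_splits)
      then show ?thesis using False by (simp add: field_simps)
    qed
    then show ?thesis by (auto simp: mem_box inner_add_left inner_diff_left)
  qed
  ultimately show ?thesis by (intro exI[of _ ?K]) auto
qed

lemma box_bump_tendsto:
  assumes "x \<in> box a c"
  shows "(\<lambda>n. box_bump a c n x) \<longlonglongrightarrow> 1"
proof -
  have "(\<lambda>n. box_bump a c n x) \<longlonglongrightarrow> (\<Prod>b\<in>(Basis::'a set). 1 * 1)"
    unfolding box_bump_def
    using assms by (intro tendsto_prod tendsto_mult flat_exp_0_tendsto) (auto simp: mem_box)
  then show ?thesis by simp
qed

lemma test_functionI:
  assumes "\<And>k. Ck_fun k \<phi>" "compact K" "K \<subseteq> D" "{x. \<phi> x \<noteq> 0} \<subseteq> K"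
  shows "test_function D \<phi>"
proof -
  have "closure {x. \<phi> x \<noteq> 0} \<subseteq> K"
    using assms by (intro closure_minimal compact_imp_closed)
  moreover from this have "compact (closure {x. \<phi> x \<noteq> 0})"
    using assms(2) by (metis closed_closure compact_Int_closed inf.absorb_iff2)
  ultimately show ?thesis using assms by (auto simp: test_function_def)
qed

text \<open>An open set is a countable union of open boxes \<open>X i\<close>. With bumps \<open>\<phi> i\<close> in these boxes,
  the function \<open>1 - (1 - \<phi> 0) \<cdots> (1 - \<phi> (n-1))\<close> is supported in finitely many of them and tends to one wherever
  one of the bumps does.\<close>

lemma test_functions_approx_open:
  fixes U :: "'a::euclidean_space set"
  assumes "open U"
  obtains \<phi> :: "nat \<Rightarrow> 'a \<Rightarrow> real" where "\<And>n. test_function U (\<phi> n)" "\<And>n x. \<bar>\<phi> n x\<bar> \<le> 1"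
    "\<And>x. (\<lambda>n. \<phi> n x) \<longlonglongrightarrow> indicator U x"
proof -
  obtain \<D> where D: "countable \<D>" "\<D> \<subseteq> Pow U" "\<And>X. X \<in> \<D> \<Longrightarrow> \<exists>a c. X = box a c" "\<Union>\<D> = U"
    using open_countable_Union_open_box[OF assms] by blast
  \<comment> \<open>The empty box ensures that the family is nonempty, so that it can be enumerated.\<close>
  define \<D>' where "\<D>' = insert {} \<D>"
  have D': "countable \<D>'" "\<D>' \<noteq> {}" using D by (auto simp: \<D>'_def)
  define X where "X = from_nat_into \<D>'"
  have "range X = \<D>'" unfolding X_def by (rule range_from_nat_into[OF D'(2,1)])
  have "box (0::'a) 0 = {}" using nonempty_Basis by (auto simp: mem_box)
  then have "\<exists>a c. Y = box a c" if "Y \<in> \<D>'" for Y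
    using D(3) that unfolding \<D>'_def by (metis insert_iff)
  then have Xbox: "\<exists>a c. X i = box a c" for i
    using \<open>range X = \<D>'\<close> by blast
  have XU: "X i \<subseteq> U" for i using D(2) \<open>range X = \<D>'\<close> by (auto simp: \<D>'_def)
  have "(\<Union>i. X i) = U" using D(4) \<open>range X = \<D>'\<close> unfolding \<D>'_def by simp
  then have XUn: "\<exists>i. x \<in> X i" if "x \<in> U" for x
    using that by blast
  from Xbox obtain a c where X: "\<And>i. X i = box (a i) (c i)" by metis
  define \<phi> where "\<phi> n x = 1 + (-1) * (\<Prod>i<n. (1 + (-1) * box_bump (a i) (c i) n x))" for n x
  have "test_function U (\<phi> n)" for n
  proof -
    have alg: "\<phi> n \<in> flat_alg"
      unfolding \<phi>_def[abs_def] by (intro flat_alg.intros flat_alg_prod finite_lessThan box_bump_flat_alg)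
    have "\<forall>i. \<exists>K. compact K \<and> K \<subseteq> X i \<and> {x. box_bump (a i) (c i) n x \<noteq> 0} \<subseteq> K"
      using box_bump_support unfolding X by blast
    from choice[OF this] obtain K where
      "\<forall>i. compact (K i) \<and> K i \<subseteq> X i \<and> {x. box_bump (a i) (c i) n x \<noteq> 0} \<subseteq> K i" ..
    then have K: "compact (K i)" "K i \<subseteq> X i" "{x. box_bump (a i) (c i) n x \<noteq> 0} \<subseteq> K i" for i
      by simp_all
    show ?thesis
    proof (rule test_functionI[where K="\<Union>i<n. K i"])
      show "{x. \<phi> n x \<noteq> 0} \<subseteq> (\<Union>i<n. K i)"
      proof
        fix x assume "x \<in> {x. \<phi> n x \<noteq> 0}"
        then have "(\<Prod>i<n. (1 + (-1) * box_bump (a i) (c i) n x)) \<noteq> 1" by (auto simp: \<phi>_def)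
        then have "\<exists>i<n. box_bump (a i) (c i) n x \<noteq> 0" by (rule contrapos_np) simp
        then obtain i where "i < n" "box_bump (a i) (c i) n x \<noteq> 0" by blast
        then show "x \<in> (\<Union>i<n. K i)" using K(3)[of i] by auto
      qed
      show "(\<Union>i<n. K i) \<subseteq> U" using K(2) XU by blast
    qed (use K in \<open>auto intro: flat_alg_Ck_fun[OF alg]\<close>)
  qed
  moreover have P: "0 \<le> (\<Prod>i<n. (1 + (-1) * box_bump (a i) (c i) n x))" "(\<Prod>i<n. (1 + (-1) * box_bump (a i) (c i) n x)) \<le> 1" for n x
    using box_bump_bounds by (auto intro!: prod_nonneg prod_le_1)
  then have "\<bar>\<phi> n x\<bar> \<le> 1" for n x unfolding \<phi>_def using P[of n x] by simp
  moreover have "(\<lambda>n. \<phi> n x) \<longlonglongrightarrow> indicator U x" for x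
  proof (cases "x \<in> U")
    case True
    then obtain j where j: "x \<in> X j" using XUn by blast
    have up: "(\<Prod>i<n. (1 + (-1) * box_bump (a i) (c i) n x)) \<le> 1 - box_bump (a j) (c j) n x" if "n > j" for n
    proof -
      have "(\<Prod>i<n. (1 + (-1) * box_bump (a i) (c i) n x))
         = (1 + (-1) * box_bump (a j) (c j) n x) * (\<Prod>i\<in>{..<n} - {j}. (1 + (-1) * box_bump (a i) (c i) n x))"
        using that by (intro prod.remove) auto
      also have "\<dots> \<le> (1 + (-1) * box_bump (a j) (c j) n x) * 1"
        using box_bump_bounds by (intro mult_left_mono prod_le_1) auto
      finally show ?thesis by simp
    qed
    have "(\<lambda>n. (\<Prod>i<n. (1 + (-1) * box_bump (a i) (c i) n x))) \<longlonglongrightarrow> 0"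
    proof (rule tendsto_sandwich[OF _ _ tendsto_const])
      show "\<forall>\<^sub>F n in sequentially. (\<Prod>i<n. (1 + (-1) * box_bump (a i) (c i) n x)) \<le> 1 - box_bump (a j) (c j) n x"
        using eventually_gt_at_top[of j] by eventually_elim (rule up)
      show "(\<lambda>n. 1 - box_bump (a j) (c j) n x) \<longlonglongrightarrow> 0"
        using tendsto_diff[OF tendsto_const[of 1] box_bump_tendsto[of x "a j" "c j"]] j X by simp
    qed (use P in auto)
    then have "(\<lambda>n. \<phi> n x) \<longlonglongrightarrow> 1 + (-1) * 0" unfolding \<phi>_def by (intro tendsto_intros)
    then show ?thesis using True by simp
  next
    case False
    have "\<phi> n x = 0" for n
    proof -
      have "x \<notin> X i" for i using False XU by auto
      then have "box_bump (a i) (c i) n x = 0" for i using box_bump_support[of "a i" "c i" n] X by auto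
      then show ?thesis by (simp add: \<phi>_def)
    qed
    then show ?thesis using False by simp
  qed
  ultimately show ?thesis by (rule that)
qed

lemma test_function_mono: "test_function U \<phi> \<Longrightarrow> U \<subseteq> D \<Longrightarrow> test_function D \<phi>"
  by (auto simp: test_function_def)

lemma test_function_continuous: "test_function D \<phi> \<Longrightarrow> continuous_on UNIV \<phi>"
  by (metis Ck_fun.simps(1) test_function_def)

lemma test_function_measurable [measurable_dest]:
  "test_function D \<phi> \<Longrightarrow> \<phi> \<in> borel_measurable borel"
  by (intro borel_measurable_continuous_onI test_function_continuous)

text \<open>Approximating indicators by test functions shows that \<open>f\<close> has integral zero over every open subset of
  \<open>D\<close>. The open subsets form an intersection-stable generator of the Borel sets of \<open>D\<close> that contains \<open>D\<close>
  itself, so the integral of \<open>f\<close> over every Borel set vanishes, in particular over the sets where a Borel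
  version of \<open>f\<close> is positive or negative.\<close>

lemma fundamental_lemma_variations:
  fixes f :: "'a::euclidean_space \<Rightarrow> real"
  assumes D: "open D" and f: "integrable (lebesgue_on D) f"
    and zero: "\<And>\<phi>. test_function D \<phi> \<Longrightarrow> (\<integral>x. f x * \<phi> x \<partial>lebesgue_on D) = 0"
  shows "AE x in lebesgue_on D. f x = 0"
proof -
  have DL: "D \<in> sets lebesgue" "D \<inter> space lebesgue \<in> sets lebesgue" using D by auto
  define h where "h x = indicator D x * f x" for x
  have h: "integrable lebesgue h"
    using f unfolding h_def[abs_def] by (subst (asm) integrable_restrict_space) (use DL in auto)
  have [measurable]: "h \<in> borel_measurable lebesgue" using h by auto
  have "(\<integral>x. indicator U x * h x \<partial>lebesgue) = 0" if "U \<in> {U. open U \<and> U \<subseteq> D}" for U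
  proof -
    have U: "open U" "U \<subseteq> D" using that by auto
    obtain \<phi> where \<phi>: "\<And>n. test_function U (\<phi> n)" "\<And>n x. \<bar>\<phi> n x\<bar> \<le> 1"
      "\<And>x. (\<lambda>n. \<phi> n x) \<longlonglongrightarrow> indicator U x"
      using test_functions_approx_open[OF U(1)] by blast
    have [measurable]: "\<phi> n \<in> borel_measurable lebesgue" for n
      using test_function_measurable[OF \<phi>(1)[of n]] by (simp add: measurable_completion)
    have [measurable]: "U \<in> sets lebesgue" using U by auto
    have "(\<lambda>n. \<integral>x. \<phi> n x * h x \<partial>lebesgue) \<longlonglongrightarrow> (\<integral>x. indicator U x * h x \<partial>lebesgue)"
    proof (rule integral_dominated_convergence[where w="\<lambda>x. norm (h x)"])
      show "AE x in lebesgue. (\<lambda>n. \<phi> n x * h x) \<longlonglongrightarrow> indicator U x * h x"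
        using \<phi>(3) by (intro AE_I2 tendsto_mult tendsto_const)
      show "AE x in lebesgue. norm (\<phi> n x * h x) \<le> norm (h x)" for n
        using \<phi>(2)[of n] by (intro AE_I2) (auto simp: abs_mult intro: mult_left_le_one_le)
    qed (use h in auto)
    moreover have "(\<integral>x. \<phi> n x * h x \<partial>lebesgue) = 0" for n
      using zero[OF test_function_mono[OF \<phi>(1) U(2)], of n]
      by (subst (asm) integral_restrict_space[OF DL(2)]) (auto simp: h_def mult_ac)
    ultimately show ?thesis by (simp add: LIMSEQ_const_iff)
  qed
  note open_zero = this
  have Int_stable_opens: "Int_stable {U. open U \<and> U \<subseteq> D}" by (auto simp: Int_stable_def)
  have sub_Pow: "{U. open U \<and> U \<subseteq> D} \<subseteq> Pow D" by auto
  have sig: "(\<integral>x. indicator A x * h x \<partial>lebesgue) = 0" and sigL: "A \<in> sets lebesgue"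
    if "A \<in> sigma_sets D {U. open U \<and> U \<subseteq> D}" for A
  proof -
    have L: "B \<in> sets lebesgue" if "B \<in> sigma_sets D {U. open U \<and> U \<subseteq> D}" for B
      using that by induction (use D in auto)
    show "A \<in> sets lebesgue" by (rule L[OF that])
    have int: "integrable lebesgue (\<lambda>x. indicator B x * h x)" if "B \<in> sets lebesgue" for B
      using integrable_mult_indicator[OF that h] by simp
    show "(\<integral>x. indicator A x * h x \<partial>lebesgue) = 0"
      using Int_stable_opens sub_Pow that
    proof (induction rule: sigma_sets_induct_disjoint)
      case (basic A) then show ?case by (rule open_zero)
    next
      case empty then show ?case by simp
    next
      case (compl A)
      have "(\<integral>x. indicator (D - A) x * h x \<partial>lebesgue) = (\<integral>x. indicator D x * h x - indicator A x * h x \<partial>lebesgue)"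
      proof (rule Bochner_Integration.integral_cong)
        have "A \<subseteq> D" using compl(1) by (intro sigma_sets_into_sp[of "{U. open U \<and> U \<subseteq> D}" D]) auto
        then show "indicator (D - A) x * h x = indicator D x * h x - indicator A x * h x" for x
          by (auto simp: indicator_def)
      qed simp
      also have "\<dots> = (\<integral>x. indicator D x * h x \<partial>lebesgue) - (\<integral>x. indicator A x * h x \<partial>lebesgue)"
        using compl L DL by (intro Bochner_Integration.integral_diff int) auto
      also have "\<dots> = 0" using compl open_zero[of D] D by simp
      finally show ?case .
    next
      case (union A)
      have AL: "A i \<in> sets lebesgue" for i using union L by auto
      have "(\<lambda>n. \<integral>x. (\<Sum>i<n. indicator (A i) x * h x) \<partial>lebesgue) \<longlonglongrightarrow> (\<integral>x. indicator (\<Union>i. A i) x * h x \<partial>lebesgue)"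
      proof (rule integral_dominated_convergence[where w="\<lambda>x. norm (h x)"])
        have s: "(\<lambda>i. indicator (A i) x :: real) sums indicator (\<Union>i. A i) x" for x
          by (rule indicator_sums) (use union(1) in \<open>auto simp: disjoint_family_on_def\<close>)
        show "AE x in lebesgue. (\<lambda>n. \<Sum>i<n. indicator (A i) x * h x) \<longlonglongrightarrow> indicator (\<Union>i. A i) x * h x"
          using s unfolding sum_distrib_right[symmetric] sums_def by (intro AE_I2 tendsto_mult tendsto_const) auto
        show "AE x in lebesgue. norm (\<Sum>i<n. indicator (A i) x * h x) \<le> norm (h x)" for n
        proof (rule AE_I2)
          fix x
          have "(\<Sum>i<n. indicator (A i) x :: real) \<le> (\<Sum>i. indicator (A i) x)"
            using s[of x] by (intro sum_le_suminf) (auto simp: sums_iff)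
          also have "\<dots> \<le> 1" using s[of x] by (auto simp: sums_iff indicator_def)
          finally have "\<bar>\<Sum>i<n. indicator (A i) x :: real\<bar> \<le> 1" by (simp add: sum_nonneg)
          then show "norm (\<Sum>i<n. indicator (A i) x * h x) \<le> norm (h x)"
            unfolding sum_distrib_right[symmetric] by (simp add: abs_mult mult_left_le_one_le)
        qed
      qed (use h AL in auto)
      moreover have "(\<integral>x. (\<Sum>i<n. indicator (A i) x * h x) \<partial>lebesgue) = 0" for n
        using union AL by (subst Bochner_Integration.integral_sum) (auto intro: int)
      ultimately show ?case by (simp add: LIMSEQ_const_iff)
    qed
  qed
  have borelD: "A \<in> sigma_sets D {U. open U \<and> U \<subseteq> D}" if "A \<in> sets borel" "A \<subseteq> D" for A
  proof -
    have "A \<in> sigma_sets UNIV {U. open U}" using that(1) by (simp add: borel_def)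
    then have "D \<inter> A \<in> (\<inter>) D ` sigma_sets UNIV {U. open U}" by blast
    also have "\<dots> = sigma_sets D ((\<inter>) D ` {U. open U})"
      by (rule sigma_sets_Int) (use D in auto)
    also have "(\<inter>) D ` {U. open U} = {U. open U \<and> U \<subseteq> D}" using D by auto
    finally have "A \<inter> D \<in> sigma_sets D {U. open U \<and> U \<subseteq> D}" by (simp add: Int_commute)
    then show ?thesis using that(2) by (simp add: Int_absorb2)
  qed
  obtain k where k: "k \<in> borel_measurable lborel" "AE x in lborel. h x = k x"
    using completion_ex_borel_measurable_real[OF \<open>h \<in> borel_measurable lebesgue\<close>] by auto
  define P N where "P = {x \<in> D. 0 < k x}" and "N = {x \<in> D. k x < 0}"
  have PN: "P \<in> sets borel" "N \<in> sets borel" "P \<subseteq> D" "N \<subseteq> D"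
    using k(1) D by (auto simp: P_def N_def intro!: borel_measurable_less sets.Int[of D borel, simplified Int_def mem_Collect_eq])
  have sgn_zero: "AE x in lebesgue. indicator A x * h x = 0"
    if A: "A \<in> sets borel" "A \<subseteq> D" and nonneg: "AE x in lebesgue. 0 \<le> s * (indicator A x * h x)" and "s \<noteq> 0" for A s
  proof -
    have AL: "A \<in> sets lebesgue" using A by auto
    have "integrable lebesgue (\<lambda>x. s * (indicator A x * h x))"
      using integrable_mult_indicator[OF AL h] by simp
    moreover have "(\<integral>x. s * (indicator A x * h x) \<partial>lebesgue) = 0"
      using sig[OF borelD[OF A]] by simp
    ultimately have "AE x in lebesgue. s * (indicator A x * h x) = 0"
      using nonneg by (subst (asm) integral_nonneg_eq_0_iff_AE) auto
    then show ?thesis using \<open>s \<noteq> 0\<close> by simp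
  qed
  have hk: "AE x in lebesgue. h x = k x" using k(2) by (rule AE_completion)
  have "AE x in lebesgue. indicator P x * h x = 0"
    by (rule sgn_zero[of P 1]) (use PN hk in \<open>auto simp: P_def elim!: eventually_mono split: split_indicator\<close>)
  moreover have "AE x in lebesgue. indicator N x * h x = 0"
    by (rule sgn_zero[of N "-1"]) (use PN hk in \<open>auto simp: N_def elim!: eventually_mono split: split_indicator\<close>)
  ultimately have "AE x in lebesgue. x \<in> D \<longrightarrow> f x = 0"
    using hk
  proof eventually_elim
    case (elim x)
    then show ?case by (auto simp: P_def N_def h_def indicator_def split: if_splits)
  qed
  then show ?thesis using DL by (subst AE_restrict_space_iff) auto
qed

section \<open>Weak gradients\<close>

lemma integral_translation_lborel:
  fixes h :: "'a::euclidean_space \<Rightarrow> real"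
  assumes [measurable]: "h \<in> borel_measurable borel"
  shows "(\<integral>x. h (x + c) \<partial>lborel) = (\<integral>x. h x \<partial>lborel)"
proof -
  have "(\<integral>x. h x \<partial>lborel) = (\<integral>x. h x \<partial>distr lborel borel ((+) c))"
    by (simp add: lborel_distr_plus)
  also have "\<dots> = (\<integral>x. h (c + x) \<partial>lborel)" by (subst integral_distr) auto
  finally show ?thesis by (simp add: add.commute)
qed

lemma integrable_lborel_compact_support:
  fixes f :: "'a::euclidean_space \<Rightarrow> real"
  assumes "compact K" "\<And>x. x \<notin> K \<Longrightarrow> f x = 0" "continuous_on UNIV f"
  shows "integrable lborel f"
proof -
  have "integrable lborel (\<lambda>x. indicator K x *\<^sub>R f x)"
    by (rule borel_integrable_compact[OF assms(1) continuous_on_subset[OF assms(3)]]) simp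
  also have "(\<lambda>x. indicator K x *\<^sub>R f x) = f"
    using assms(2) by (auto simp: fun_eq_iff indicator_def)
  finally show ?thesis .
qed

text \<open>Lebesgue measure is translation invariant, so all difference quotients of \<open>h\<close> have integral zero; dominated
  convergence transfers this to the derivative. This replaces integration along lines by Fubini.\<close>

lemma integral_directional_derivative_eq_0:
  fixes h :: "'a::euclidean_space \<Rightarrow> real"
  assumes h: "\<And>x. (h has_derivative h' x) (at x)"
    and cont: "continuous_on UNIV (\<lambda>x. h' x b)"
    and K: "compact K" "\<And>x. x \<notin> K \<Longrightarrow> h x = 0"
  shows "(\<integral>x. h' x b \<partial>lborel) = 0"
proof -
  have hc: "continuous_on UNIV h"
    by (rule continuous_at_imp_continuous_on) (use h in \<open>auto dest: has_derivative_continuous\<close>)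
  have [measurable]: "h \<in> borel_measurable borel" "(\<lambda>x. h' x b) \<in> borel_measurable borel"
    using hc cont by (auto intro: borel_measurable_continuous_onI)
  have h'0: "h' x b = 0" if "x \<notin> K" for x
  proof -
    have "((\<lambda>x. 0) has_derivative (\<lambda>_. 0)) (at x)" by simp
    then have "(h has_derivative (\<lambda>_. 0)) (at x)"
      by (rule has_derivative_transform_within_open[where s="- K"])
         (use that K compact_imp_closed[OF K(1)] in auto)
    from has_derivative_unique[OF h this] show ?thesis by simp
  qed
  have "compact ((\<lambda>x. h' x b) ` K)"
    by (intro compact_continuous_image continuous_on_subset[OF cont] K) auto
  then have "bounded ((\<lambda>x. h' x b) ` K)" by (rule compact_imp_bounded)
  then obtain B0 where B0: "\<And>x. x \<in> K \<Longrightarrow> \<bar>h' x b\<bar> \<le> B0" by (auto simp: bounded_iff)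
  define B where "B = max B0 0"
  have B: "\<bar>h' x b\<bar> \<le> B" for x
  proof (cases "x \<in> K")
    case True
    then show ?thesis using B0[OF True] by (simp add: B_def)
  next
    case False
    then show ?thesis by (simp add: B_def h'0)
  qed
  obtain R where R: "\<And>x. x \<in> K \<Longrightarrow> norm x \<le> R" using compact_imp_bounded[OF K(1)] by (auto simp: bounded_iff)
  define q where "q n x = (h (x + (1 / real (Suc n)) *\<^sub>R b) - h x) * real (Suc n)" for n x
  have line: "((\<lambda>t. h (x + t *\<^sub>R b)) has_real_derivative h' (x + t *\<^sub>R b) b) (at t)" for x t
  proof -
    have lin: "linear (h' (x + t *\<^sub>R b))" using h has_derivative_linear by blast
    have 1: "((\<lambda>t. x + t *\<^sub>R b) has_derivative (\<lambda>s. s *\<^sub>R b)) (at t)"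
      by (auto intro!: derivative_eq_intros)
    have "((\<lambda>t. h (x + t *\<^sub>R b)) has_derivative (\<lambda>s. h' (x + t *\<^sub>R b) (s *\<^sub>R b))) (at t)"
      by (rule has_derivative_compose[OF 1 h])
    moreover have "(\<lambda>s. h' (x + t *\<^sub>R b) (s *\<^sub>R b)) = (*) (h' (x + t *\<^sub>R b) b)"
      using linear_scale[OF lin] by (auto simp: fun_eq_iff)
    ultimately show ?thesis by (simp add: has_field_derivative_def)
  qed
  have lim: "(\<lambda>n. q n x) \<longlonglongrightarrow> h' x b" for x
  proof -
    have "((\<lambda>t. (h (x + t *\<^sub>R b) - h x) / t) \<longlongrightarrow> h' x b) (at 0)"
      using line[of x 0] by (simp add: DERIV_def)
    moreover have "filterlim (\<lambda>n. 1 / real (Suc n)) (at 0) sequentially"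
      using LIMSEQ_inverse_real_of_nat by (auto simp: filterlim_at inverse_eq_divide)
    ultimately have "(\<lambda>n. (h (x + (1 / real (Suc n)) *\<^sub>R b) - h x) / (1 / real (Suc n))) \<longlonglongrightarrow> h' x b"
      by (rule filterlim_compose)
    then show ?thesis by (simp add: q_def)
  qed
  have qB: "\<bar>q n x\<bar> \<le> B" for n x
  proof -
    have "\<exists>z>0. z < 1 / real (Suc n) \<and> h (x + (1 / real (Suc n)) *\<^sub>R b) - h (x + 0 *\<^sub>R b)
        = (1 / real (Suc n) - 0) * h' (x + z *\<^sub>R b) b"
      by (rule MVT2) (use line in auto)
    then obtain z where "h (x + (1 / real (Suc n)) *\<^sub>R b) - h x = (1 / real (Suc n)) * h' (x + z *\<^sub>R b) b" by auto
    then have "q n x = h' (x + z *\<^sub>R b) b" unfolding q_def by simp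
    then show ?thesis using B by simp
  qed
  have q0: "q n x = 0" if "x \<notin> cball 0 (R + norm b)" for n x
  proof -
    have "norm ((1 / real (Suc n)) *\<^sub>R b) \<le> 1 * norm b"
      unfolding norm_scaleR by (intro mult_right_mono) auto
    moreover have "norm x \<le> norm (x + (1 / real (Suc n)) *\<^sub>R b) + norm ((1 / real (Suc n)) *\<^sub>R b)"
      using norm_triangle_ineq4[of "x + (1 / real (Suc n)) *\<^sub>R b" "(1 / real (Suc n)) *\<^sub>R b"] by simp
    moreover have "norm x > R + norm b" using that by simp
    ultimately have "norm (x + (1 / real (Suc n)) *\<^sub>R b) > R" "norm x > R"
      using norm_ge_zero[of b] by linarith+
    then have "x + (1 / real (Suc n)) *\<^sub>R b \<notin> K" "x \<notin> K" using R by fastforce+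
    then show ?thesis by (simp add: q_def K)
  qed
  have hint: "integrable lborel h"
    by (rule integrable_lborel_compact_support[OF K hc])
  have "(\<lambda>n. \<integral>x. q n x \<partial>lborel) \<longlonglongrightarrow> (\<integral>x. h' x b \<partial>lborel)"
  proof (rule integral_dominated_convergence[where w="\<lambda>x. B * indicator (cball 0 (R + norm b)) x"])
    have "emeasure lborel (cball 0 (R + norm b)) < \<infinity>"
      by (rule emeasure_bounded_finite[OF bounded_cball])
    then show "integrable lborel (\<lambda>x. B * indicator (cball 0 (R + norm b)) x :: real)"
      by (intro integrable_mult_right integrable_real_indicator) auto
    show "AE x in lborel. norm (q n x) \<le> B * indicator (cball 0 (R + norm b)) x" for n
    proof (rule AE_I2)
      fix x show "norm (q n x) \<le> B * indicator (cball 0 (R + norm b)) x"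
        using qB[of n x] q0[of x n] by (cases "x \<in> cball 0 (R + norm b)") auto
    qed
    show "(\<lambda>x. q n x) \<in> borel_measurable lborel" for n unfolding q_def by measurable
  qed (use lim in auto)
  moreover have "(\<integral>x. q n x \<partial>lborel) = 0" for n
  proof -
    have "integrable lborel (\<lambda>x. h (x + (1 / real (Suc n)) *\<^sub>R b))"
      by (rule integrable_lborel_compact_support[of "(\<lambda>x. x - (1 / real (Suc n)) *\<^sub>R b) ` K"])
        (auto intro!: compact_continuous_image continuous_intros K continuous_on_compose2[OF hc] simp: image_iff algebra_simps)
    then show ?thesis
      unfolding q_def using hint integral_translation_lborel[of h] by simp
  qed
  ultimately show ?thesis by (simp add: LIMSEQ_const_iff)
qed

abbreviation partial_deriv :: "('a::euclidean_space \<Rightarrow> real) \<Rightarrow> 'a \<Rightarrow> 'a \<Rightarrow> real" where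
  "partial_deriv \<phi> b x \<equiv> frechet_derivative \<phi> (at x) b"

definition classical_gradient :: "('a::euclidean_space \<Rightarrow> real) \<Rightarrow> 'a \<Rightarrow> 'a" where
  "classical_gradient \<phi> x = (\<Sum>b\<in>Basis. partial_deriv \<phi> b x *\<^sub>R b)"

lemma classical_gradient_inner: "b \<in> Basis \<Longrightarrow> classical_gradient \<phi> x \<bullet> b = partial_deriv \<phi> b x"
  by (simp add: classical_gradient_def inner_sum_left inner_Basis if_distrib sum.delta' cong: if_cong)

lemma Ck_fun_add: "Ck_fun k f \<Longrightarrow> Ck_fun k g \<Longrightarrow> Ck_fun k (\<lambda>x. f x + g x)"
proof (induction k arbitrary: f g)
  case (Suc k)
  have "frechet_derivative (\<lambda>x. f x + g x) (at x) = (\<lambda>h. frechet_derivative f (at x) h + frechet_derivative g (at x) h)" for x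
    using Suc.prems by (intro frechet_derivative_at[symmetric] has_derivative_add frechet_derivative_works[THEN iffD1]) auto
  then show ?case using Suc by auto
qed (auto intro: continuous_on_add)

lemma Ck_fun_cmult: "Ck_fun k f \<Longrightarrow> Ck_fun k (\<lambda>x. c * f x)"
proof (induction k arbitrary: f)
  case (Suc k)
  have "frechet_derivative (\<lambda>x. c * f x) (at x) = (\<lambda>h. c * frechet_derivative f (at x) h)" for x
    using Suc.prems by (intro frechet_derivative_at[symmetric] has_derivative_mult_right frechet_derivative_works[THEN iffD1]) auto
  then show ?case using Suc by auto
qed (auto intro: continuous_on_mult_left)

lemma test_function_support:
  assumes "test_function D \<phi>"
  obtains K where "compact K" "K \<subseteq> D" "\<And>x. x \<notin> K \<Longrightarrow> \<phi> x = 0"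
proof (rule that[of "closure {x. \<phi> x \<noteq> 0}"])
  show "\<phi> x = 0" if "x \<notin> closure {x. \<phi> x \<noteq> 0}" for x
    using that closure_subset[of "{x. \<phi> x \<noteq> 0}"] by blast
qed (use assms in \<open>auto simp: test_function_def\<close>)

lemma test_function_add:
  assumes "test_function D f" "test_function D g"
  shows "test_function D (\<lambda>x. f x + g x)"
proof -
  obtain K where K: "compact K" "K \<subseteq> D" "\<And>x. x \<notin> K \<Longrightarrow> f x = 0"
    using test_function_support[OF assms(1)] by metis
  obtain L where L: "compact L" "L \<subseteq> D" "\<And>x. x \<notin> L \<Longrightarrow> g x = 0"
    using test_function_support[OF assms(2)] by metis
  have "{x. f x + g x \<noteq> 0} \<subseteq> K \<union> L" using K(3) L(3) by fastforce
  then show ?thesis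
    by (intro test_functionI[where K="K \<union> L"] Ck_fun_add compact_Un K L) (use assms K L in \<open>auto simp: test_function_def\<close>)
qed

lemma test_function_cmult:
  assumes "test_function D f"
  shows "test_function D (\<lambda>x. c * f x)"
proof -
  obtain K where K: "compact K" "K \<subseteq> D" "\<And>x. x \<notin> K \<Longrightarrow> f x = 0"
    using test_function_support[OF assms(1)] by metis
  have "{x. c * f x \<noteq> 0} \<subseteq> K" using K(3) by fastforce
  then show ?thesis
    by (intro test_functionI[where K="K"] Ck_fun_cmult K) (use assms K in \<open>auto simp: test_function_def\<close>)
qed

lemma test_function_0: "test_function D (\<lambda>x. 0)"
  using flat_alg_Ck_fun[OF flat_alg.const[of 0]] by (intro test_functionI[of _ "{}"]) auto

lemma test_function_has_derivative:
  assumes "test_function D \<phi>"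
  shows "(\<phi> has_derivative frechet_derivative \<phi> (at x)) (at x)"
  using assms Ck_fun.simps(2)[of 0 \<phi>] unfolding test_function_def
  by (metis frechet_derivative_works)

lemma test_function_partial_continuous:
  assumes "test_function D \<phi>" "b \<in> Basis"
  shows "continuous_on UNIV (partial_deriv \<phi> b)"
  using assms Ck_fun.simps(2)[of 0 \<phi>] unfolding test_function_def
  by (metis Ck_fun.simps(1))

lemma test_function_partial_support:
  assumes "test_function D \<phi>" "closed K" "\<And>x. x \<notin> K \<Longrightarrow> \<phi> x = 0" "x \<notin> K"
  shows "partial_deriv \<phi> b x = 0"
proof -
  have "((\<lambda>x. 0) has_derivative (\<lambda>_. 0)) (at x)" by simp
  then have "(\<phi> has_derivative (\<lambda>_. 0)) (at x)"
    by (rule has_derivative_transform_within_open[where s="- K"]) (use assms in auto)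
  from has_derivative_unique[OF test_function_has_derivative[OF assms(1)] this] show ?thesis by simp
qed

lemma continuous_bounded_if_compact_support:
  fixes f :: "'a::euclidean_space \<Rightarrow> real"
  assumes "continuous_on UNIV f" "compact K" "\<And>x. x \<notin> K \<Longrightarrow> f x = 0"
  obtains B where "\<And>x. \<bar>f x\<bar> \<le> B" "B \<ge> 0"
proof -
  have "bounded (f ` K)"
    by (intro compact_imp_bounded compact_continuous_image continuous_on_subset[OF assms(1)] assms) auto
  then obtain B0 where B0: "\<And>x. x \<in> K \<Longrightarrow> \<bar>f x\<bar> \<le> B0" by (auto simp: bounded_iff)
  show ?thesis
  proof (rule that[of "max B0 0"])
    show "\<bar>f x\<bar> \<le> max B0 0" for x
      using B0[of x] assms(3)[of x] by (cases "x \<in> K") auto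
  qed auto
qed

locale bounded_open_set =
  fixes D :: "'a::euclidean_space set"
  assumes open_D: "open D" and bounded_D: "bounded D"
begin

abbreviation "M \<equiv> lebesgue_on D"

lemma D_lebesgue [simp]: "D \<in> sets lebesgue" "D \<inter> space lebesgue \<in> sets lebesgue"
  using open_D by auto

lemma finite_measure_M: "finite_measure M"
proof
  have "emeasure lebesgue D < \<infinity>"
    using emeasure_bounded_finite[OF bounded_D] open_D by (simp add: emeasure_completion)
  then show "emeasure M (space M) \<noteq> \<infinity>"
    by (simp add: emeasure_restrict_space space_restrict_space)
qed

lemma borel_measurable_M:
  "f \<in> borel_measurable borel \<Longrightarrow> f \<in> borel_measurable M"
  by (intro measurable_restrict_space1) (simp add: measurable_completion)

lemma integral_M_eq_lborel:
  fixes f :: "'a \<Rightarrow> real"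
  assumes "f \<in> borel_measurable borel" "\<And>x. x \<notin> D \<Longrightarrow> f x = 0"
  shows "(\<integral>x. f x \<partial>M) = (\<integral>x. f x \<partial>lborel)"
proof -
  have "(\<integral>x. f x \<partial>M) = (\<integral>x. indicator D x *\<^sub>R f x \<partial>lebesgue)"
    by (rule integral_restrict_space) simp
  also have "(\<lambda>x. indicator D x *\<^sub>R f x) = f" using assms(2) by (auto simp: fun_eq_iff indicator_def)
  also have "(\<integral>x. f x \<partial>lebesgue) = (\<integral>x. f x \<partial>lborel)"
    by (rule integral_completion) (use assms in simp)
  finally show ?thesis .
qed

lemma continuous_compact_support_L2:
  fixes f :: "'a \<Rightarrow> real"
  assumes "continuous_on UNIV f" "compact K" "\<And>x. x \<notin> K \<Longrightarrow> f x = 0"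
  shows "f \<in> L2_space M"
proof -
  obtain B where "\<And>x. \<bar>f x\<bar> \<le> B" by (rule continuous_bounded_if_compact_support[OF assms]) auto
  then show ?thesis
    using borel_measurable_M[OF borel_measurable_continuous_onI[OF assms(1)]]
    by (intro L2_space_bounded[OF finite_measure_M]) auto
qed

lemma test_function_L2: "test_function D \<phi> \<Longrightarrow> \<phi> \<in> L2_space M"
  by (metis continuous_compact_support_L2 test_function_continuous test_function_support)

lemma test_function_partial_L2: 
  assumes "test_function D \<phi>" "b \<in> Basis" shows "partial_deriv \<phi> b \<in> L2_space M"
proof -
  obtain K where K: "compact K" "K \<subseteq> D" "\<And>x. x \<notin> K \<Longrightarrow> \<phi> x = 0"
    using test_function_support[OF assms(1)] by metis
  show ?thesis
    by (rule continuous_compact_support_L2[OF test_function_partial_continuous[OF assms] K(1)])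
       (rule test_function_partial_support[OF assms(1) compact_imp_closed[OF K(1)] K(3)])
qed

lemma L2_scaleR_const: "f \<in> L2_space M \<Longrightarrow> (\<lambda>x. f x *\<^sub>R (c::'b::euclidean_space)) \<in> L2_space M"
  for f :: "'a \<Rightarrow> real"
  by (auto simp: L2_space_def power_mult_distrib)

lemma L2_inner_const: 
  fixes F :: "'a \<Rightarrow> 'b::euclidean_space"
  assumes "F \<in> L2_space M" 
  shows "(\<lambda>x. F x \<bullet> c) \<in> L2_space M"
proof (rule L2_dominated)
  have [measurable]: "F \<in> borel_measurable M" using assms by (rule L2_spaceD)
  show "(\<lambda>x. F x \<bullet> c) \<in> borel_measurable M" by measurable
  show "integrable M (\<lambda>x. (norm c)\<^sup>2 * (norm (F x))\<^sup>2)" using assms by (auto simp: L2_space_def)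
  show "AE x in M. (norm (F x \<bullet> c))\<^sup>2 \<le> (norm c)\<^sup>2 * (norm (F x))\<^sup>2"
  proof (rule AE_I2)
    fix x
    have "(norm (F x \<bullet> c))\<^sup>2 \<le> (norm (F x) * norm c)\<^sup>2"
      by (intro power_mono) (auto simp: Cauchy_Schwarz_ineq2)
    then show "(norm (F x \<bullet> c))\<^sup>2 \<le> (norm c)\<^sup>2 * (norm (F x))\<^sup>2" by (simp add: power_mult_distrib mult.commute)
  qed
qed

lemma classical_gradient_L2:
  assumes "test_function D \<phi>" shows "classical_gradient \<phi> \<in> L2_space M"
proof -
  have "(\<lambda>x. \<Sum>b\<in>B. partial_deriv \<phi> b x *\<^sub>R b) \<in> L2_space M" if "finite B" "B \<subseteq> Basis" for B
    using that
  proof (induction B rule: finite_induct)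
    case empty then show ?case by (simp add: L2_space_def)
  next
    case (insert b B)
    then show ?case
      using L2_space_add[OF L2_scaleR_const[OF test_function_partial_L2[OF assms, of b], of b] insert.IH] by simp
  qed
  from this[OF finite_Basis] show ?thesis by (simp add: classical_gradient_def[abs_def])
qed

lemma integration_by_parts:
  assumes \<phi>: "test_function D \<phi>" and \<psi>: "test_function D \<psi>" and b: "b \<in> Basis"
  shows "(\<integral>x. \<phi> x * partial_deriv \<psi> b x \<partial>M) = - (\<integral>x. partial_deriv \<phi> b x * \<psi> x \<partial>M)"
proof -
  obtain K where K: "compact K" "K \<subseteq> D" "\<And>x. x \<notin> K \<Longrightarrow> \<phi> x = 0"
    using test_function_support[OF \<phi>] by metis
  let ?d = "\<lambda>x h. \<phi> x * frechet_derivative \<psi> (at x) h + frechet_derivative \<phi> (at x) h * \<psi> x"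
  note c = test_function_continuous[OF \<phi>] test_function_continuous[OF \<psi>]
    test_function_partial_continuous[OF \<phi> b] test_function_partial_continuous[OF \<psi> b]
  have cont: "continuous_on UNIV (\<lambda>x. ?d x b)" by (intro continuous_intros c)
  have "(\<integral>x. ?d x b \<partial>lborel) = 0"
  proof (rule integral_directional_derivative_eq_0)
    show "((\<lambda>x. \<phi> x * \<psi> x) has_derivative ?d x) (at x)" for x
      by (rule has_derivative_mult[OF test_function_has_derivative[OF \<phi>] test_function_has_derivative[OF \<psi>]])
    show "compact K" by (rule K)
    show "\<phi> x * \<psi> x = 0" if "x \<notin> K" for x using K(3)[OF that] by simp
  qed (rule cont)
  moreover have "?d x b = 0" if "x \<notin> D" for x
  proof -
    have "x \<notin> K" using K(2) that by auto
    then show ?thesis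
      using K(3)[of x] test_function_partial_support[OF \<phi> compact_imp_closed[OF K(1)] K(3), of x b] by simp
  qed
  ultimately have "(\<integral>x. ?d x b \<partial>M) = 0"
    using integral_M_eq_lborel[OF borel_measurable_continuous_onI[OF cont]] by simp
  moreover have "integrable M (\<lambda>x. \<phi> x * partial_deriv \<psi> b x)" "integrable M (\<lambda>x. partial_deriv \<phi> b x * \<psi> x)"
    using L2_inner_integrable[OF test_function_L2[OF \<phi>] test_function_partial_L2[OF \<psi> b]]
      L2_inner_integrable[OF test_function_partial_L2[OF \<phi> b] test_function_L2[OF \<psi>]] by auto
  ultimately show ?thesis by simp
qed

lemma is_weak_gradient_classical:
  assumes "test_function D \<phi>"
  shows "is_weak_gradient D \<phi> (classical_gradient \<phi>)"
  unfolding is_weak_gradient_def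
  using classical_gradient_L2[OF assms] integration_by_parts[OF assms] by (auto simp: classical_gradient_inner)

lemma is_weak_gradient_unique:
  assumes F: "is_weak_gradient D v F" and G: "is_weak_gradient D v G"
  shows "AE x in M. F x = G x"
proof -
  have L2: "(\<lambda>x. F x - G x) \<in> L2_space M"
    using F G by (intro L2_space_diff) (auto simp: is_weak_gradient_def)
  have "AE x in M. (F x - G x) \<bullet> b = 0" if b: "b \<in> Basis" for b
  proof (rule fundamental_lemma_variations[OF open_D])
    show "integrable M (\<lambda>x. (F x - G x) \<bullet> b)"
      by (rule L2_space_integrable[OF finite_measure_M L2_inner_const[OF L2]])
    fix \<phi> assume \<phi>: "test_function D \<phi>"
    have i: "integrable M (\<lambda>x. (H x \<bullet> b) * \<phi> x)" if "H \<in> L2_space M" for H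
      using L2_inner_integrable[OF L2_inner_const[OF that] test_function_L2[OF \<phi>]] by simp
    have "(\<integral>x. v x * partial_deriv \<phi> b x \<partial>M) = - (\<integral>x. (F x \<bullet> b) * \<phi> x \<partial>M)"
      using F \<phi> b by (simp add: is_weak_gradient_def)
    moreover have "(\<integral>x. v x * partial_deriv \<phi> b x \<partial>M) = - (\<integral>x. (G x \<bullet> b) * \<phi> x \<partial>M)"
      using G \<phi> b by (simp add: is_weak_gradient_def)
    ultimately have "(\<integral>x. (F x \<bullet> b) * \<phi> x \<partial>M) = (\<integral>x. (G x \<bullet> b) * \<phi> x \<partial>M)" by simp
    then show "(\<integral>x. ((F x - G x) \<bullet> b) * \<phi> x \<partial>M) = 0"
      using F G i by (auto simp: is_weak_gradient_def inner_diff_left left_diff_distrib)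
  qed
  then have "AE x in M. \<forall>b\<in>Basis. (F x - G x) \<bullet> b = 0"
    by (subst AE_ball_countable) (auto intro: countable_finite)
  then show ?thesis
    by eventually_elim (metis euclidean_all_zero_iff eq_iff_diff_eq_0)
qed

lemma is_weak_gradient_add:
  assumes "is_weak_gradient D v F" "is_weak_gradient D w G" "v \<in> L2_space M" "w \<in> L2_space M"
  shows "is_weak_gradient D (\<lambda>x. v x + w x) (\<lambda>x. F x + G x)"
  unfolding is_weak_gradient_def
proof (intro conjI allI impI)
  have FG: "F \<in> L2_space M" "G \<in> L2_space M" using assms by (auto simp: is_weak_gradient_def)
  then show "(\<lambda>x. F x + G x) \<in> L2_space M" by (rule L2_space_add)
  fix \<phi> and b :: 'a assume "test_function D \<phi> \<and> b \<in> Basis"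
  then have \<phi>: "test_function D \<phi>" and b: "b \<in> Basis" by auto
  have i: "integrable M (\<lambda>x. (H x \<bullet> b) * \<phi> x)" if "H \<in> L2_space M" for H
    using L2_inner_integrable[OF L2_inner_const[OF that] test_function_L2[OF \<phi>]] by simp
  have j: "integrable M (\<lambda>x. u x * partial_deriv \<phi> b x)" if "u \<in> L2_space M" for u
    using L2_inner_integrable[OF that test_function_partial_L2[OF \<phi> b]] by simp
  have "(\<integral>x. v x * partial_deriv \<phi> b x \<partial>M) = - (\<integral>x. (F x \<bullet> b) * \<phi> x \<partial>M)"
    "(\<integral>x. w x * partial_deriv \<phi> b x \<partial>M) = - (\<integral>x. (G x \<bullet> b) * \<phi> x \<partial>M)"
    using assms \<phi> b by (auto simp: is_weak_gradient_def)
  then show "(\<integral>x. (v x + w x) * partial_deriv \<phi> b x \<partial>M) = - (\<integral>x. ((F x + G x) \<bullet> b) * \<phi> x \<partial>M)"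
    using i[OF FG(1)] i[OF FG(2)] j[OF assms(3)] j[OF assms(4)]
    by (simp add: inner_add_left distrib_right)
qed

lemma is_weak_gradient_cmult:
  assumes "is_weak_gradient D v F"
  shows "is_weak_gradient D (\<lambda>x. c * v x) (\<lambda>x. c *\<^sub>R F x)"
  using assms L2_space_cmult[of F M c] by (auto simp: is_weak_gradient_def mult.assoc)

text \<open>Both sides of the defining identity are \<open>L\<^sup>2\<close>-continuous in the function and in its weak gradient.\<close>

lemma is_weak_gradient_limit:
  assumes v: "\<And>n. v n \<in> L2_space M" and F: "\<And>n. is_weak_gradient D (v n) (F n)"
    and w: "w \<in> L2_space M" and G: "G \<in> L2_space M"
    and vw: "(\<lambda>n. L2_norm M (\<lambda>x. v n x - w x)) \<longlonglongrightarrow> 0"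
    and FG: "(\<lambda>n. L2_norm M (\<lambda>x. F n x - G x)) \<longlonglongrightarrow> 0"
  shows "is_weak_gradient D w G"
  unfolding is_weak_gradient_def
proof (intro conjI allI impI)
  show "G \<in> L2_space M" by (rule G)
  fix \<phi> and b :: 'a assume "test_function D \<phi> \<and> b \<in> Basis"
  then have \<phi>: "test_function D \<phi>" and b: "b \<in> Basis" by auto
  have FL: "F n \<in> L2_space M" for n using F by (auto simp: is_weak_gradient_def)
  note \<phi>L = test_function_L2[OF \<phi>] test_function_partial_L2[OF \<phi> b]
  have "(\<lambda>n. \<integral>x. v n x * partial_deriv \<phi> b x \<partial>M) \<longlonglongrightarrow> (\<integral>x. w x * partial_deriv \<phi> b x \<partial>M)"
  proof (rule LIM_zero_cancel, rule Lim_null_comparison)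
    show "(\<lambda>n. L2_norm M (\<lambda>x. v n x - w x) * L2_norm M (partial_deriv \<phi> b)) \<longlonglongrightarrow> 0"
      using tendsto_mult_right[OF vw] by simp
    show "\<forall>\<^sub>F n in sequentially. norm ((\<integral>x. v n x * partial_deriv \<phi> b x \<partial>M) - (\<integral>x. w x * partial_deriv \<phi> b x \<partial>M))
        \<le> L2_norm M (\<lambda>x. v n x - w x) * L2_norm M (partial_deriv \<phi> b)"
    proof (rule always_eventually, rule allI)
      fix n
      show "norm ((\<integral>x. v n x * partial_deriv \<phi> b x \<partial>M) - (\<integral>x. w x * partial_deriv \<phi> b x \<partial>M))
        \<le> L2_norm M (\<lambda>x. v n x - w x) * L2_norm M (partial_deriv \<phi> b)"
        using L2_Cauchy_Schwarz[OF L2_space_diff[OF v w] \<phi>L(2), of n]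
          L2_inner_integrable[OF v \<phi>L(2), of n] L2_inner_integrable[OF w \<phi>L(2)]
        by (simp add: left_diff_distrib)
    qed
  qed
  moreover have "(\<lambda>n. \<integral>x. (F n x \<bullet> b) * \<phi> x \<partial>M) \<longlonglongrightarrow> (\<integral>x. (G x \<bullet> b) * \<phi> x \<partial>M)"
  proof (rule LIM_zero_cancel, rule Lim_null_comparison)
    have \<phi>b: "(\<lambda>x. \<phi> x *\<^sub>R b) \<in> L2_space M" by (rule L2_scaleR_const[OF \<phi>L(1)])
    show "(\<lambda>n. L2_norm M (\<lambda>x. F n x - G x) * L2_norm M (\<lambda>x. \<phi> x *\<^sub>R b)) \<longlonglongrightarrow> 0"
      using tendsto_mult_right[OF FG] by simp
    show "\<forall>\<^sub>F n in sequentially. norm ((\<integral>x. (F n x \<bullet> b) * \<phi> x \<partial>M) - (\<integral>x. (G x \<bullet> b) * \<phi> x \<partial>M))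
        \<le> L2_norm M (\<lambda>x. F n x - G x) * L2_norm M (\<lambda>x. \<phi> x *\<^sub>R b)"
    proof (rule always_eventually, rule allI)
      fix n
      show "norm ((\<integral>x. (F n x \<bullet> b) * \<phi> x \<partial>M) - (\<integral>x. (G x \<bullet> b) * \<phi> x \<partial>M))
        \<le> L2_norm M (\<lambda>x. F n x - G x) * L2_norm M (\<lambda>x. \<phi> x *\<^sub>R b)"
        using L2_Cauchy_Schwarz[OF L2_space_diff[OF FL G] \<phi>b, of n]
          L2_inner_integrable[OF FL \<phi>b, of n] L2_inner_integrable[OF G \<phi>b]
        by (simp add: inner_diff_left mult.commute right_diff_distrib)
    qed
  qed
  then have "(\<lambda>n. - (\<integral>x. (F n x \<bullet> b) * \<phi> x \<partial>M)) \<longlonglongrightarrow> - (\<integral>x. (G x \<bullet> b) * \<phi> x \<partial>M)"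
    by (rule tendsto_minus)
  moreover have "(\<integral>x. v n x * partial_deriv \<phi> b x \<partial>M) = - (\<integral>x. (F n x \<bullet> b) * \<phi> x \<partial>M)" for n
    using F[of n] \<phi> b by (auto simp: is_weak_gradient_def)
  ultimately show "(\<integral>x. w x * partial_deriv \<phi> b x \<partial>M) = - (\<integral>x. (G x \<bullet> b) * \<phi> x \<partial>M)"
    using LIMSEQ_unique by force
qed

end

section \<open>Sobolev spaces and the Poincare inequality\<close>

context bounded_open_set
begin

lemma H1_spaceD:
  assumes "v \<in> H1_space D"
  shows "v \<in> L2_space M" "is_weak_gradient D v (weak_gradient D v)" "weak_gradient D v \<in> L2_space M"
proof -
  show "v \<in> L2_space M" using assms by (simp add: H1_space_def)
  have "\<exists>F. is_weak_gradient D v F" using assms by (simp add: H1_space_def)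
  then show *: "is_weak_gradient D v (weak_gradient D v)" unfolding weak_gradient_def by (rule someI_ex)
  then show "weak_gradient D v \<in> L2_space M" by (simp add: is_weak_gradient_def)
qed

lemma H1_spaceI: "v \<in> L2_space M \<Longrightarrow> is_weak_gradient D v F \<Longrightarrow> v \<in> H1_space D"
  by (auto simp: H1_space_def)

lemma weak_gradient_AE:
  assumes "is_weak_gradient D v F"
  shows "AE x in M. weak_gradient D v x = F x"
proof -
  have "is_weak_gradient D v (weak_gradient D v)"
    unfolding weak_gradient_def using assms by (rule someI[of "is_weak_gradient D v"])
  then show ?thesis using assms by (rule is_weak_gradient_unique)
qed

lemma L2_norm_weak_gradient:
  assumes "is_weak_gradient D v F"
  shows "L2_norm M (weak_gradient D v) = L2_norm M F"
proof (rule L2_norm_cong_AE[OF weak_gradient_AE[OF assms]])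
  have "is_weak_gradient D v (weak_gradient D v)"
    unfolding weak_gradient_def using assms by (rule someI[of "is_weak_gradient D v"])
  then show "weak_gradient D v \<in> borel_measurable M" "F \<in> borel_measurable M"
    using assms by (auto simp: is_weak_gradient_def L2_space_def)
qed

text \<open>\<^const>\<open>weak_gradient\<close> is a choice of representative, so it is linear only up to null sets; this is where the
  uniqueness of weak gradients enters.\<close>

lemma H1_lincomb:
  assumes v: "v \<in> H1_space D" and w: "w \<in> H1_space D"
  shows "(\<lambda>x. v x + c * w x) \<in> H1_space D"
    and "is_weak_gradient D (\<lambda>x. v x + c * w x) (\<lambda>x. weak_gradient D v x + c *\<^sub>R weak_gradient D w x)"
proof -
  have cw: "(\<lambda>x. c * w x) \<in> L2_space M" using L2_space_cmult[OF H1_spaceD(1)[OF w], of c] by simp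
  show *: "is_weak_gradient D (\<lambda>x. v x + c * w x) (\<lambda>x. weak_gradient D v x + c *\<^sub>R weak_gradient D w x)"
    by (intro is_weak_gradient_add is_weak_gradient_cmult H1_spaceD v w cw)
  show "(\<lambda>x. v x + c * w x) \<in> H1_space D"
    by (rule H1_spaceI[OF L2_space_add[OF H1_spaceD(1)[OF v] cw] *])
qed

lemma test_function_H1: "test_function D \<phi> \<Longrightarrow> \<phi> \<in> H1_space D"
  by (rule H1_spaceI[OF test_function_L2 is_weak_gradient_classical])

lemma H1_diff:
  assumes "v \<in> H1_space D" "w \<in> H1_space D"
  shows "(\<lambda>x. v x - w x) \<in> H1_space D"
    and "is_weak_gradient D (\<lambda>x. v x - w x) (\<lambda>x. weak_gradient D v x - weak_gradient D w x)"
  using H1_lincomb[OF assms, of "-1"] by auto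

lemma H1_norm_nonneg [simp]: "0 \<le> H1_norm D v"
  by (simp add: H1_norm_def)

lemma L2_norm_le_H1_norm: "L2_norm M v \<le> H1_norm D v"
  and L2_norm_gradient_le_H1_norm: "L2_norm M (weak_gradient D v) \<le> H1_norm D v"
  by (auto simp: H1_norm_def intro!: real_le_rsqrt)

lemma H1_norm_le_sum: "H1_norm D v \<le> L2_norm M v + L2_norm M (weak_gradient D v)"
  unfolding H1_norm_def by (rule sqrt_sum_squares_le_sum) auto

lemma H1_norm_lincomb:
  assumes v: "v \<in> H1_space D" and w: "w \<in> H1_space D"
  shows "H1_norm D (\<lambda>x. v x + c * w x) \<le> H1_norm D v + \<bar>c\<bar> * H1_norm D w"
proof -
  have cw: "(\<lambda>x. c * w x) \<in> L2_space M" using L2_space_cmult[OF H1_spaceD(1)[OF w], of c] by simp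
  have cG: "(\<lambda>x. c *\<^sub>R weak_gradient D w x) \<in> L2_space M" by (rule L2_space_cmult[OF H1_spaceD(3)[OF w]])
  have 1: "L2_norm M (\<lambda>x. v x + c * w x) \<le> L2_norm M v + \<bar>c\<bar> * L2_norm M w"
    using L2_triangle[OF H1_spaceD(1)[OF v] cw] L2_norm_cmult[of M c w] by simp
  have 2: "L2_norm M (weak_gradient D (\<lambda>x. v x + c * w x)) \<le> L2_norm M (weak_gradient D v) + \<bar>c\<bar> * L2_norm M (weak_gradient D w)"
    unfolding L2_norm_weak_gradient[OF H1_lincomb(2)[OF v w]]
    using L2_triangle[OF H1_spaceD(3)[OF v] cG] L2_norm_cmult[of M c "weak_gradient D w"] by simp
  have "H1_norm D (\<lambda>x. v x + c * w x) \<le> sqrt ((L2_norm M v + \<bar>c\<bar> * L2_norm M w)\<^sup>2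
      + (L2_norm M (weak_gradient D v) + \<bar>c\<bar> * L2_norm M (weak_gradient D w))\<^sup>2)"
    unfolding H1_norm_def using 1 2 by (intro real_sqrt_le_mono add_mono power_mono) auto
  also have "\<dots> \<le> H1_norm D v + sqrt ((\<bar>c\<bar> * L2_norm M w)\<^sup>2 + (\<bar>c\<bar> * L2_norm M (weak_gradient D w))\<^sup>2)"
    unfolding H1_norm_def by (rule real_sqrt_sum_squares_triangle_ineq)
  also have "sqrt ((\<bar>c\<bar> * L2_norm M w)\<^sup>2 + (\<bar>c\<bar> * L2_norm M (weak_gradient D w))\<^sup>2) = \<bar>c\<bar> * H1_norm D w"
    unfolding H1_norm_def power_mult_distrib distrib_left[symmetric] real_sqrt_mult by simp
  finally show ?thesis .
qed

lemma H1_norm_cmult: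
  assumes v: "v \<in> H1_space D"
  shows "H1_norm D (\<lambda>x. c * v x) = \<bar>c\<bar> * H1_norm D v"
proof -
  have "L2_norm M (weak_gradient D (\<lambda>x. c * v x)) = \<bar>c\<bar> * L2_norm M (weak_gradient D v)"
    unfolding L2_norm_weak_gradient[OF is_weak_gradient_cmult[OF H1_spaceD(2)[OF v]]] by (rule L2_norm_cmult)
  moreover have "L2_norm M (\<lambda>x. c * v x) = \<bar>c\<bar> * L2_norm M v" using L2_norm_cmult[of M c v] by simp
  ultimately show ?thesis
    unfolding H1_norm_def by (simp add: power_mult_distrib distrib_left[symmetric] real_sqrt_mult)
qed

lemma H1_norm_minus_commute:
  assumes "v \<in> H1_space D" "w \<in> H1_space D"
  shows "H1_norm D (\<lambda>x. v x - w x) = H1_norm D (\<lambda>x. w x - v x)"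
  using H1_norm_cmult[OF H1_diff(1)[OF assms], of "-1"] by simp

lemma H10_H1: "v \<in> H10_space D \<Longrightarrow> v \<in> H1_space D"
  by (simp add: H10_space_def)

lemma H10_approx:
  assumes "v \<in> H10_space D" "e > 0"
  obtains \<phi> where "test_function D \<phi>" "H1_norm D (\<lambda>x. v x - \<phi> x) < e"
proof -
  obtain \<phi> where \<phi>: "\<And>n. test_function D (\<phi> n)" "(\<lambda>n. H1_norm D (\<lambda>x. v x - \<phi> n x)) \<longlonglongrightarrow> 0"
    using assms by (auto simp: H10_space_def)
  have "\<forall>\<^sub>F n in sequentially. H1_norm D (\<lambda>x. v x - \<phi> n x) < e"
    using order_tendstoD(2)[OF \<phi>(2) \<open>e > 0\<close>] .
  then obtain n where "H1_norm D (\<lambda>x. v x - \<phi> n x) < e"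
    using eventually_happens trivial_limit_sequentially by blast
  with \<phi>(1) show ?thesis by (rule that)
qed

lemma H10_closed:
  assumes w: "w \<in> H1_space D" and app: "\<And>e. e > 0 \<Longrightarrow> \<exists>v\<in>H10_space D. H1_norm D (\<lambda>x. w x - v x) < e"
  shows "w \<in> H10_space D"
proof -
  have "\<exists>\<phi>. test_function D \<phi> \<and> H1_norm D (\<lambda>x. w x - \<phi> x) < inverse (real (Suc n))" for n
  proof -
    define e where "e = inverse (real (Suc n)) / 2"
    have e: "e > 0" by (simp add: e_def)
    then obtain v where v: "v \<in> H10_space D" "H1_norm D (\<lambda>x. w x - v x) < e" using app by blast
    obtain \<phi> where \<phi>: "test_function D \<phi>" "H1_norm D (\<lambda>x. v x - \<phi> x) < e"
      using H10_approx[OF v(1) e] .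
    have "H1_norm D (\<lambda>x. (w x - v x) + 1 * (v x - \<phi> x)) \<le> H1_norm D (\<lambda>x. w x - v x) + \<bar>1\<bar> * H1_norm D (\<lambda>x. v x - \<phi> x)"
      by (intro H1_norm_lincomb H1_diff w H10_H1 v test_function_H1 \<phi>)
    then have "H1_norm D (\<lambda>x. w x - \<phi> x) < inverse (real (Suc n))"
      using v(2) \<phi>(2) by (simp add: e_def)
    with \<phi>(1) show ?thesis by blast
  qed
  then have "\<forall>n. \<exists>\<phi>. test_function D \<phi> \<and> H1_norm D (\<lambda>x. w x - \<phi> x) < inverse (real (Suc n))" by blast
  from choice[OF this] obtain \<phi> where
    \<phi>: "\<forall>n. test_function D (\<phi> n) \<and> H1_norm D (\<lambda>x. w x - \<phi> n x) < inverse (real (Suc n))" ..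
  have "(\<lambda>n. H1_norm D (\<lambda>x. w x - \<phi> n x)) \<longlonglongrightarrow> 0"
  proof (rule Lim_null_comparison[OF always_eventually LIMSEQ_inverse_real_of_nat], rule allI)
    fix n show "norm (H1_norm D (\<lambda>x. w x - \<phi> n x)) \<le> inverse (real (Suc n))"
      using \<phi> by (auto intro: less_imp_le)
  qed
  with \<phi> w show ?thesis by (auto simp: H10_space_def)
qed

lemma H10_lincomb:
  assumes v: "v \<in> H10_space D" and w: "w \<in> H10_space D"
  shows "(\<lambda>x. v x + c * w x) \<in> H10_space D"
proof -
  obtain \<phi> where \<phi>: "\<And>n. test_function D (\<phi> n)" "(\<lambda>n. H1_norm D (\<lambda>x. v x - \<phi> n x)) \<longlonglongrightarrow> 0"
    using v by (auto simp: H10_space_def)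
  obtain \<xi> where \<xi>: "\<And>n. test_function D (\<xi> n)" "(\<lambda>n. H1_norm D (\<lambda>x. w x - \<xi> n x)) \<longlonglongrightarrow> 0"
    using w by (auto simp: H10_space_def)
  have "(\<lambda>n. H1_norm D (\<lambda>x. (v x + c * w x) - (\<phi> n x + c * \<xi> n x))) \<longlonglongrightarrow> 0"
  proof (rule Lim_null_comparison[OF always_eventually], rule allI)
    fix n
    have "H1_norm D (\<lambda>x. (v x - \<phi> n x) + c * (w x - \<xi> n x)) \<le> H1_norm D (\<lambda>x. v x - \<phi> n x) + \<bar>c\<bar> * H1_norm D (\<lambda>x. w x - \<xi> n x)"
      by (intro H1_norm_lincomb H1_diff H10_H1 v w test_function_H1 \<phi> \<xi>)
    then show "norm (H1_norm D (\<lambda>x. (v x + c * w x) - (\<phi> n x + c * \<xi> n x)))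
      \<le> H1_norm D (\<lambda>x. v x - \<phi> n x) + \<bar>c\<bar> * H1_norm D (\<lambda>x. w x - \<xi> n x)"
      by (simp add: algebra_simps)
  next
    show "(\<lambda>n. H1_norm D (\<lambda>x. v x - \<phi> n x) + \<bar>c\<bar> * H1_norm D (\<lambda>x. w x - \<xi> n x)) \<longlonglongrightarrow> 0"
      using tendsto_add[OF \<phi>(2) tendsto_mult_left[OF \<xi>(2), of "\<bar>c\<bar>"]] by simp
  qed
  moreover have "test_function D (\<lambda>x. \<phi> n x + c * \<xi> n x)" for n
    by (intro test_function_add test_function_cmult \<phi> \<xi>)
  ultimately show ?thesis
    unfolding H10_space_def using H1_lincomb(1)[OF H10_H1[OF v] H10_H1[OF w], of c]
    by (auto intro!: exI[of _ "\<lambda>n x. \<phi> n x + c * \<xi> n x"])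
qed

lemma test_function_H10:
  assumes \<phi>: "test_function D \<phi>" shows "\<phi> \<in> H10_space D"
proof -
  have "H1_norm D (\<lambda>x. \<phi> x - \<phi> x) = 0"
    using H1_norm_cmult[OF test_function_H1[OF test_function_0], of 0] by simp
  then show ?thesis
    unfolding H10_space_def using test_function_H1[OF \<phi>] \<phi> by (auto intro!: exI[of _ "\<lambda>_. \<phi>"])
qed

lemma H10_0: "(\<lambda>x. 0) \<in> H10_space D"
  by (rule test_function_H10[OF test_function_0])

lemma H10_cmult: "v \<in> H10_space D \<Longrightarrow> (\<lambda>x. c * v x) \<in> H10_space D"
  using H10_lincomb[OF H10_0, of v c] by simp

lemma H10_diff: "v \<in> H10_space D \<Longrightarrow> w \<in> H10_space D \<Longrightarrow> (\<lambda>x. v x - w x) \<in> H10_space D"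
  using H10_lincomb[of v w "-1"] by simp

text \<open>The derivative of \<open>\<phi>\<^sup>2 (x \<bullet> b)\<close> in direction \<open>b\<close> has integral zero, so the squared norm of
  \<open>\<phi>\<close> equals minus twice the integral of \<open>\<phi> (x \<bullet> b) \<partial>\<phi>\<close>, and \<open>|x \<bullet> b|\<close> is bounded on \<open>D\<close>.\<close>

lemma Poincare_test_function:
  assumes R: "\<And>x. x \<in> D \<Longrightarrow> norm x \<le> R" "R \<ge> 0" and \<phi>: "test_function D \<phi>"
  shows "L2_norm M \<phi> \<le> 2 * R * L2_norm M (classical_gradient \<phi>)"
proof -
  obtain b :: 'a where b: "b \<in> Basis" using nonempty_Basis by blast
  obtain K where K: "compact K" "K \<subseteq> D" "\<And>x. x \<notin> K \<Longrightarrow> \<phi> x = 0"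
    using test_function_support[OF \<phi>] by metis
  let ?d = "\<lambda>x h. (\<phi> x * frechet_derivative \<phi> (at x) h + frechet_derivative \<phi> (at x) h * \<phi> x) * (x \<bullet> b) + (\<phi> x * \<phi> x) * (h \<bullet> b)"
  have der: "((\<lambda>x. (\<phi> x * \<phi> x) * (x \<bullet> b)) has_derivative ?d x) (at x)" for x
    by (rule has_derivative_eq_rhs[OF has_derivative_mult[OF
          has_derivative_mult[OF test_function_has_derivative[OF \<phi>] test_function_has_derivative[OF \<phi>]]
          has_derivative_inner_left[OF has_derivative_ident]]])
       (auto simp: fun_eq_iff)
  note c = test_function_continuous[OF \<phi>] test_function_partial_continuous[OF \<phi> b]
  have cont: "continuous_on UNIV (\<lambda>x. ?d x b)" by (intro continuous_intros c)
  have "(\<integral>x. ?d x b \<partial>lborel) = 0"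
    by (rule integral_directional_derivative_eq_0[OF der cont K(1)]) (simp add: K(3))
  moreover have "?d x b = 0" if "x \<notin> D" for x
    using K that by (cases "x \<in> K") auto
  ultimately have zero: "(\<integral>x. ?d x b \<partial>M) = 0"
    using integral_M_eq_lborel[OF borel_measurable_continuous_onI[OF cont]] by simp
  have d: "?d x b = 2 * ((\<phi> x * (x \<bullet> b)) * partial_deriv \<phi> b x) + (norm (\<phi> x))\<^sup>2" for x
    using b by (simp add: algebra_simps power2_eq_square)
  have \<phi>b: "(\<lambda>x. \<phi> x * (x \<bullet> b)) \<in> L2_space M"
    by (rule continuous_compact_support_L2[OF _ K(1)]) (auto intro!: continuous_intros c simp: K(3))
  have xb: "\<bar>x \<bullet> b\<bar> \<le> R" if "x \<in> D" for x
    using R(1)[OF that] Basis_le_norm[OF b, of x] by simp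
  have n1: "L2_norm M (\<lambda>x. \<phi> x * (x \<bullet> b)) \<le> R * L2_norm M \<phi>"
  proof -
    have "(L2_norm M (\<lambda>x. \<phi> x * (x \<bullet> b)))\<^sup>2 \<le> (\<integral>x. R\<^sup>2 * (norm (\<phi> x))\<^sup>2 \<partial>M)"
      unfolding L2_norm_power2
    proof (rule integral_mono_AE)
      show "AE x in M. (norm (\<phi> x * (x \<bullet> b)))\<^sup>2 \<le> R\<^sup>2 * (norm (\<phi> x))\<^sup>2"
      proof (rule AE_I2)
        fix x assume "x \<in> space M"
        then have "x \<in> D" by (simp add: space_restrict_space)
        then have "(norm (\<phi> x * (x \<bullet> b)))\<^sup>2 \<le> (\<bar>\<phi> x\<bar> * R)\<^sup>2"
          using xb by (intro power_mono) (auto simp: abs_mult intro: mult_left_mono)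
        then show "(norm (\<phi> x * (x \<bullet> b)))\<^sup>2 \<le> R\<^sup>2 * (norm (\<phi> x))\<^sup>2" by (simp add: power_mult_distrib mult.commute)
      qed
    qed (use \<phi>b test_function_L2[OF \<phi>] in \<open>auto simp: L2_space_def\<close>)
    also have "\<dots> = (R * L2_norm M \<phi>)\<^sup>2" by (simp add: L2_norm_power2 power_mult_distrib)
    finally show ?thesis by (rule power2_le_imp_le) (use R(2) in simp)
  qed
  have n2: "L2_norm M (partial_deriv \<phi> b) \<le> L2_norm M (classical_gradient \<phi>)"
    unfolding L2_norm_def
  proof (intro real_sqrt_le_mono integral_mono_AE AE_I2)
    fix x show "(norm (partial_deriv \<phi> b x))\<^sup>2 \<le> (norm (classical_gradient \<phi> x))\<^sup>2"
      using Basis_le_norm[OF b, of "classical_gradient \<phi> x"] classical_gradient_inner[OF b, of \<phi> x]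
      by (intro power_mono) auto
  qed (use test_function_partial_L2[OF \<phi> b] classical_gradient_L2[OF \<phi>] in \<open>auto simp: L2_space_def\<close>)
  have "0 = 2 * (\<integral>x. (\<phi> x * (x \<bullet> b)) * partial_deriv \<phi> b x \<partial>M) + (L2_norm M \<phi>)\<^sup>2"
    using zero L2_inner_integrable[OF \<phi>b test_function_partial_L2[OF \<phi> b]] L2_spaceD(2)[OF test_function_L2[OF \<phi>]]
    unfolding d L2_norm_power2 by simp
  then have "(L2_norm M \<phi>)\<^sup>2 \<le> 2 * \<bar>\<integral>x. (\<phi> x * (x \<bullet> b)) * partial_deriv \<phi> b x \<partial>M\<bar>" by linarith
  also have "\<dots> \<le> 2 * (L2_norm M (\<lambda>x. \<phi> x * (x \<bullet> b)) * L2_norm M (partial_deriv \<phi> b))"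
    using L2_Cauchy_Schwarz[OF \<phi>b test_function_partial_L2[OF \<phi> b]] by simp
  also have "\<dots> \<le> 2 * ((R * L2_norm M \<phi>) * L2_norm M (classical_gradient \<phi>))"
    using n1 n2 R(2) by (intro mult_left_mono mult_mono) auto
  finally have "L2_norm M \<phi> * L2_norm M \<phi> \<le> L2_norm M \<phi> * (2 * R * L2_norm M (classical_gradient \<phi>))"
    by (simp add: power2_eq_square mult_ac)
  note * = this
  show ?thesis
  proof (cases "L2_norm M \<phi> = 0")
    case True
    then show ?thesis using R(2) by simp
  next
    case False
    then have "L2_norm M \<phi> > 0" by (simp add: less_le)
    with * show ?thesis by (rule mult_left_le_imp_le)
  qed
qed

lemma Poincare:
  obtains C where "C \<ge> 0" "\<And>v. v \<in> H10_space D \<Longrightarrow> L2_norm M v \<le> C * L2_norm M (weak_gradient D v)"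
proof -
  obtain R0 where R0: "\<And>x. x \<in> D \<Longrightarrow> norm x \<le> R0" using bounded_D by (auto simp: bounded_iff)
  define R where "R = max R0 0"
  have R: "\<And>x. x \<in> D \<Longrightarrow> norm x \<le> R" "R \<ge> 0" using R0 unfolding R_def by (fastforce intro: max.coboundedI1, simp)
  have "L2_norm M v \<le> 2 * R * L2_norm M (weak_gradient D v)" if v: "v \<in> H10_space D" for v
  proof (rule field_le_epsilon)
    fix e :: real assume "e > 0"
    define d where "d = e / (2 * R + 1)"
    have d: "d > 0" using \<open>e > 0\<close> R(2) by (simp add: d_def)
    obtain \<phi> where \<phi>: "test_function D \<phi>" "H1_norm D (\<lambda>x. v x - \<phi> x) < d" using H10_approx[OF v d] .
    note H = H10_H1[OF v] test_function_H1[OF \<phi>(1)]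
    have "L2_norm M v \<le> L2_norm M \<phi> + L2_norm M (\<lambda>x. v x - \<phi> x)"
      by (rule L2_norm_le_add[OF H1_spaceD(1)[OF H(1)] test_function_L2[OF \<phi>(1)]])
    also have "L2_norm M (\<lambda>x. v x - \<phi> x) \<le> d" using L2_norm_le_H1_norm \<phi>(2) by (meson less_imp_le order_trans)
    also have "L2_norm M \<phi> \<le> 2 * R * L2_norm M (weak_gradient D \<phi>)"
      using Poincare_test_function[OF R \<phi>(1)] L2_norm_weak_gradient[OF is_weak_gradient_classical[OF \<phi>(1)]] by simp
    also have "L2_norm M (weak_gradient D \<phi>) \<le> L2_norm M (weak_gradient D v) + d"
    proof -
      have "L2_norm M (\<lambda>x. weak_gradient D v x - weak_gradient D \<phi> x) \<le> d"
        using L2_norm_gradient_le_H1_norm[of "\<lambda>x. v x - \<phi> x"] \<phi>(2) L2_norm_weak_gradient[OF H1_diff(2)[OF H]] by simp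
      then show ?thesis
        using L2_norm_le_add[OF H1_spaceD(3)[OF H(2)] H1_spaceD(3)[OF H(1)]]
          L2_norm_minus_commute[of M "weak_gradient D v" "weak_gradient D \<phi>"] by simp
    qed
    finally have "L2_norm M v \<le> 2 * R * (L2_norm M (weak_gradient D v) + d) + d"
      using R(2) by (simp add: mult_left_mono)
    also have "\<dots> = 2 * R * L2_norm M (weak_gradient D v) + (2 * R + 1) * d" by (simp add: algebra_simps)
    also have "(2 * R + 1) * d = e" using R(2) by (simp add: d_def)
    finally show "L2_norm M v \<le> 2 * R * L2_norm M (weak_gradient D v) + e" .
  qed
  with R(2) show ?thesis by (intro that[of "2 * R"]) auto
qed

text \<open>By the Poincare inequality, convergence of the gradients controls convergence of the functions.\<close>

lemma H10_complete:
  assumes v: "\<And>n. v n \<in> H10_space D"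
    and cauchy: "\<And>e. e > 0 \<Longrightarrow> \<exists>N. \<forall>m\<ge>N. \<forall>n\<ge>N. L2_norm M (weak_gradient D (\<lambda>x. v m x - v n x)) < e"
  obtains w where "w \<in> H10_space D" "(\<lambda>n. L2_norm M (weak_gradient D (\<lambda>x. v n x - w x))) \<longlonglongrightarrow> 0"
proof -
  obtain C where C: "C \<ge> 0" "\<And>v. v \<in> H10_space D \<Longrightarrow> L2_norm M v \<le> C * L2_norm M (weak_gradient D v)"
    using Poincare by blast
  note H = H10_H1[OF v]
  have c1: "\<exists>N. \<forall>m\<ge>N. \<forall>n\<ge>N. L2_norm M (\<lambda>x. weak_gradient D (v m) x - weak_gradient D (v n) x) < e" if "e > 0" for e
    using cauchy[OF that] unfolding L2_norm_weak_gradient[OF H1_diff(2)[OF H H]] .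
  have c2: "\<exists>N. \<forall>m\<ge>N. \<forall>n\<ge>N. L2_norm M (\<lambda>x. v m x - v n x) < e" if "e > 0" for e
  proof -
    have "e / (C + 1) > 0" using that C(1) by simp
    from cauchy[OF this] obtain N where N: "\<forall>m\<ge>N. \<forall>n\<ge>N. L2_norm M (weak_gradient D (\<lambda>x. v m x - v n x)) < e / (C + 1)" by blast
    have "L2_norm M (\<lambda>x. v m x - v n x) < e" if "m \<ge> N" "n \<ge> N" for m n
    proof -
      have "L2_norm M (\<lambda>x. v m x - v n x) \<le> C * L2_norm M (weak_gradient D (\<lambda>x. v m x - v n x))"
        by (intro C(2) H10_diff v)
      also have "\<dots> \<le> C * (e / (C + 1))" using N that C(1) by (intro mult_left_mono) (auto intro: less_imp_le)
      also have "\<dots> < e" using \<open>e > 0\<close> C(1) by (simp add: field_simps)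
      finally show ?thesis .
    qed
    then show ?thesis by blast
  qed
  obtain F where F: "F \<in> L2_space M" "(\<lambda>n. L2_norm M (\<lambda>x. weak_gradient D (v n) x - F x)) \<longlonglongrightarrow> 0"
    using L2_complete[of "\<lambda>n. weak_gradient D (v n)" M] c1 H1_spaceD(3)[OF H] by blast
  obtain w where w: "w \<in> L2_space M" "(\<lambda>n. L2_norm M (\<lambda>x. v n x - w x)) \<longlonglongrightarrow> 0"
    using L2_complete[of v M] c2 H1_spaceD(1)[OF H] by blast
  have wF: "is_weak_gradient D w F"
    by (rule is_weak_gradient_limit[OF H1_spaceD(1)[OF H] H1_spaceD(2)[OF H] w(1) F(1) w(2) F(2)])
  have wH: "w \<in> H1_space D" by (rule H1_spaceI[OF w(1) wF])
  have eq: "L2_norm M (weak_gradient D (\<lambda>x. v n x - w x)) = L2_norm M (\<lambda>x. weak_gradient D (v n) x - F x)" for n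
  proof -
    have "is_weak_gradient D (\<lambda>x. v n x + (-1) * w x) (\<lambda>x. weak_gradient D (v n) x + (-1) *\<^sub>R F x)"
      by (rule is_weak_gradient_add[OF H1_spaceD(2)[OF H] is_weak_gradient_cmult[OF wF] H1_spaceD(1)[OF H]])
         (use L2_space_cmult[OF w(1), of "-1"] in simp)
    from L2_norm_weak_gradient[OF this] show ?thesis by simp
  qed
  have lim: "(\<lambda>n. L2_norm M (weak_gradient D (\<lambda>x. v n x - w x))) \<longlonglongrightarrow> 0" unfolding eq by (rule F(2))
  have "(\<lambda>n. H1_norm D (\<lambda>x. w x - v n x)) \<longlonglongrightarrow> 0"
  proof (rule Lim_null_comparison[OF always_eventually], rule allI)
    fix n
    show "norm (H1_norm D (\<lambda>x. w x - v n x)) \<le> L2_norm M (\<lambda>x. v n x - w x) + L2_norm M (weak_gradient D (\<lambda>x. v n x - w x))"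
      unfolding H1_norm_minus_commute[OF wH H] using H1_norm_le_sum by simp
  next
    show "(\<lambda>n. L2_norm M (\<lambda>x. v n x - w x) + L2_norm M (weak_gradient D (\<lambda>x. v n x - w x))) \<longlonglongrightarrow> 0"
      using tendsto_add[OF w(2) lim] by simp
  qed
  note limH = this
  have "w \<in> H10_space D"
  proof (rule H10_closed[OF wH])
    fix e :: real assume "e > 0"
    then have "\<forall>\<^sub>F n in sequentially. H1_norm D (\<lambda>x. w x - v n x) < e" using order_tendstoD(2)[OF limH] by blast
    then obtain n where "H1_norm D (\<lambda>x. w x - v n x) < e"
      using eventually_happens trivial_limit_sequentially by blast
    then show "\<exists>v\<in>H10_space D. H1_norm D (\<lambda>x. w x - v x) < e" using v by blast
  qed
  from that[OF this lim] show ?thesis .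
qed

end

section \<open>The elliptic boundary value problem\<close>

text \<open>The Euler-Lagrange argument: at a minimum the first-order term vanishes.\<close>

lemma linear_perturbation_zero:
  fixes r q :: real
  assumes "\<And>t. 0 \<le> t * r + t\<^sup>2 * q"
  shows "r = 0"
proof (rule ccontr)
  assume "r \<noteq> 0"
  define c where "c = \<bar>q\<bar> + 1"
  have p: "c > 0" "\<bar>q\<bar> = c - 1" by (auto simp: c_def)
  \<comment> \<open>The minimiser of \<open>t r + t\<^sup>2 c\<close> up to a factor two; \<open>c\<close> exceeds \<open>|q|\<close>, which makes the value negative.\<close>
  define t where "t = - r / c"
  have "t * r + t\<^sup>2 * q \<le> t * r + t\<^sup>2 * \<bar>q\<bar>" by (intro add_left_mono mult_left_mono) auto
  also have "\<dots> = - (r\<^sup>2 / c\<^sup>2)"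
    using p(1) unfolding t_def p(2) by (simp add: field_simps power2_eq_square)
  also have "\<dots> < 0" using \<open>r \<noteq> 0\<close> p by simp
  finally show False using assms[of t] by simp
qed

context bounded_open_set
begin

text \<open>The lower bound is a parameter because the estimates for solutions are expressed through it; the
  upper bound is existential, as it only has to make the energy form finite.\<close>

definition elliptic_coeff :: "real \<Rightarrow> ('a \<Rightarrow> real) \<Rightarrow> bool" where
  "elliptic_coeff \<alpha> a \<longleftrightarrow> a \<in> borel_measurable M \<and> (\<exists>A. AE x in M. \<bar>a x\<bar> \<le> A) \<and> (AE x in M. \<alpha> \<le> a x)"

definition energy_form :: "('a \<Rightarrow> real) \<Rightarrow> ('a \<Rightarrow> real) \<Rightarrow> ('a \<Rightarrow> real) \<Rightarrow> real" where
  "energy_form a v w = (\<integral>x. a x * (weak_gradient D v x \<bullet> weak_gradient D w x) \<partial>M)"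

lemma L2_space_mult_bounded:
  fixes F :: "'a \<Rightarrow> 'b::euclidean_space"
  assumes [measurable]: "c \<in> borel_measurable M" and A: "AE x in M. \<bar>c x\<bar> \<le> A" "A \<ge> 0" and F: "F \<in> L2_space M"
  shows "(\<lambda>x. c x *\<^sub>R F x) \<in> L2_space M" and "L2_norm M (\<lambda>x. c x *\<^sub>R F x) \<le> A * L2_norm M F"
proof -
  have [measurable]: "F \<in> borel_measurable M" using F by (rule L2_spaceD)
  have int: "integrable M (\<lambda>x. A\<^sup>2 * (norm (F x))\<^sup>2)" using F by (auto simp: L2_space_def)
  have le: "AE x in M. (norm (c x *\<^sub>R F x))\<^sup>2 \<le> A\<^sup>2 * (norm (F x))\<^sup>2"
    using A(1)
  proof eventually_elim
    case (elim x)
    then have "(norm (c x *\<^sub>R F x))\<^sup>2 \<le> (A * norm (F x))\<^sup>2"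
      by (intro power_mono) (auto intro: mult_right_mono)
    then show ?case by (simp add: power_mult_distrib)
  qed
  show *: "(\<lambda>x. c x *\<^sub>R F x) \<in> L2_space M" by (rule L2_dominated[OF _ int le]) measurable
  have "(L2_norm M (\<lambda>x. c x *\<^sub>R F x))\<^sup>2 \<le> (\<integral>x. A\<^sup>2 * (norm (F x))\<^sup>2 \<partial>M)"
    unfolding L2_norm_power2 by (rule integral_mono_AE[OF L2_spaceD(2)[OF *] int le])
  also have "\<dots> = (A * L2_norm M F)\<^sup>2" by (simp add: L2_norm_power2 power_mult_distrib)
  finally show "L2_norm M (\<lambda>x. c x *\<^sub>R F x) \<le> A * L2_norm M F"
    by (rule power2_le_imp_le) (use A(2) in simp)
qed

lemma weighted_inner:
  fixes F G :: "'a \<Rightarrow> 'b::euclidean_space"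
  assumes c: "c \<in> borel_measurable M" and A: "AE x in M. \<bar>c x\<bar> \<le> A" "A \<ge> 0" and F: "F \<in> L2_space M" and G: "G \<in> L2_space M"
  shows "integrable M (\<lambda>x. c x * (F x \<bullet> G x))"
    and "\<bar>\<integral>x. c x * (F x \<bullet> G x) \<partial>M\<bar> \<le> A * L2_norm M F * L2_norm M G"
proof -
  note cF = L2_space_mult_bounded[OF c A F]
  show "integrable M (\<lambda>x. c x * (F x \<bullet> G x))" using L2_inner_integrable[OF cF(1) G] by simp
  have "\<bar>\<integral>x. c x * (F x \<bullet> G x) \<partial>M\<bar> \<le> L2_norm M (\<lambda>x. c x *\<^sub>R F x) * L2_norm M G"
    using L2_Cauchy_Schwarz[OF cF(1) G] by simp
  also have "\<dots> \<le> A * L2_norm M F * L2_norm M G" by (intro mult_right_mono cF(2)) auto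
  finally show "\<bar>\<integral>x. c x * (F x \<bullet> G x) \<partial>M\<bar> \<le> A * L2_norm M F * L2_norm M G" .
qed

lemma elliptic_coeffD:
  assumes "elliptic_coeff \<alpha> a"
  obtains A where "a \<in> borel_measurable M" "A \<ge> 0" "AE x in M. \<bar>a x\<bar> \<le> A" "AE x in M. \<alpha> \<le> a x"
proof -
  obtain A where A: "AE x in M. \<bar>a x\<bar> \<le> A" using assms by (auto simp: elliptic_coeff_def)
  have "AE x in M. \<bar>a x\<bar> \<le> max A 0" using A by eventually_elim simp
  then show ?thesis using assms by (intro that[of "max A 0"]) (auto simp: elliptic_coeff_def)
qed

lemma energy_form_integrable:
  assumes "elliptic_coeff \<alpha> a" "v \<in> H1_space D" "w \<in> H1_space D"
  shows "integrable M (\<lambda>x. a x * (weak_gradient D v x \<bullet> weak_gradient D w x))"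
  using assms by (auto elim!: elliptic_coeffD intro: weighted_inner H1_spaceD)

lemma energy_form_commute: "energy_form a v w = energy_form a w v"
  by (simp add: energy_form_def inner_commute)

lemma energy_form_lincomb:
  assumes a: "elliptic_coeff \<alpha> a" and v: "v \<in> H1_space D" and w: "w \<in> H1_space D" and u: "u \<in> H1_space D"
  shows "energy_form a (\<lambda>x. v x + c * w x) u = energy_form a v u + c * energy_form a w u"
proof -
  note i = energy_form_integrable[OF a]
  have "energy_form a (\<lambda>x. v x + c * w x) u
      = (\<integral>x. a x * (weak_gradient D v x \<bullet> weak_gradient D u x) + c * (a x * (weak_gradient D w x \<bullet> weak_gradient D u x)) \<partial>M)"
    unfolding energy_form_def
  proof (rule integral_cong_AE)
    show "AE x in M. a x * (weak_gradient D (\<lambda>x. v x + c * w x) x \<bullet> weak_gradient D u x) =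
        a x * (weak_gradient D v x \<bullet> weak_gradient D u x) + c * (a x * (weak_gradient D w x \<bullet> weak_gradient D u x))"
      using weak_gradient_AE[OF H1_lincomb(2)[OF v w, of c]]
      by eventually_elim (simp add: inner_add_left algebra_simps)
    show "(\<lambda>x. a x * (weak_gradient D (\<lambda>x. v x + c * w x) x \<bullet> weak_gradient D u x)) \<in> borel_measurable M"
      using i[OF H1_lincomb(1)[OF v w] u] by (rule borel_measurable_integrable)
  qed (use i[OF v u] i[OF w u] in auto)
  also have "\<dots> = energy_form a v u + c * energy_form a w u"
    unfolding energy_form_def using i[OF v u] i[OF w u] by simp
  finally show ?thesis .
qed

lemma energy_form_coercive:
  assumes a: "elliptic_coeff \<alpha> a" and v: "v \<in> H1_space D"
  shows "\<alpha> * (L2_norm M (weak_gradient D v))\<^sup>2 \<le> energy_form a v v"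
proof -
  have "\<alpha> * (L2_norm M (weak_gradient D v))\<^sup>2 = (\<integral>x. \<alpha> * (norm (weak_gradient D v x))\<^sup>2 \<partial>M)"
    by (simp add: L2_norm_power2)
  also have "\<dots> \<le> energy_form a v v"
    unfolding energy_form_def
  proof (rule integral_mono_AE)
    show "AE x in M. \<alpha> * (norm (weak_gradient D v x))\<^sup>2 \<le> a x * (weak_gradient D v x \<bullet> weak_gradient D v x)"
      using a unfolding elliptic_coeff_def power2_norm_eq_inner by (auto elim!: eventually_mono intro: mult_right_mono)
  qed (use energy_form_integrable[OF a v v] H1_spaceD(3)[OF v] in \<open>auto simp: L2_space_def\<close>)
  finally show ?thesis .
qed

text \<open>On \<open>H\<^sup>1\<^sub>0\<close> the gradient norm is equivalent to the full norm, so a functional is bounded by the gradient norm alone.\<close>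

lemma Hm1_bound:
  assumes "l \<in> Hm1_space D"
  obtains K where "K \<ge> 0" "\<And>v. v \<in> H10_space D \<Longrightarrow> \<bar>l v\<bar> \<le> K * L2_norm M (weak_gradient D v)"
proof -
  obtain C where C: "C \<ge> 0" "\<And>v. v \<in> H10_space D \<Longrightarrow> L2_norm M v \<le> C * L2_norm M (weak_gradient D v)"
    using Poincare by blast
  obtain K where K: "\<And>v. v \<in> H10_space D \<Longrightarrow> \<bar>l v\<bar> \<le> K * H1_norm D v"
    using assms unfolding Hm1_space_def by blast
  have "\<bar>l v\<bar> \<le> (\<bar>K\<bar> * (C + 1)) * L2_norm M (weak_gradient D v)" if v: "v \<in> H10_space D" for v
  proof -
    have "\<bar>l v\<bar> \<le> \<bar>K\<bar> * H1_norm D v"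
      using order_trans[OF K[OF v] mult_right_mono[OF abs_ge_self H1_norm_nonneg]] .
    also have "H1_norm D v \<le> (C + 1) * L2_norm M (weak_gradient D v)"
      using H1_norm_le_sum[of v] C(2)[OF v] by (simp add: distrib_right)
    finally show ?thesis by (simp add: mult_left_mono mult.assoc)
  qed
  with C(1) show ?thesis by (intro that[of "\<bar>K\<bar> * (C + 1)"]) auto
qed

lemma Hm1_lincomb:
  assumes "l \<in> Hm1_space D" "v \<in> H10_space D" "w \<in> H10_space D"
  shows "l (\<lambda>x. v x + c * w x) = l v + c * l w"
  using assms H10_cmult[of w c] by (simp add: Hm1_space_def)

lemma Hm1_diff:
  assumes "l \<in> Hm1_space D" "v \<in> H10_space D" "w \<in> H10_space D"
  shows "l (\<lambda>x. v x - w x) = l v - l w"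
  using Hm1_lincomb[OF assms, of "-1"] by simp

lemma Hm1_norm_bdd_above:
  assumes "l \<in> Hm1_space D"
  shows "bdd_above {\<bar>l v\<bar> | v. v \<in> H10_space D \<and> H1_norm D v \<le> 1}"
proof -
  obtain K where K: "\<And>v. v \<in> H10_space D \<Longrightarrow> \<bar>l v\<bar> \<le> K * H1_norm D v"
    using assms unfolding Hm1_space_def by blast
  have "\<bar>l v\<bar> \<le> \<bar>K\<bar>" if "v \<in> H10_space D" "H1_norm D v \<le> 1" for v
  proof -
    have "\<bar>l v\<bar> \<le> \<bar>K\<bar> * H1_norm D v"
      using order_trans[OF K[OF that(1)] mult_right_mono[OF abs_ge_self H1_norm_nonneg]] .
    also have "\<dots> \<le> \<bar>K\<bar> * 1" using that by (intro mult_left_mono) auto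
    finally show ?thesis by simp
  qed
  then show ?thesis by (intro bdd_aboveI[of _ "\<bar>K\<bar>"]) auto
qed

lemma Hm1_norm_nonneg:
  assumes "l \<in> Hm1_space D" shows "0 \<le> Hm1_norm D l"
proof -
  have "H1_norm D (\<lambda>x. 0) \<le> 1" using H1_norm_cmult[OF H10_H1[OF H10_0], of 0] by simp
  then have "\<bar>l (\<lambda>x. 0)\<bar> \<le> Hm1_norm D l"
    unfolding Hm1_norm_def by (intro cSup_upper Hm1_norm_bdd_above assms) (use H10_0 in auto)
  then show ?thesis by linarith
qed

lemma Hm1_norm_zero:
  assumes l: "l \<in> Hm1_space D" and "Hm1_norm D l = 0" and v: "v \<in> H10_space D"
  shows "l v = 0"
proof (cases "H1_norm D v = 0")
  case True
  then show ?thesis using l v by (auto simp: Hm1_space_def)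
next
  case False
  then have pos: "H1_norm D v > 0" by (simp add: less_le)
  define u where "u x = (1 / H1_norm D v) * v x" for x
  have u: "u \<in> H10_space D" unfolding u_def by (rule H10_cmult[OF v])
  have "H1_norm D u = 1" unfolding u_def H1_norm_cmult[OF H10_H1[OF v]] using pos by simp
  then have "\<bar>l u\<bar> \<le> Hm1_norm D l"
    unfolding Hm1_norm_def by (intro cSup_upper Hm1_norm_bdd_above l) (use u in auto)
  then have "l u = 0" using assms(2) by simp
  moreover have "l (\<lambda>x. c * v x) = c * l v" for c
    using l v unfolding Hm1_space_def by blast
  then have "l u = (1 / H1_norm D v) * l v" unfolding u_def .
  ultimately show ?thesis using pos by simp
qed

text \<open>Minimise \<open>E(v) = B(v,v)/2 - g(v)\<close>. The parallelogram identity makes a minimising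
  sequence Cauchy, and letting \<open>n\<close> tend to infinity in \<open>E(v\<^sub>n + t u) \<ge> inf E\<close>
  yields the Euler-Lagrange equation for the limit.\<close>

lemma weak_solution_exists:
  assumes a: "elliptic_coeff \<alpha> a" and \<alpha>: "\<alpha> > 0" and g: "g \<in> Hm1_space D"
  shows "\<exists>p. is_weak_solution D g a p"
proof -
  obtain K where K: "K \<ge> 0" "\<And>v. v \<in> H10_space D \<Longrightarrow> \<bar>g v\<bar> \<le> K * L2_norm M (weak_gradient D v)"
    using Hm1_bound[OF g] by blast
  obtain A where A: "a \<in> borel_measurable M" "A \<ge> 0" "AE x in M. \<bar>a x\<bar> \<le> A"
    using elliptic_coeffD[OF a] by blast
  define E where "E v = energy_form a v v / 2 - g v" for v
  have E_expand: "E (\<lambda>x. v x + t * w x) = E v + t * (energy_form a v w - g w) + t\<^sup>2 * (energy_form a w w / 2)"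
    if v: "v \<in> H10_space D" and w: "w \<in> H10_space D" for v w t
  proof -
    note H = H10_H1[OF v] H10_H1[OF w] H10_H1[OF H10_lincomb[OF v w]]
    have "energy_form a (\<lambda>x. v x + t * w x) (\<lambda>x. v x + t * w x)
        = energy_form a v (\<lambda>x. v x + t * w x) + t * energy_form a w (\<lambda>x. v x + t * w x)"
      by (rule energy_form_lincomb[OF a H])
    also have "energy_form a v (\<lambda>x. v x + t * w x) = energy_form a v v + t * energy_form a v w"
      using energy_form_lincomb[OF a H(1,2,1)] by (simp add: energy_form_commute)
    also have "energy_form a w (\<lambda>x. v x + t * w x) = energy_form a v w + t * energy_form a w w"
      using energy_form_lincomb[OF a H(1,2,2)] by (simp add: energy_form_commute)
    finally show ?thesis
      unfolding E_def Hm1_lincomb[OF g v w] by (simp add: algebra_simps power2_eq_square)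
  qed
  have E_lower: "- K\<^sup>2 / (2 * \<alpha>) \<le> E v" if v: "v \<in> H10_space D" for v
  proof -
    define s where "s = L2_norm M (weak_gradient D v)"
    have "\<alpha> * s\<^sup>2 / 2 - K * s \<le> E v"
      unfolding E_def s_def using energy_form_coercive[OF a H10_H1[OF v]] K(2)[OF v] by linarith
    moreover have "0 \<le> (\<alpha> * s - K)\<^sup>2 / (2 * \<alpha>)" using \<alpha> by simp
    then have "- K\<^sup>2 / (2 * \<alpha>) \<le> \<alpha> * s\<^sup>2 / 2 - K * s"
      using \<alpha> by (simp add: field_simps power2_eq_square)
    ultimately show ?thesis by linarith
  qed
  define d where "d = Inf (E ` H10_space D)"
  have bdd: "bdd_below (E ` H10_space D)" using E_lower by (auto intro!: bdd_belowI)
  have dle: "d \<le> E v" if "v \<in> H10_space D" for v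
    unfolding d_def by (intro cInf_lower bdd imageI that)
  have "\<exists>v. v \<in> H10_space D \<and> E v < d + inverse (real (Suc n))" for n
  proof -
    have "\<exists>e\<in>E ` H10_space D. e < d + inverse (real (Suc n))"
      unfolding d_def by (subst cInf_less_iff[symmetric]) (use H10_0 bdd in auto)
    then show ?thesis by auto
  qed
  then have "\<forall>n. \<exists>v. v \<in> H10_space D \<and> E v < d + inverse (real (Suc n))" by blast
  from choice[OF this] obtain v where "\<forall>n. v n \<in> H10_space D \<and> E (v n) < d + inverse (real (Suc n))" ..
  then have v: "v n \<in> H10_space D" and Ev: "E (v n) < d + inverse (real (Suc n))" for n by auto
  have avg: "(p + q) / 2 - d \<le> (r + s) / 2" if "p < d + r" "q < d + s" for p q r s :: real
    using that by (simp add: field_simps)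
  have mean_le: "(p + q) / 2 \<le> r" if "p \<le> r" "q \<le> r" for p q r :: real
    using that by simp
  have scaled_le: "\<alpha> / 8 * p \<le> r" if "q / 8 \<le> r" "\<alpha> * p \<le> q" for p q r :: real
    using that by simp
  have nonneg_step: "0 \<le> r + x + z" if "d \<le> q" "q = p + x + z" "p < d + r" for p q r x z :: real
    using that by simp
  have par: "\<alpha> / 8 * (L2_norm M (weak_gradient D (\<lambda>x. v m x - v n x)))\<^sup>2 \<le> inverse (real (Suc N))"
    if "m \<ge> N" "n \<ge> N" for m n N
  proof -
    define w where "w x = v m x - v n x" for x
    have w: "w \<in> H10_space D" unfolding w_def by (rule H10_diff[OF v v])
    have 1: "E (v m) = E (v n) + (energy_form a (v n) w - g w) + energy_form a w w / 2"
      using E_expand[OF v w, of n 1] by (simp add: w_def)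
    \<comment> \<open>The value at the midpoint of \<open>v n\<close> and \<open>v m\<close>.\<close>
    have 2: "E (\<lambda>x. v n x + (1/2) * w x) = E (v n) + (1/2) * (energy_form a (v n) w - g w) + energy_form a w w / 8"
      using E_expand[OF v w, of n "1/2"] by (simp add: power2_eq_square)
    have "energy_form a w w / 8 = (E (v m) + E (v n)) / 2 - E (\<lambda>x. v n x + (1/2) * w x)"
      unfolding 1 2 by (simp add: field_simps)
    also have "\<dots> \<le> (E (v m) + E (v n)) / 2 - d"
      using dle[OF H10_lincomb[OF v w, of n "1/2"]] by linarith
    also have "\<dots> \<le> (inverse (real (Suc m)) + inverse (real (Suc n))) / 2"
      using avg[OF Ev[of m] Ev[of n]] .
    also have "\<dots> \<le> inverse (real (Suc N))"
    proof -
      have "inverse (real (Suc m)) \<le> inverse (real (Suc N))" "inverse (real (Suc n)) \<le> inverse (real (Suc N))"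
        using that by (auto intro!: le_imp_inverse_le)
      then show ?thesis by (rule mean_le)
    qed
    finally have "energy_form a w w / 8 \<le> inverse (real (Suc N))" .
    moreover have "\<alpha> * (L2_norm M (weak_gradient D w))\<^sup>2 \<le> energy_form a w w"
      by (rule energy_form_coercive[OF a H10_H1[OF w]])
    ultimately show ?thesis unfolding w_def[abs_def] by (rule scaled_le)
  qed
  obtain w where w: "w \<in> H10_space D" "(\<lambda>n. L2_norm M (weak_gradient D (\<lambda>x. v n x - w x))) \<longlonglongrightarrow> 0"
  proof (rule H10_complete[OF v])
    fix e :: real assume "e > 0"
    then have "0 < \<alpha> / 8 * e\<^sup>2" using \<alpha> by simp
    from reals_Archimedean[OF this] obtain N where N: "inverse (real (Suc N)) < \<alpha> / 8 * e\<^sup>2" ..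
    have "L2_norm M (weak_gradient D (\<lambda>x. v m x - v n x)) < e" if "m \<ge> N" "n \<ge> N" for m n
    proof -
      have "\<alpha> / 8 * (L2_norm M (weak_gradient D (\<lambda>x. v m x - v n x)))\<^sup>2 < \<alpha> / 8 * e\<^sup>2"
        using par[OF that] N by (rule le_less_trans)
      then have "(L2_norm M (weak_gradient D (\<lambda>x. v m x - v n x)))\<^sup>2 < e\<^sup>2" using \<alpha> by simp
      then show ?thesis by (rule power2_less_imp_less) (use \<open>e > 0\<close> in simp)
    qed
    then show "\<exists>N. \<forall>m\<ge>N. \<forall>n\<ge>N. L2_norm M (weak_gradient D (\<lambda>x. v m x - v n x)) < e" by blast
  qed
  have "energy_form a w u = g u" if u: "u \<in> H10_space D" for u
  proof -
    have lim: "(\<lambda>n. energy_form a (v n) u) \<longlonglongrightarrow> energy_form a w u"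
    proof (rule LIM_zero_cancel, rule Lim_null_comparison[OF always_eventually], rule allI)
      fix n
      have d: "energy_form a (\<lambda>x. v n x - w x) u = energy_form a (v n) u - energy_form a w u"
        using energy_form_lincomb[OF a H10_H1[OF v] H10_H1[OF w(1)] H10_H1[OF u], of n "-1"] by simp
      have "\<bar>energy_form a (\<lambda>x. v n x - w x) u\<bar>
          \<le> A * L2_norm M (weak_gradient D (\<lambda>x. v n x - w x)) * L2_norm M (weak_gradient D u)"
        unfolding energy_form_def
        by (rule weighted_inner(2)[OF A(1,3,2) H1_spaceD(3)[OF H10_H1[OF H10_diff[OF v w(1)]]] H1_spaceD(3)[OF H10_H1[OF u]]])
      then show "norm (energy_form a (v n) u - energy_form a w u)
          \<le> A * L2_norm M (weak_gradient D (\<lambda>x. v n x - w x)) * L2_norm M (weak_gradient D u)"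
        unfolding d by simp
    next
      show "(\<lambda>n. A * L2_norm M (weak_gradient D (\<lambda>x. v n x - w x)) * L2_norm M (weak_gradient D u)) \<longlonglongrightarrow> 0"
        using tendsto_mult_right[OF tendsto_mult_left[OF w(2), of A]] by simp
    qed
    have "energy_form a w u - g u = 0"
    proof (rule linear_perturbation_zero)
      fix t
      have "(\<lambda>n. inverse (real (Suc n)) + t * (energy_form a (v n) u - g u) + t\<^sup>2 * (energy_form a u u / 2))
        \<longlonglongrightarrow> 0 + t * (energy_form a w u - g u) + t\<^sup>2 * (energy_form a u u / 2)"
        by (intro tendsto_intros LIMSEQ_inverse_real_of_nat lim)
      moreover have "0 \<le> inverse (real (Suc n)) + t * (energy_form a (v n) u - g u) + t\<^sup>2 * (energy_form a u u / 2)" for n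
        by (rule nonneg_step[OF dle[OF H10_lincomb[OF v u]] E_expand[OF v u] Ev])
      ultimately have "0 \<le> 0 + t * (energy_form a w u - g u) + t\<^sup>2 * (energy_form a u u / 2)"
        by (intro LIMSEQ_le_const) auto
      then show "0 \<le> t * (energy_form a w u - g u) + t\<^sup>2 * (energy_form a u u / 2)" by simp
    qed
    then show ?thesis by simp
  qed
  then have "is_weak_solution D g a w"
    using w(1) by (auto simp: is_weak_solution_def energy_form_def)
  then show ?thesis by blast
qed

lemma weak_solution:
  assumes "elliptic_coeff \<alpha> a" "\<alpha> > 0" "g \<in> Hm1_space D"
  shows "weak_solution D g a \<in> H10_space D"
    and "v \<in> H10_space D \<Longrightarrow> energy_form a (weak_solution D g a) v = g v"
proof -
  have "is_weak_solution D g a (weak_solution D g a)"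
    unfolding weak_solution_def using weak_solution_exists[OF assms] by (rule someI_ex)
  then show "weak_solution D g a \<in> H10_space D"
    "v \<in> H10_space D \<Longrightarrow> energy_form a (weak_solution D g a) v = g v"
    by (auto simp: is_weak_solution_def energy_form_def)
qed

text \<open>Test the equation with the solution itself.\<close>

lemma weak_solution_bound:
  assumes a: "elliptic_coeff \<alpha> a" and \<alpha>: "\<alpha> > 0" and g: "g \<in> Hm1_space D"
    and K: "\<And>v. v \<in> H10_space D \<Longrightarrow> \<bar>g v\<bar> \<le> K * L2_norm M (weak_gradient D v)" "K \<ge> 0"
  shows "L2_norm M (weak_gradient D (weak_solution D g a)) \<le> K / \<alpha>"
proof -
  define p where "p = weak_solution D g a"
  define s where "s = L2_norm M (weak_gradient D p)"
  have p: "p \<in> H10_space D" "energy_form a p p = g p"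
    unfolding p_def using weak_solution[OF a \<alpha> g] by auto
  have "\<alpha> * s\<^sup>2 \<le> K * s"
    unfolding s_def using energy_form_coercive[OF a H10_H1[OF p(1)]] K(1)[OF p(1)] p(2) by linarith
  have "s \<le> K / \<alpha>"
  proof (cases "s = 0")
    case False
    then have "s > 0" by (simp add: s_def less_le)
    with \<open>\<alpha> * s\<^sup>2 \<le> K * s\<close> have "\<alpha> * s \<le> K" by (simp add: power2_eq_square)
    then show ?thesis using \<alpha> by (simp add: field_simps)
  qed (use K(2) \<alpha> in simp)
  then show ?thesis by (simp add: s_def p_def)
qed

text \<open>Subtract the two equations and test with the difference \<open>w\<close> of the solutions: \<open>B\<^sub>a(w,w)\<close> equals the integral of
  \<open>(b - a) \<nabla>q \<bullet> \<nabla>w\<close>, where \<open>q\<close> is the solution for \<open>b\<close>.\<close>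

lemma weak_solution_Lipschitz:
  assumes a: "elliptic_coeff \<alpha> a" and b: "elliptic_coeff \<alpha> b" and \<alpha>: "\<alpha> > 0" and g: "g \<in> Hm1_space D"
    and K: "\<And>v. v \<in> H10_space D \<Longrightarrow> \<bar>g v\<bar> \<le> K * L2_norm M (weak_gradient D v)" "K \<ge> 0"
    and e: "AE x in M. \<bar>a x - b x\<bar> \<le> e" "e \<ge> 0"
  shows "L2_norm M (weak_gradient D (\<lambda>x. weak_solution D g a x - weak_solution D g b x)) \<le> e * K / \<alpha>\<^sup>2"
proof -
  define p q where "p = weak_solution D g a" and "q = weak_solution D g b"
  define w where "w x = p x - q x" for x
  define s where "s = L2_norm M (weak_gradient D w)"
  have p: "p \<in> H10_space D" "\<And>v. v \<in> H10_space D \<Longrightarrow> energy_form a p v = g v"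
    unfolding p_def using weak_solution[OF a \<alpha> g] by auto
  have q: "q \<in> H10_space D" "\<And>v. v \<in> H10_space D \<Longrightarrow> energy_form b q v = g v"
    unfolding q_def using weak_solution[OF b \<alpha> g] by auto
  have w: "w \<in> H10_space D" unfolding w_def by (rule H10_diff[OF p(1) q(1)])
  note H = H10_H1[OF p(1)] H10_H1[OF q(1)] H10_H1[OF w]
  have [measurable]: "a \<in> borel_measurable M" "b \<in> borel_measurable M"
    using a b by (auto simp: elliptic_coeff_def)
  have "energy_form a w w = energy_form a p w - energy_form a q w"
    using energy_form_lincomb[OF a H, of "-1"] by (simp add: w_def[abs_def])
  also have "\<dots> = energy_form b q w - energy_form a q w" by (simp add: p(2) q(2) w)
  also have "\<dots> = (\<integral>x. (b x - a x) * (weak_gradient D q x \<bullet> weak_gradient D w x) \<partial>M)"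
    unfolding energy_form_def left_diff_distrib
    using energy_form_integrable[OF a H(2,3)] energy_form_integrable[OF b H(2,3)] by simp
  also have "\<dots> \<le> e * L2_norm M (weak_gradient D q) * s"
  proof -
    have "AE x in M. \<bar>b x - a x\<bar> \<le> e" using e(1) by (simp add: abs_minus_commute)
    from weighted_inner(2)[OF _ this e(2) H1_spaceD(3)[OF H(2)] H1_spaceD(3)[OF H(3)]]
    show ?thesis by (simp add: s_def)
  qed
  also have "\<dots> \<le> e * (K / \<alpha>) * s"
    using weak_solution_bound[OF b \<alpha> g K] e(2) by (intro mult_right_mono mult_left_mono) (auto simp: q_def s_def)
  finally have "\<alpha> * s\<^sup>2 \<le> e * (K / \<alpha>) * s"
    using energy_form_coercive[OF a H(3)] by (simp add: s_def)
  have "s \<le> e * K / \<alpha>\<^sup>2"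
  proof (cases "s = 0")
    case False
    then have "s > 0" by (simp add: s_def less_le)
    have "\<alpha> * s * s \<le> e * (K / \<alpha>) * s"
      using \<open>\<alpha> * s\<^sup>2 \<le> e * (K / \<alpha>) * s\<close> by (simp only: power2_eq_square mult.assoc)
    then have "\<alpha> * s \<le> e * (K / \<alpha>)" using \<open>s > 0\<close> by (rule mult_right_le_imp_le)
    then show ?thesis using \<alpha> by (simp add: field_simps power2_eq_square)
  qed (use K(2) \<alpha> e in simp)
  then show ?thesis by (simp add: s_def w_def[abs_def] p_def q_def)
qed

text \<open>The constant depends on the coefficient only through its lower bound, which is what makes all later
  estimates uniform in the number of coordinates.\<close>

lemma observation_bounds:
  assumes \<alpha>: "\<alpha> > 0" and g: "g \<in> Hm1_space D" and l: "l \<in> Hm1_space D"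
  shows "\<exists>K\<ge>0. (\<forall>a. elliptic_coeff \<alpha> a \<longrightarrow> \<bar>l (weak_solution D g a)\<bar> \<le> K) \<and>
    (\<forall>a b e. elliptic_coeff \<alpha> a \<longrightarrow> elliptic_coeff \<alpha> b \<longrightarrow> (AE x in M. \<bar>a x - b x\<bar> \<le> e) \<longrightarrow> e \<ge> 0
      \<longrightarrow> \<bar>l (weak_solution D g a) - l (weak_solution D g b)\<bar> \<le> K * e)"
proof -
  obtain Kg where Kg: "Kg \<ge> 0" "\<And>v. v \<in> H10_space D \<Longrightarrow> \<bar>g v\<bar> \<le> Kg * L2_norm M (weak_gradient D v)"
    using Hm1_bound[OF g] by blast
  obtain Kl where Kl: "Kl \<ge> 0" "\<And>v. v \<in> H10_space D \<Longrightarrow> \<bar>l v\<bar> \<le> Kl * L2_norm M (weak_gradient D v)"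
    using Hm1_bound[OF l] by blast
  define K where "K = max (Kl * (Kg / \<alpha>)) (Kl * (Kg / \<alpha>\<^sup>2))"
  have "K \<ge> 0" using Kg Kl \<alpha> by (simp add: K_def le_max_iff_disj)
  moreover have "\<bar>l (weak_solution D g a)\<bar> \<le> K" if a: "elliptic_coeff \<alpha> a" for a
  proof -
    have "\<bar>l (weak_solution D g a)\<bar> \<le> Kl * L2_norm M (weak_gradient D (weak_solution D g a))"
      by (rule Kl(2)[OF weak_solution(1)[OF a \<alpha> g]])
    also have "\<dots> \<le> Kl * (Kg / \<alpha>)"
      by (rule mult_left_mono[OF weak_solution_bound[OF a \<alpha> g Kg(2,1)] Kl(1)])
    finally show ?thesis by (simp add: K_def)
  qed
  moreover have "\<bar>l (weak_solution D g a) - l (weak_solution D g b)\<bar> \<le> K * e"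
    if a: "elliptic_coeff \<alpha> a" and b: "elliptic_coeff \<alpha> b" and e: "AE x in M. \<bar>a x - b x\<bar> \<le> e" "e \<ge> 0" for a b e
  proof -
    note S = weak_solution(1)[OF a \<alpha> g] weak_solution(1)[OF b \<alpha> g]
    have "\<bar>l (weak_solution D g a) - l (weak_solution D g b)\<bar> = \<bar>l (\<lambda>x. weak_solution D g a x - weak_solution D g b x)\<bar>"
      by (simp add: Hm1_diff[OF l S])
    also have "\<dots> \<le> Kl * L2_norm M (weak_gradient D (\<lambda>x. weak_solution D g a x - weak_solution D g b x))"
      by (rule Kl(2)[OF H10_diff[OF S]])
    also have "\<dots> \<le> Kl * (e * Kg / \<alpha>\<^sup>2)"
      by (rule mult_left_mono[OF weak_solution_Lipschitz[OF a b \<alpha> g Kg(2,1) e] Kl(1)])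
    also have "\<dots> = (Kl * (Kg / \<alpha>\<^sup>2)) * e" by simp
    also have "\<dots> \<le> K * e" using e(2) by (intro mult_right_mono) (auto simp: K_def)
    finally show ?thesis .
  qed
  ultimately show ?thesis by blast
qed

end

section \<open>The likelihood as a function of the coordinates\<close>

lemma Linf_norm_less_AE:
  assumes "Linf_norm M f < ereal c"
  shows "AE x in M. \<bar>f x\<bar> \<le> c"
proof -
  have "AE x in M. ereal \<bar>f x\<bar> \<le> Linf_norm M f" unfolding Linf_norm_def by (rule esssup_AE)
  then show ?thesis
  proof eventually_elim
    case (elim x)
    then have "ereal \<bar>f x\<bar> < ereal c" using assms by (rule le_less_trans)
    then show ?case by simp
  qed
qed

lemma Linf_space_AE_bounded:
  assumes "f \<in> Linf_space M"
  obtains c where "AE x in M. \<bar>f x\<bar> \<le> c"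
proof -
  have "Linf_norm M f \<noteq> \<infinity>" using assms by (auto simp: Linf_space_def)
  then obtain n :: nat where "Linf_norm M f < ereal (real n)" by (auto simp: less_PInf_Ex_of_nat)
  from Linf_norm_less_AE[OF this] show ?thesis by (rule that)
qed

lemma space_unif: "space unif = {-1..1}"
  by (simp add: unif_def space_uniform_measure space_restrict_space)

lemma sets_unif [measurable_cong]: "sets unif = sets (restrict_space borel {-1..1})"
  by (simp add: unif_def sets_restrict_space)

lemma prob_space_unif: "prob_space unif"
  unfolding unif_def
proof (rule prob_space_uniform_measure)
  show "emeasure (restrict_space lborel {-1..1::real}) {-1..1} \<noteq> 0" "emeasure (restrict_space lborel {-1..1::real}) {-1..1} \<noteq> \<infinity>"
    by (auto simp: emeasure_restrict_space)
qed

lemma space_prior: "space (prior J) = (\<Pi>\<^sub>E j\<in>coords J. {-1..1})"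
  by (simp add: prior_def space_PiM space_unif)

text \<open>The coefficient is elliptic only for coordinates in \<open>[-1, 1]\<close>. Composing with this continuous retraction gives
  observations that are continuous on the whole product space, where Borel and product measurability agree.\<close>

definition clamp_coords :: "(nat \<Rightarrow> real) \<Rightarrow> nat \<Rightarrow> real" where
  "clamp_coords u j = max (-1) (min 1 (u j))"

lemma clamp_coords_range: "clamp_coords u j \<in> {-1..1}"
  by (auto simp: clamp_coords_def)

lemma clamp_coords_id: "u j \<in> {-1..1} \<Longrightarrow> clamp_coords u j = u j"
  by (auto simp: clamp_coords_def)

locale elliptic_problem = bounded_open_set D
  for D :: "'a::euclidean_space set" +
  fixes g :: "('a \<Rightarrow> real) \<Rightarrow> real"
    and l :: "'n::finite \<Rightarrow> ('a \<Rightarrow> real) \<Rightarrow> real"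
    and abar :: "'a \<Rightarrow> real"
    and \<gamma> :: "nat \<Rightarrow> real"
    and \<psi> :: "nat \<Rightarrow> 'a \<Rightarrow> real"
    and astar :: real
  assumes g_dual: "g \<in> Hm1_space D" and l_dual: "\<And>i. l i \<in> Hm1_space D"
    and abar_Linf: "abar \<in> Linf_space (lebesgue_on D)"
    and psi_Linf: "\<And>j. \<psi> j \<in> Linf_space (lebesgue_on D)"
    and psi_norm: "\<And>j. Linf_norm (lebesgue_on D) (\<psi> j) = 1"
    and series: "\<And>u. (\<And>j. u j \<in> {-1..1}) \<Longrightarrow>
          (\<lambda>n. Linf_norm (lebesgue_on D) (\<lambda>x. coefficient abar \<gamma> \<psi> \<infinity> u x - coefficient abar \<gamma> \<psi> (enat n) u x)) \<longlonglongrightarrow> 0"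
    and astar_pos: "astar > 0"
    and elliptic: "\<And>J u. (\<And>j. j \<in> coords J \<Longrightarrow> u j \<in> {-1..1}) \<Longrightarrow>
          AE x in lebesgue_on D. coefficient abar \<gamma> \<psi> J u x \<ge> astar"
begin

abbreviation "coef \<equiv> coefficient abar \<gamma> \<psi>"

abbreviation "observed i J u \<equiv> l i (weak_solution D g (coef J u))"

lemma psi_measurable [measurable]: "\<psi> j \<in> borel_measurable M"
  using psi_Linf by (simp add: Linf_space_def)

lemma abar_measurable [measurable]: "abar \<in> borel_measurable M"
  using abar_Linf by (simp add: Linf_space_def)

lemma psi_le_1: "AE x in M. \<bar>\<psi> j x\<bar> \<le> 1"
proof -
  have "AE x in M. ereal \<bar>\<psi> j x\<bar> \<le> Linf_norm M (\<psi> j)" unfolding Linf_norm_def by (rule esssup_AE)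
  then show ?thesis by (simp add: psi_norm one_ereal_def)
qed

lemma coef_measurable [measurable]: "coef J u \<in> borel_measurable M"
  unfolding coefficient_def by (cases J) (auto intro!: borel_measurable_add borel_measurable_sum borel_measurable_times borel_measurable_suminf)

lemma coef_finite_diff:
  "AE x in M. \<bar>coef (enat n) u x - coef (enat n) w x\<bar> \<le> (\<Sum>j<n. \<bar>\<gamma> j\<bar> * \<bar>u j - w j\<bar>)"
proof -
  have "AE x in M. \<forall>j. \<bar>\<psi> j x\<bar> \<le> 1" using psi_le_1 by (simp add: AE_all_countable)
  then show ?thesis
  proof eventually_elim
    case (elim x)
    have "\<bar>coef (enat n) u x - coef (enat n) w x\<bar> = \<bar>\<Sum>j<n. \<gamma> j * (u j - w j) * \<psi> j x\<bar>"
      by (simp add: coefficient_def sum_subtractf[symmetric] algebra_simps)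
    also have "\<dots> \<le> (\<Sum>j<n. \<bar>\<gamma> j * (u j - w j) * \<psi> j x\<bar>)" by (rule sum_abs)
    also have "\<dots> \<le> (\<Sum>j<n. \<bar>\<gamma> j\<bar> * \<bar>u j - w j\<bar>)"
      using elim by (intro sum_mono) (auto simp: abs_mult intro: mult_left_le)
    finally show ?case .
  qed
qed

lemma coef_finite_bounded: "\<exists>A. AE x in M. \<bar>coef (enat n) u x\<bar> \<le> A"
proof -
  obtain A where A: "AE x in M. \<bar>abar x\<bar> \<le> A" using Linf_space_AE_bounded[OF abar_Linf] .
  have "AE x in M. \<bar>coef (enat n) u x\<bar> \<le> A + (\<Sum>j<n. \<bar>\<gamma> j\<bar> * \<bar>u j - 0\<bar>)"
    using A coef_finite_diff[of n u "\<lambda>_. 0"]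
  proof eventually_elim
    case (elim x)
    have "coef (enat n) (\<lambda>_. 0) x = abar x" by (simp add: coefficient_def)
    with elim show ?case by linarith
  qed
  then show ?thesis by blast
qed

lemma coef_tail:
  assumes "\<And>j. u j \<in> {-1..1}" "e > 0"
  shows "\<forall>\<^sub>F n in sequentially. AE x in M. \<bar>coef \<infinity> u x - coef (enat n) u x\<bar> \<le> e"
proof -
  have "\<forall>\<^sub>F n in sequentially. Linf_norm M (\<lambda>x. coef \<infinity> u x - coef (enat n) u x) < ereal e"
    using order_tendstoD(2)[OF series[of u]] assms by simp
  then show ?thesis by eventually_elim (rule Linf_norm_less_AE)
qed

lemma coef_elliptic:
  assumes u: "\<And>j. j \<in> coords J \<Longrightarrow> u j \<in> {-1..1}"
  shows "elliptic_coeff astar (coef J u)"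
proof -
  have "\<exists>A. AE x in M. \<bar>coef J u x\<bar> \<le> A"
  proof (cases J)
    case (enat n)
    then show ?thesis using coef_finite_bounded by simp
  next
    case infinity
    have "u j \<in> {-1..1}" for j using u[of j] infinity by (simp add: coords_def)
    from coef_tail[OF this, of 1] obtain n where n: "AE x in M. \<bar>coef \<infinity> u x - coef (enat n) u x\<bar> \<le> 1"
      using eventually_happens trivial_limit_sequentially by fastforce
    obtain A where "AE x in M. \<bar>coef (enat n) u x\<bar> \<le> A" using coef_finite_bounded by blast
    with n have "AE x in M. \<bar>coef \<infinity> u x\<bar> \<le> A + 1" by eventually_elim linarith
    then show ?thesis using infinity by blast
  qed
  then show ?thesis using elliptic[OF u] by (auto simp: elliptic_coeff_def)
qed

lemma coef_cong: "(\<And>j. j \<in> coords J \<Longrightarrow> u j = w j) \<Longrightarrow> coef J u = coef J w"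
  by (cases J) (auto simp: coefficient_def coords_def fun_eq_iff)

lemma extend_coords_measurable:
  "(\<lambda>u j. if j \<in> coords J then u j else 0) \<in> prior J \<rightarrow>\<^sub>M PiM UNIV (\<lambda>_. borel)"
proof (rule measurable_PiM_single')
  fix j :: nat
  have "(\<lambda>u. u j) \<in> borel_measurable (prior J)" if "j \<in> coords J"
  proof -
    have "(\<lambda>u. u j) \<in> prior J \<rightarrow>\<^sub>M unif"
      unfolding prior_def by (rule measurable_component_singleton[OF that])
    then show ?thesis
      by (rule measurable_compose[where g="\<lambda>x. x" and N=unif, simplified]) (simp add: measurable_restrict_space1 cong: measurable_cong_sets[OF sets_unif refl])
  qed
  then show "(\<lambda>u. if j \<in> coords J then u j else 0) \<in> borel_measurable (prior J)"
    by (cases "j \<in> coords J") simp_all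
qed auto

text \<open>With finitely many coordinates, the observations are Lipschitz in the coordinates.\<close>

lemma observed_finite_measurable:
  assumes nJ: "coords (enat n) \<subseteq> coords J"
  shows "(\<lambda>u. observed i (enat n) u) \<in> borel_measurable (prior J)"
proof -
  obtain K where K: "K \<ge> 0" "\<And>a. elliptic_coeff astar a \<Longrightarrow> \<bar>l i (weak_solution D g a)\<bar> \<le> K"
    "\<And>a b e. \<lbrakk>elliptic_coeff astar a; elliptic_coeff astar b; AE x in M. \<bar>a x - b x\<bar> \<le> e; e \<ge> 0\<rbrakk>
      \<Longrightarrow> \<bar>l i (weak_solution D g a) - l i (weak_solution D g b)\<bar> \<le> K * e"
    using observation_bounds[OF astar_pos g_dual l_dual[of i]] by blast
  define h where "h u = observed i (enat n) (clamp_coords u)" for u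
  have Lip: "\<bar>h u - h w\<bar> \<le> K * (\<Sum>j<n. \<bar>\<gamma> j\<bar> * \<bar>clamp_coords u j - clamp_coords w j\<bar>)" for u w
    unfolding h_def
    by (rule K(3)[OF coef_elliptic[OF clamp_coords_range] coef_elliptic[OF clamp_coords_range] coef_finite_diff sum_nonneg]) simp
  have coord: "((\<lambda>w. clamp_coords w j) \<longlongrightarrow> clamp_coords u j) (at u)" for u j
  proof -
    have "continuous_on UNIV (\<lambda>w::nat \<Rightarrow> real. w j)" by (rule continuous_on_product_coordinates)
    then have "isCont (\<lambda>w::nat \<Rightarrow> real. w j) u" by (metis UNIV_I continuous_on_eq_continuous_at open_UNIV)
    then have "((\<lambda>w. w j) \<longlongrightarrow> u j) (at u)" by (simp add: isCont_def)
    then show ?thesis unfolding clamp_coords_def by (intro tendsto_intros)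
  qed
  have "isCont h u" for u
    unfolding isCont_def
  proof (rule LIM_zero_cancel, rule Lim_null_comparison[OF always_eventually], rule allI)
    show "norm (h w - h u) \<le> K * (\<Sum>j<n. \<bar>\<gamma> j\<bar> * \<bar>clamp_coords w j - clamp_coords u j\<bar>)" for w
      using Lip by simp
    have "((\<lambda>w. K * (\<Sum>j<n. \<bar>\<gamma> j\<bar> * \<bar>clamp_coords w j - clamp_coords u j\<bar>)) \<longlongrightarrow>
        K * (\<Sum>j<n. \<bar>\<gamma> j\<bar> * \<bar>clamp_coords u j - clamp_coords u j\<bar>)) (at u)"
      by (intro tendsto_intros coord)
    then show "((\<lambda>w. K * (\<Sum>j<n. \<bar>\<gamma> j\<bar> * \<bar>clamp_coords w j - clamp_coords u j\<bar>)) \<longlongrightarrow> 0) (at u)" by simp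
  qed
  then have "continuous_on UNIV h" by (simp add: continuous_at_imp_continuous_on)
  then have "h \<in> borel_measurable borel" by (rule borel_measurable_continuous_onI)
  then have "h \<in> borel_measurable (PiM UNIV (\<lambda>_. borel))"
    by (subst measurable_cong_sets[OF sets_PiM_equal_borel refl])
  from measurable_compose[OF extend_coords_measurable[of J] this]
  have "(\<lambda>u. h (\<lambda>j. if j \<in> coords J then u j else 0)) \<in> borel_measurable (prior J)" .
  then show ?thesis
  proof (rule measurable_cong[THEN iffD1, rotated])
    fix u assume "u \<in> space (prior J)"
    then have "u j \<in> {-1..1}" if "j \<in> coords J" for j using that by (auto simp: space_prior)
    then have "coef (enat n) (clamp_coords (\<lambda>j. if j \<in> coords J then u j else 0)) = coef (enat n) u"
      using nJ by (intro coef_cong) (auto simp: clamp_coords_id subset_iff)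
    then show "h (\<lambda>j. if j \<in> coords J then u j else 0) = observed i (enat n) u" by (simp add: h_def)
  qed
qed

text \<open>For infinitely many coordinates the truncated coefficients converge in \<open>L\<^sup>\<infinity>\<close>, hence the observations converge
  pointwise.\<close>

lemma observed_measurable: "(\<lambda>u. observed i J u) \<in> borel_measurable (prior J)"
proof (cases J)
  case (enat n)
  then show ?thesis using observed_finite_measurable[of n J i] by simp
next
  case infinity
  obtain K where K: "K \<ge> 0" "\<And>a. elliptic_coeff astar a \<Longrightarrow> \<bar>l i (weak_solution D g a)\<bar> \<le> K"
    "\<And>a b e. \<lbrakk>elliptic_coeff astar a; elliptic_coeff astar b; AE x in M. \<bar>a x - b x\<bar> \<le> e; e \<ge> 0\<rbrakk>
      \<Longrightarrow> \<bar>l i (weak_solution D g a) - l i (weak_solution D g b)\<bar> \<le> K * e"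
    using observation_bounds[OF astar_pos g_dual l_dual[of i]] by blast
  show ?thesis
    unfolding infinity
  proof (rule borel_measurable_LIMSEQ_real)
    show "(\<lambda>u. observed i (enat n) u) \<in> borel_measurable (prior \<infinity>)" for n
      by (rule observed_finite_measurable) (simp add: coords_def)
    fix u assume "u \<in> space (prior \<infinity>)"
    then have u: "u j \<in> {-1..1}" for j by (auto simp: space_prior coords_def)
    show "(\<lambda>n. observed i (enat n) u) \<longlonglongrightarrow> observed i \<infinity> u"
    proof (rule LIMSEQ_I)
      fix e :: real assume "e > 0"
      then have "e / (K + 1) > 0" using K(1) by simp
      from coef_tail[of u "e / (K + 1)", OF u this] have "\<forall>\<^sub>F n in sequentially. norm (observed i (enat n) u - observed i \<infinity> u) < e"
      proof eventually_elim
        case (elim n)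
        have "\<bar>observed i \<infinity> u - observed i (enat n) u\<bar> \<le> K * (e / (K + 1))"
          by (rule K(3)[OF coef_elliptic[OF u] coef_elliptic[OF u] elim less_imp_le[OF \<open>e / (K + 1) > 0\<close>]])
        also have "\<dots> < e" using K(1) \<open>e > 0\<close> by (simp add: field_simps)
        finally show ?case by simp
      qed
      then show "\<exists>N. \<forall>n\<ge>N. norm (observed i (enat n) u - observed i \<infinity> u) < e"
        by (simp add: eventually_sequentially)
    qed
  qed
qed

lemma likelihood_measurable:
  "likelihood (forward_map D g l) \<Gamma> y (coef J) \<in> borel_measurable (prior J)"
proof -
  have "(\<lambda>u. forward_map D g l (coef J u)) \<in> borel_measurable (prior J)"
  proof (subst borel_measurable_euclidean_space, rule ballI)
    fix b :: "real ^ 'n" assume "b \<in> Basis"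
    then obtain i where "b = axis i 1" by (auto simp: Basis_vec_def)
    then show "(\<lambda>u. forward_map D g l (coef J u) \<bullet> b) \<in> borel_measurable (prior J)"
      using observed_measurable[of i J] by (simp add: inner_axis forward_map_def)
  qed
  moreover have "continuous_on UNIV (\<lambda>z. exp (- (1/2) * (cov_norm \<Gamma> (y - z))\<^sup>2))"
    unfolding cov_norm_def
    by (intro continuous_intros linear_continuous_on_compose[OF _ matrix_vector_mul_linear])
  then have "(\<lambda>z. exp (- (1/2) * (cov_norm \<Gamma> (y - z))\<^sup>2)) \<in> borel_measurable borel"
    by (rule borel_measurable_continuous_onI)
  ultimately have "(\<lambda>u. exp (- (1/2) * (cov_norm \<Gamma> (y - forward_map D g l (coef J u)))\<^sup>2)) \<in> borel_measurable (prior J)"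
    by (rule measurable_compose)
  then show ?thesis by (simp add: likelihood_def[abs_def])
qed

lemma likelihood_bounds:
  obtains m where "m > 0" "\<And>J u. u \<in> space (prior J) \<Longrightarrow> m \<le> likelihood (forward_map D g l) \<Gamma> y (coef J) u"
    "\<And>J u. likelihood (forward_map D g l) \<Gamma> y (coef J) u \<le> 1"
proof -
  have "\<exists>K. \<forall>J u. u \<in> space (prior J) \<longrightarrow> \<bar>observed i J u\<bar> \<le> K" for i
  proof -
    obtain K where K: "\<And>a. elliptic_coeff astar a \<Longrightarrow> \<bar>l i (weak_solution D g a)\<bar> \<le> K"
      using observation_bounds[OF astar_pos g_dual l_dual[of i]] by blast
    have "\<bar>observed i J u\<bar> \<le> K" if "u \<in> space (prior J)" for J u
      by (rule K[OF coef_elliptic]) (use that in \<open>auto simp: space_prior\<close>)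
    then show ?thesis by blast
  qed
  then obtain K where K: "\<And>i J u. u \<in> space (prior J) \<Longrightarrow> \<bar>observed i J u\<bar> \<le> K i" by metis
  define S where "S = inv_sqrt_matrix \<Gamma>"
  define r where "r = onorm ((*v) S) * (norm y + (\<Sum>i\<in>UNIV. K i))"
  have bl: "bounded_linear ((*v) S)" by (simp add: matrix_vector_mul_bounded_linear)
  show ?thesis
  proof (rule that[of "exp (- (1/2) * r\<^sup>2)"])
    fix J u assume u: "u \<in> space (prior J)"
    have "norm (forward_map D g l (coef J u)) \<le> (\<Sum>i\<in>UNIV. \<bar>forward_map D g l (coef J u) $ i\<bar>)"
      by (rule norm_le_l1_cart)
    also have "\<dots> \<le> (\<Sum>i\<in>UNIV. K i)" using K[OF u] by (intro sum_mono) (simp add: forward_map_def)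
    finally have "norm (y - forward_map D g l (coef J u)) \<le> norm y + (\<Sum>i\<in>UNIV. K i)"
      using norm_triangle_ineq4[of y "forward_map D g l (coef J u)"] by linarith
    then have "cov_norm \<Gamma> (y - forward_map D g l (coef J u)) \<le> r"
      unfolding cov_norm_def r_def S_def[symmetric]
      by (rule order_trans[OF onorm[OF bl] mult_left_mono[OF _ onorm_pos_le[OF bl]]])
    then have "(cov_norm \<Gamma> (y - forward_map D g l (coef J u)))\<^sup>2 \<le> r\<^sup>2"
      by (intro power_mono) (auto simp: cov_norm_def)
    then show "exp (- (1/2) * r\<^sup>2) \<le> likelihood (forward_map D g l) \<Gamma> y (coef J) u"
      by (simp add: likelihood_def)
  qed (auto simp: likelihood_def)
qed

text \<open>Functionals of norm zero annihilate the solution, so the data do not inform about \<open>u\<close>.\<close>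

lemma likelihood_const:
  assumes "\<And>i. Hm1_norm D (l i) = 0" and u: "u \<in> space (prior J)"
  shows "likelihood (forward_map D g l) \<Gamma> y (coef J) u = exp (- (1/2) * (cov_norm \<Gamma> y)\<^sup>2)"
proof -
  have "elliptic_coeff astar (coef J u)"
    by (rule coef_elliptic) (use u in \<open>auto simp: space_prior\<close>)
  then have "l i (weak_solution D g (coef J u)) = 0" for i
    using Hm1_norm_zero[OF l_dual assms(1) weak_solution(1)[OF _ astar_pos g_dual]] by blast
  then have "forward_map D g l (coef J u) = 0" by (simp add: forward_map_def vec_eq_iff)
  then show ?thesis by (simp add: likelihood_def)
qed

end

section \<open>Reversible Markov kernels\<close>

definition var_of :: "'a measure \<Rightarrow> ('a \<Rightarrow> real) \<Rightarrow> real" where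
  "var_of \<nu> f = (\<integral>x. (f x)\<^sup>2 \<partial>\<nu>) - (\<integral>x. f x \<partial>\<nu>)\<^sup>2"

lemma var_of_eq:
  assumes "prob_space \<nu>" "f \<in> L2_space \<nu>"
  shows "(L2_norm \<nu> (\<lambda>x. f x - (\<integral>x. f x \<partial>\<nu>)))\<^sup>2 = var_of \<nu> f"
proof -
  interpret prob_space \<nu> by fact
  have i: "integrable \<nu> f" "integrable \<nu> (\<lambda>x. (f x)\<^sup>2)"
    using L2_space_integrable[OF _ assms(2)] L2_spaceD(2)[OF assms(2)] finite_measure_axioms by auto
  have "(L2_norm \<nu> (\<lambda>x. f x - (\<integral>x. f x \<partial>\<nu>)))\<^sup>2 = (\<integral>x. (f x)\<^sup>2 - 2 * (\<integral>x. f x \<partial>\<nu>) * f x + (\<integral>x. f x \<partial>\<nu>)\<^sup>2 \<partial>\<nu>)"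
    unfolding L2_norm_power2 by (intro Bochner_Integration.integral_cong) (auto simp: power2_diff)
  also have "\<dots> = var_of \<nu> f"
    using i by (simp add: var_of_def prob_space power2_eq_square)
  finally show ?thesis .
qed

lemma L2_space_const: "finite_measure \<nu> \<Longrightarrow> (\<lambda>x. c::'b::euclidean_space) \<in> L2_space \<nu>"
  by (intro L2_space_bounded[where B="norm c"]) auto

locale markov_prob = prob_space \<nu> for \<nu> :: "'a measure" +
  fixes P :: "'a \<Rightarrow> 'a measure"
  assumes kernel: "markov_kernel \<nu> P"
begin

abbreviation "J \<equiv> kernel_joint \<nu> P"

lemma kernel_subprob [measurable]: "P \<in> \<nu> \<rightarrow>\<^sub>M subprob_algebra \<nu>"
  using kernel unfolding markov_kernel_def by (rule measurable_prob_algebraD)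

lemma prob_P: "x \<in> space \<nu> \<Longrightarrow> prob_space (P x)"
  using kernel unfolding markov_kernel_def prob_algebra_def
  by (auto dest!: measurable_space simp: space_restrict_space)

lemma sets_P: "x \<in> space \<nu> \<Longrightarrow> sets (P x) = sets \<nu>"
  by (rule sets_kernel[OF kernel_subprob])

lemma measurable_P: "x \<in> space \<nu> \<Longrightarrow> borel_measurable (P x) = borel_measurable \<nu>"
  by (intro measurable_cong_sets sets_P) auto

lemma joint_kernel_measurable: "(\<lambda>x. distr (P x) (\<nu> \<Otimes>\<^sub>M \<nu>) (\<lambda>y. (x, y))) \<in> \<nu> \<rightarrow>\<^sub>M subprob_algebra (\<nu> \<Otimes>\<^sub>M \<nu>)"
  by (rule measurable_distr2[OF _ kernel_subprob]) simp

lemma sets_J [measurable_cong, simp]: "sets J = sets (\<nu> \<Otimes>\<^sub>M \<nu>)"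
  unfolding kernel_joint_def
  by (rule sets_bind_measurable[OF joint_kernel_measurable not_empty])

lemma nn_integral_J:
  assumes F: "F \<in> borel_measurable (\<nu> \<Otimes>\<^sub>M \<nu>)"
  shows "(\<integral>\<^sup>+z. F z \<partial>J) = (\<integral>\<^sup>+x. \<integral>\<^sup>+y. F (x, y) \<partial>P x \<partial>\<nu>)"
proof -
  have "(\<integral>\<^sup>+z. F z \<partial>J) = (\<integral>\<^sup>+x. \<integral>\<^sup>+z. F z \<partial>distr (P x) (\<nu> \<Otimes>\<^sub>M \<nu>) (\<lambda>y. (x, y)) \<partial>\<nu>)"
    unfolding kernel_joint_def by (rule nn_integral_bind[OF F joint_kernel_measurable])
  also have "\<dots> = (\<integral>\<^sup>+x. \<integral>\<^sup>+y. F (x, y) \<partial>P x \<partial>\<nu>)"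
  proof (rule nn_integral_cong)
    fix x assume x: "x \<in> space \<nu>"
    have "(\<lambda>y. (x, y)) \<in> P x \<rightarrow>\<^sub>M \<nu> \<Otimes>\<^sub>M \<nu>"
      using measurable_Pair1'[OF x] measurable_cong_sets[OF sets_P[OF x] refl] by blast
    then show "(\<integral>\<^sup>+z. F z \<partial>distr (P x) (\<nu> \<Otimes>\<^sub>M \<nu>) (\<lambda>y. (x, y))) = (\<integral>\<^sup>+y. F (x, y) \<partial>P x)"
      by (rule nn_integral_distr) (use F in simp)
  qed
  finally show ?thesis .
qed

lemma nn_integral_P_measurable:
  assumes "F \<in> borel_measurable (\<nu> \<Otimes>\<^sub>M \<nu>)"
  shows "(\<lambda>x. \<integral>\<^sup>+y. F (x, y) \<partial>P x) \<in> borel_measurable \<nu>"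
  by (rule nn_integral_measurable_subprob_algebra2[OF _ kernel_subprob]) (use assms in simp)

lemma nn_integral_J_fst:
  assumes "f \<in> borel_measurable \<nu>"
  shows "(\<integral>\<^sup>+z. f (fst z) \<partial>J) = (\<integral>\<^sup>+x. f x \<partial>\<nu>)"
proof -
  have "(\<integral>\<^sup>+z. f (fst z) \<partial>J) = (\<integral>\<^sup>+x. \<integral>\<^sup>+y. f (fst (x, y)) \<partial>P x \<partial>\<nu>)"
    by (rule nn_integral_J) (use assms in measurable)
  also have "\<dots> = (\<integral>\<^sup>+x. f x \<partial>\<nu>)"
    by (intro nn_integral_cong) (simp add: prob_space.emeasure_space_1[OF prob_P])
  finally show ?thesis .
qed

lemma space_J: "space J = space \<nu> \<times> space \<nu>"
  using sets_eq_imp_space_eq[OF sets_J] by (simp add: space_pair_measure)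

lemma prob_J: "prob_space J"
proof
  have "emeasure J (space J) = (\<integral>\<^sup>+z. 1 \<partial>J)" by simp
  also have "\<dots> = (\<integral>\<^sup>+x. 1 \<partial>\<nu>)" by (rule nn_integral_J_fst) simp
  finally show "emeasure J (space J) = 1" by (simp add: emeasure_space_1)
qed

lemma measurable_fst_J [measurable]: "fst \<in> J \<rightarrow>\<^sub>M \<nu>"
  and measurable_snd_J [measurable]: "snd \<in> J \<rightarrow>\<^sub>M \<nu>"
  by (simp_all cong: measurable_cong_sets)

lemma distr_J_fst: "distr J \<nu> fst = \<nu>"
proof (rule measure_eqI)
  fix A assume "A \<in> sets (distr J \<nu> fst)"
  then have A: "A \<in> sets \<nu>" by simp
  have "emeasure (distr J \<nu> fst) A = (\<integral>\<^sup>+x. indicator A x \<partial>distr J \<nu> fst)" using A by simp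
  also have "\<dots> = (\<integral>\<^sup>+z. indicator A (fst z) \<partial>J)" using A by (intro nn_integral_distr) auto
  also have "\<dots> = emeasure \<nu> A" using A by (subst nn_integral_J_fst) auto
  finally show "emeasure (distr J \<nu> fst) A = emeasure \<nu> A" .
qed simp

text \<open>Fubini's theorem for the joint law of a kernel. The positive and negative parts reduce it to nonnegative functions.\<close>

lemma integral_J:
  fixes F :: "'a \<times> 'a \<Rightarrow> real"
  assumes F: "integrable J F"
  shows "AE x in \<nu>. integrable (P x) (\<lambda>y. F (x, y))" and "(\<integral>z. F z \<partial>J) = (\<integral>x. \<integral>y. F (x, y) \<partial>P x \<partial>\<nu>)"
proof -
  have [measurable]: "F \<in> borel_measurable (\<nu> \<Otimes>\<^sub>M \<nu>)"
    using borel_measurable_integrable[OF F] by (simp cong: measurable_cong_sets)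
  define A B where "A x = (\<integral>\<^sup>+y. ennreal (F (x, y)) \<partial>P x)" and "B x = (\<integral>\<^sup>+y. ennreal (- F (x, y)) \<partial>P x)" for x
  have [measurable]: "A \<in> borel_measurable \<nu>" "B \<in> borel_measurable \<nu>"
    using nn_integral_P_measurable[of "\<lambda>z. ennreal (F z)"] nn_integral_P_measurable[of "\<lambda>z. ennreal (- F z)"]
    by (auto simp: A_def[abs_def] B_def[abs_def])
  have JA: "(\<integral>\<^sup>+z. ennreal (F z) \<partial>J) = (\<integral>\<^sup>+x. A x \<partial>\<nu>)" and JB: "(\<integral>\<^sup>+z. ennreal (- F z) \<partial>J) = (\<integral>\<^sup>+x. B x \<partial>\<nu>)"
    unfolding A_def B_def by (intro nn_integral_J; measurable)+
  have fin: "(\<integral>\<^sup>+x. A x \<partial>\<nu>) \<noteq> \<infinity>" "(\<integral>\<^sup>+x. B x \<partial>\<nu>) \<noteq> \<infinity>"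
    using F JA JB by (auto simp: real_integrable_def)
  have AEfin: "AE x in \<nu>. A x \<noteq> \<infinity>" "AE x in \<nu>. B x \<noteq> \<infinity>"
    using nn_integral_PInf_AE[OF _ fin(1)] nn_integral_PInf_AE[OF _ fin(2)] by auto
  have meas: "(\<lambda>y. F (x, y)) \<in> borel_measurable (P x)" if "x \<in> space \<nu>" for x
    unfolding measurable_P[OF that] using that by measurable
  show int: "AE x in \<nu>. integrable (P x) (\<lambda>y. F (x, y))"
    using AEfin AE_space
  proof eventually_elim
    case (elim x)
    then show ?case using meas[of x] by (simp add: real_integrable_def A_def B_def)
  qed
  have eA: "(\<integral>x. enn2real (A x) \<partial>\<nu>) = enn2real (\<integral>\<^sup>+x. A x \<partial>\<nu>)" "integrable \<nu> (\<lambda>x. enn2real (A x))"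
   and eB: "(\<integral>x. enn2real (B x) \<partial>\<nu>) = enn2real (\<integral>\<^sup>+x. B x \<partial>\<nu>)" "integrable \<nu> (\<lambda>x. enn2real (B x))"
  proof -
    have *: "(\<integral>x. enn2real (C x) \<partial>\<nu>) = enn2real (\<integral>\<^sup>+x. C x \<partial>\<nu>) \<and> integrable \<nu> (\<lambda>x. enn2real (C x))"
      if [measurable]: "C \<in> borel_measurable \<nu>" and C: "AE x in \<nu>. C x \<noteq> \<infinity>" "(\<integral>\<^sup>+x. C x \<partial>\<nu>) \<noteq> \<infinity>" for C
    proof -
      have eq: "(\<integral>\<^sup>+x. ennreal (enn2real (C x)) \<partial>\<nu>) = (\<integral>\<^sup>+x. C x \<partial>\<nu>)"
        using C(1) by (intro nn_integral_cong_AE) (auto elim!: eventually_mono simp: ennreal_enn2real_if)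
      moreover have "(\<integral>x. enn2real (C x) \<partial>\<nu>) = enn2real (\<integral>\<^sup>+x. ennreal (enn2real (C x)) \<partial>\<nu>)"
        by (intro integral_eq_nn_integral) auto
      moreover have "integrable \<nu> (\<lambda>x. enn2real (C x))"
        using C(2) eq by (intro integrableI_nonneg) (auto simp: less_top)
      ultimately show ?thesis by simp
    qed
    show "(\<integral>x. enn2real (A x) \<partial>\<nu>) = enn2real (\<integral>\<^sup>+x. A x \<partial>\<nu>)" "integrable \<nu> (\<lambda>x. enn2real (A x))"
      using *[of A] AEfin fin by auto
    show "(\<integral>x. enn2real (B x) \<partial>\<nu>) = enn2real (\<integral>\<^sup>+x. B x \<partial>\<nu>)" "integrable \<nu> (\<lambda>x. enn2real (B x))"
      using *[of B] AEfin fin by auto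
  qed
  have "(\<lambda>x. if A x \<noteq> \<infinity> \<and> B x \<noteq> \<infinity> then enn2real (A x) - enn2real (B x) else 0) \<in> borel_measurable \<nu>"
    by measurable
  then have "(\<lambda>x. \<integral>y. F (x, y) \<partial>P x) \<in> borel_measurable \<nu>"
  proof (rule measurable_cong[THEN iffD1, rotated])
    fix x assume x: "x \<in> space \<nu>"
    have "integrable (P x) (\<lambda>y. F (x, y)) \<longleftrightarrow> A x \<noteq> \<infinity> \<and> B x \<noteq> \<infinity>"
      using meas[OF x] by (simp add: real_integrable_def A_def B_def)
    then show "(if A x \<noteq> \<infinity> \<and> B x \<noteq> \<infinity> then enn2real (A x) - enn2real (B x) else 0) = (\<integral>y. F (x, y) \<partial>P x)"
      by (auto simp: real_lebesgue_integral_def not_integrable_integral_eq A_def[symmetric] B_def[symmetric])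
  qed
  then have "(\<integral>x. \<integral>y. F (x, y) \<partial>P x \<partial>\<nu>) = (\<integral>x. enn2real (A x) - enn2real (B x) \<partial>\<nu>)"
  proof (rule integral_cong_AE)
    show "(\<lambda>x. enn2real (A x) - enn2real (B x)) \<in> borel_measurable \<nu>" by measurable
    show "AE x in \<nu>. (\<integral>y. F (x, y) \<partial>P x) = enn2real (A x) - enn2real (B x)"
      using int by eventually_elim (simp add: real_lebesgue_integral_def A_def B_def)
  qed
  also have "\<dots> = (\<integral>x. enn2real (A x) \<partial>\<nu>) - (\<integral>x. enn2real (B x) \<partial>\<nu>)"
    using eA eB by simp
  also have "\<dots> = (\<integral>z. F z \<partial>J)"
    unfolding eA eB real_lebesgue_integral_def[OF F] JA JB ..
  finally show "(\<integral>z. F z \<partial>J) = (\<integral>x. \<integral>y. F (x, y) \<partial>P x \<partial>\<nu>)" ..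
qed

lemma kernel_op_measurable:
  assumes "f \<in> borel_measurable \<nu>"
  shows "kernel_op P f \<in> borel_measurable \<nu>"
  unfolding kernel_op_def[abs_def]
  by (rule measurable_compose[OF kernel_subprob integral_measurable_subprob_algebra[OF assms]])

end

locale reversible_prob = markov_prob +
  assumes rev: "reversible \<nu> P"
begin

lemma nn_integral_J_swap:
  assumes F: "F \<in> borel_measurable (\<nu> \<Otimes>\<^sub>M \<nu>)"
  shows "(\<integral>\<^sup>+z. F (snd z, fst z) \<partial>J) = (\<integral>\<^sup>+z. F z \<partial>J)"
proof -
  have "(\<integral>\<^sup>+z. F z \<partial>J) = (\<integral>\<^sup>+z. F z \<partial>distr J (\<nu> \<Otimes>\<^sub>M \<nu>) (\<lambda>(x, y). (y, x)))"
    using rev unfolding reversible_def by simp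
  also have "\<dots> = (\<integral>\<^sup>+z. F (case z of (x, y) \<Rightarrow> (y, x)) \<partial>J)"
    by (rule nn_integral_distr) (use F in \<open>auto cong: measurable_cong_sets\<close>)
  finally show ?thesis by (simp add: case_prod_unfold)
qed

lemma nn_integral_J_snd:
  assumes "f \<in> borel_measurable \<nu>"
  shows "(\<integral>\<^sup>+z. f (snd z) \<partial>J) = (\<integral>\<^sup>+x. f x \<partial>\<nu>)"
  using nn_integral_J_swap[of "\<lambda>z. f (fst z)"] nn_integral_J_fst[OF assms] assms by simp

lemma distr_J_snd: "distr J \<nu> snd = \<nu>"
proof (rule measure_eqI)
  fix A assume "A \<in> sets (distr J \<nu> snd)"
  then have A: "A \<in> sets \<nu>" by simp
  have "emeasure (distr J \<nu> snd) A = (\<integral>\<^sup>+x. indicator A x \<partial>distr J \<nu> snd)" using A by simp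
  also have "\<dots> = (\<integral>\<^sup>+z. indicator A (snd z) \<partial>J)" using A by (intro nn_integral_distr) auto
  also have "\<dots> = emeasure \<nu> A" using A by (subst nn_integral_J_snd) auto
  finally show "emeasure (distr J \<nu> snd) A = emeasure \<nu> A" .
qed simp

lemma integral_J_marginal:
  fixes f :: "'a \<Rightarrow> real"
  assumes "f \<in> borel_measurable \<nu>"
  shows "(\<integral>z. f (fst z) \<partial>J) = (\<integral>x. f x \<partial>\<nu>)" "(\<integral>z. f (snd z) \<partial>J) = (\<integral>x. f x \<partial>\<nu>)"
    "integrable J (\<lambda>z. f (fst z)) \<longleftrightarrow> integrable \<nu> f" "integrable J (\<lambda>z. f (snd z)) \<longleftrightarrow> integrable \<nu> f"
  using integral_distr[OF measurable_fst_J assms] integral_distr[OF measurable_snd_J assms]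
    integrable_distr_eq[OF measurable_fst_J assms] integrable_distr_eq[OF measurable_snd_J assms]
  unfolding distr_J_fst distr_J_snd by auto

lemma L2_lift:
  fixes f :: "'a \<Rightarrow> real"
  assumes f: "f \<in> L2_space \<nu>"
  shows "(\<lambda>z. f (fst z)) \<in> L2_space J" "(\<lambda>z. f (snd z)) \<in> L2_space J"
    "L2_norm J (\<lambda>z. f (fst z)) = L2_norm \<nu> f" "L2_norm J (\<lambda>z. f (snd z)) = L2_norm \<nu> f"
proof -
  have [measurable]: "f \<in> borel_measurable \<nu>" using f by (rule L2_spaceD)
  have sq: "(\<lambda>x. (norm (f x))\<^sup>2) \<in> borel_measurable \<nu>" by measurable
  show "(\<lambda>z. f (fst z)) \<in> L2_space J" "(\<lambda>z. f (snd z)) \<in> L2_space J"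
    using integral_J_marginal(3,4)[OF sq] L2_spaceD(2)[OF f] by (auto simp: L2_space_def)
  show "L2_norm J (\<lambda>z. f (fst z)) = L2_norm \<nu> f" "L2_norm J (\<lambda>z. f (snd z)) = L2_norm \<nu> f"
    unfolding L2_norm_def using integral_J_marginal(1,2)[OF sq] by auto
qed

lemma J_product_integrable:
  fixes f h :: "'a \<Rightarrow> real"
  assumes "f \<in> L2_space \<nu>" "h \<in> L2_space \<nu>"
  shows "integrable J (\<lambda>z. f (fst z) * h (snd z))"
  using L2_inner_integrable[OF L2_lift(1)[OF assms(1)] L2_lift(2)[OF assms(2)]] by simp

lemma J_product_commute:
  fixes f h :: "'a \<Rightarrow> real"
  assumes "f \<in> L2_space \<nu>" "h \<in> L2_space \<nu>"
  shows "(\<integral>z. f (fst z) * h (snd z) \<partial>J) = (\<integral>z. h (fst z) * f (snd z) \<partial>J)"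
proof -
  have [measurable]: "f \<in> borel_measurable \<nu>" "h \<in> borel_measurable \<nu>"
    using assms by (auto dest: L2_spaceD)
  have "(\<integral>z. f (fst z) * h (snd z) \<partial>J) = (\<integral>z. f (fst z) * h (snd z) \<partial>distr J (\<nu> \<Otimes>\<^sub>M \<nu>) (\<lambda>(x, y). (y, x)))"
    using rev unfolding reversible_def by simp
  also have "\<dots> = (\<integral>z. f (fst (case z of (x, y) \<Rightarrow> (y, x))) * h (snd (case z of (x, y) \<Rightarrow> (y, x))) \<partial>J)"
    by (rule integral_distr) (auto cong: measurable_cong_sets)
  finally show ?thesis by (simp add: case_prod_unfold mult.commute)
qed

text \<open>Jensen's inequality in each \<open>P x\<close>, followed by the invariance of \<open>\<nu>\<close>.\<close>

lemma kernel_op_L2: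
  assumes f: "f \<in> L2_space \<nu>"
  shows "kernel_op P f \<in> L2_space \<nu>" "L2_norm \<nu> (kernel_op P f) \<le> L2_norm \<nu> f"
proof -
  have [measurable]: "f \<in> borel_measurable \<nu>" using f by (rule L2_spaceD)
  have [measurable]: "kernel_op P f \<in> borel_measurable \<nu>" by (rule kernel_op_measurable) simp
  have nnf: "(\<integral>\<^sup>+x. ennreal ((f x)\<^sup>2) \<partial>\<nu>) = ennreal (\<integral>x. (f x)\<^sup>2 \<partial>\<nu>)"
    using L2_spaceD(2)[OF f] by (intro nn_integral_eq_integral) auto
  have Jf: "(\<integral>\<^sup>+x. \<integral>\<^sup>+y. ennreal ((f y)\<^sup>2) \<partial>P x \<partial>\<nu>) = (\<integral>\<^sup>+x. ennreal ((f x)\<^sup>2) \<partial>\<nu>)"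
    using nn_integral_J[of "\<lambda>z. ennreal ((f (snd z))\<^sup>2)"] nn_integral_J_snd[of "\<lambda>x. ennreal ((f x)\<^sup>2)"] by simp
  have le: "ennreal ((kernel_op P f x)\<^sup>2) \<le> (\<integral>\<^sup>+y. ennreal ((f y)\<^sup>2) \<partial>P x)" if x: "x \<in> space \<nu>" for x
  proof (cases "(\<integral>\<^sup>+y. ennreal ((f y)\<^sup>2) \<partial>P x) = \<infinity>")
    case False
    interpret Px: prob_space "P x" by (rule prob_P[OF x])
    have [measurable]: "f \<in> borel_measurable (P x)" unfolding measurable_P[OF x] by simp
    have int: "integrable (P x) (\<lambda>y. (f y)\<^sup>2)"
      using False by (intro integrableI_nonneg) (auto simp: less_top)
    then have fL: "f \<in> L2_space (P x)" by (auto simp: L2_space_def)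
    have 1: "(\<lambda>_. 1::real) \<in> L2_space (P x)" by (rule L2_space_const) (rule Px.finite_measure_axioms)
    have "\<bar>kernel_op P f x\<bar> \<le> L2_norm (P x) f * L2_norm (P x) (\<lambda>_. 1::real)"
      using L2_Cauchy_Schwarz[OF fL 1] by (simp add: kernel_op_def)
    also have "L2_norm (P x) (\<lambda>_. 1::real) = 1" by (simp add: L2_norm_def Px.prob_space)
    finally have "\<bar>kernel_op P f x\<bar>\<^sup>2 \<le> (L2_norm (P x) f)\<^sup>2"
      by (intro power_mono) auto
    then have "ennreal ((kernel_op P f x)\<^sup>2) \<le> ennreal (\<integral>y. (f y)\<^sup>2 \<partial>P x)"
      by (intro ennreal_leI) (simp add: L2_norm_power2)
    also have "\<dots> = (\<integral>\<^sup>+y. ennreal ((f y)\<^sup>2) \<partial>P x)" using int by (intro nn_integral_eq_integral[symmetric]) auto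
    finally show ?thesis .
  qed simp
  have "(\<integral>\<^sup>+x. ennreal ((kernel_op P f x)\<^sup>2) \<partial>\<nu>) \<le> (\<integral>\<^sup>+x. \<integral>\<^sup>+y. ennreal ((f y)\<^sup>2) \<partial>P x \<partial>\<nu>)"
    by (rule nn_integral_mono[OF le])
  then have bound: "(\<integral>\<^sup>+x. ennreal ((kernel_op P f x)\<^sup>2) \<partial>\<nu>) \<le> ennreal (\<integral>x. (f x)\<^sup>2 \<partial>\<nu>)"
    unfolding Jf nnf .
  then have int: "integrable \<nu> (\<lambda>x. (kernel_op P f x)\<^sup>2)"
    by (intro integrableI_nonneg) (auto simp: le_less_trans)
  then show "kernel_op P f \<in> L2_space \<nu>" by (auto simp: L2_space_def)
  have "ennreal (\<integral>x. (kernel_op P f x)\<^sup>2 \<partial>\<nu>) \<le> ennreal (\<integral>x. (f x)\<^sup>2 \<partial>\<nu>)"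
    using bound by (subst (asm) nn_integral_eq_integral[OF int]) auto
  then have "(\<integral>x. (kernel_op P f x)\<^sup>2 \<partial>\<nu>) \<le> (\<integral>x. (f x)\<^sup>2 \<partial>\<nu>)" by (simp add: ennreal_le_iff)
  then show "L2_norm \<nu> (kernel_op P f) \<le> L2_norm \<nu> f" by (simp add: L2_norm_def)
qed

lemma kernel_op_pairing:
  fixes f h :: "'a \<Rightarrow> real"
  assumes f: "f \<in> L2_space \<nu>" and h: "h \<in> L2_space \<nu>"
  shows "(\<integral>x. h x * kernel_op P f x \<partial>\<nu>) = (\<integral>z. h (fst z) * f (snd z) \<partial>J)"
  using integral_J(2)[OF J_product_integrable[OF h f]] by (simp add: kernel_op_def)

lemma integral_kernel_op:
  fixes f :: "'a \<Rightarrow> real"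
  assumes f: "f \<in> L2_space \<nu>"
  shows "(\<integral>x. kernel_op P f x \<partial>\<nu>) = (\<integral>x. f x \<partial>\<nu>)"
  using kernel_op_pairing[OF f L2_space_const[OF finite_measure_axioms, of 1]]
    integral_J_marginal(2)[OF L2_spaceD(1)[OF f]] by simp

lemma L2_beta_set_bdd:
  "bdd_above {L2_norm \<nu> (kernel_op P f) / L2_norm \<nu> f | f.
     f \<in> L2_space \<nu> \<and> L2_norm \<nu> f \<noteq> 0 \<and> (\<integral>x. f x \<partial>\<nu>) = 0}"
proof (rule bdd_aboveI[of _ 1])
  fix r assume "r \<in> {L2_norm \<nu> (kernel_op P f) / L2_norm \<nu> f | f.
     f \<in> L2_space \<nu> \<and> L2_norm \<nu> f \<noteq> 0 \<and> (\<integral>x. f x \<partial>\<nu>) = 0}"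
  then obtain f where r: "r = L2_norm \<nu> (kernel_op P f) / L2_norm \<nu> f" and f: "f \<in> L2_space \<nu>" "L2_norm \<nu> f \<noteq> 0" by auto
  then have "L2_norm \<nu> f > 0" by (simp add: less_le)
  then show "r \<le> 1" unfolding r using kernel_op_L2(2)[OF f(1)] by simp
qed

lemma kernel_op_L2_beta:
  assumes f: "f \<in> L2_space \<nu>" "(\<integral>x. f x \<partial>\<nu>) = 0"
  shows "L2_norm \<nu> (kernel_op P f) \<le> L2_beta \<nu> P * L2_norm \<nu> f"
proof (cases "L2_norm \<nu> f = 0")
  case True
  then show ?thesis using kernel_op_L2(2)[OF f(1)] by simp
next
  case False
  then have pos: "L2_norm \<nu> f > 0" by (simp add: less_le)
  have "L2_norm \<nu> (kernel_op P f) / L2_norm \<nu> f \<le> L2_beta \<nu> P"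
    unfolding L2_beta_def by (rule cSup_upper[OF _ L2_beta_set_bdd]) (use f False in blast)
  then show ?thesis using pos by (simp add: field_simps)
qed

text \<open>A centred indicator shows that \<open>L\<^sup>2\<close> contains a nonzero mean-zero function. It keeps the supremum that defines
  \<^const>\<open>L2_beta\<close> from being taken over the empty set, where a real supremum has no meaning.\<close>

lemma L2_centered_event:
  assumes A: "A \<in> sets \<nu>" "0 < prob A" "prob A < 1"
  defines "f \<equiv> \<lambda>x. indicator A x - prob A"
  shows "f \<in> L2_space \<nu>" "L2_norm \<nu> f \<noteq> 0" "(\<integral>x. f x \<partial>\<nu>) = 0"
proof -
  have ind: "(indicator A :: 'a \<Rightarrow> real) \<in> L2_space \<nu>"
    by (rule L2_space_bounded[OF finite_measure_axioms, where B=1]) (use A in \<open>auto simp: indicator_def\<close>)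
  show "f \<in> L2_space \<nu>"
    unfolding f_def by (intro L2_space_diff ind L2_space_const finite_measure_axioms)
  have e: "(\<integral>x. indicator A x \<partial>\<nu>) = prob A" using A by simp
  show "(\<integral>x. f x \<partial>\<nu>) = 0"
    unfolding f_def using A L2_space_integrable[OF finite_measure_axioms ind] by (simp add: prob_space)
  have "(L2_norm \<nu> f)\<^sup>2 = var_of \<nu> (indicator A)"
    using var_of_eq[OF prob_space_axioms ind] by (simp add: f_def e sets.Int_space_eq2[OF A(1)])
  also have "\<dots> = prob A * (1 - prob A)"
  proof -
    have "(\<lambda>x. (indicator A x :: real)\<^sup>2) = indicator A" by (auto simp: indicator_def fun_eq_iff)
    then show ?thesis by (simp only: var_of_def e) (simp add: power2_eq_square algebra_simps)
  qed
  finally show "L2_norm \<nu> f \<noteq> 0" using A by auto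
qed

lemma L2_beta_nonneg:
  assumes "A \<in> sets \<nu>" "0 < prob A" "prob A < 1"
  shows "0 \<le> L2_beta \<nu> P"
proof -
  note f = L2_centered_event[OF assms]
  have "0 \<le> L2_norm \<nu> (kernel_op P (\<lambda>x. indicator A x - prob A))" by simp
  also have "\<dots> \<le> L2_beta \<nu> P * L2_norm \<nu> (\<lambda>x. indicator A x - prob A)"
    by (rule kernel_op_L2_beta[OF f(1,3)])
  finally have "0 \<le> L2_beta \<nu> P * L2_norm \<nu> (\<lambda>x. indicator A x - prob A)" .
  moreover have "0 < L2_norm \<nu> (\<lambda>x. indicator A x - prob A)" using f(2) by (simp add: less_le)
  ultimately show ?thesis by (simp add: zero_le_mult_iff)
qed

text \<open>A bilinear and symmetric form of the spectral gap. The arithmetic mean of the variances on the right, instead of the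
  product of standard deviations, makes the bound additive and hence easy to integrate over further coordinates.\<close>

lemma correlation_bound:
  fixes f h :: "'a \<Rightarrow> real"
  assumes f: "f \<in> L2_space \<nu>" and h: "h \<in> L2_space \<nu>" and \<beta>: "0 \<le> L2_beta \<nu> P"
  shows "(\<integral>z. f (fst z) * h (snd z) \<partial>J) \<le> (\<integral>x. f x \<partial>\<nu>) * (\<integral>x. h x \<partial>\<nu>) + L2_beta \<nu> P / 2 * (var_of \<nu> f + var_of \<nu> h)"
proof -
  define F H where "F = (\<integral>x. f x \<partial>\<nu>)" and "H = (\<integral>x. h x \<partial>\<nu>)"
  define f0 h0 where "f0 x = f x - F" and "h0 x = h x - H" for x
  have c: "(\<lambda>_. c::real) \<in> L2_space \<nu>" for c by (rule L2_space_const[OF finite_measure_axioms])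
  have f0: "f0 \<in> L2_space \<nu>" and h0: "h0 \<in> L2_space \<nu>"
    unfolding f0_def h0_def by (intro L2_space_diff f h c)+
  have z: "(\<integral>x. f0 x \<partial>\<nu>) = 0" "(\<integral>x. h0 x \<partial>\<nu>) = 0"
    unfolding f0_def h0_def using L2_space_integrable[OF finite_measure_axioms f] L2_space_integrable[OF finite_measure_axioms h]
    by (auto simp: F_def H_def prob_space)
  note i = J_product_integrable[OF f0 h0] J_product_integrable[OF f0 c[of H]] J_product_integrable[OF c[of F] h0]
  have "(\<integral>z. f (fst z) * h (snd z) \<partial>J) = (\<integral>z. f0 (fst z) * h0 (snd z) + f0 (fst z) * H + F * h0 (snd z) + F * H \<partial>J)"
    by (intro Bochner_Integration.integral_cong) (auto simp: f0_def h0_def algebra_simps)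
  also have "\<dots> = (\<integral>z. f0 (fst z) * h0 (snd z) \<partial>J) + F * H"
    using i integral_J_marginal(1)[OF L2_spaceD(1)[OF f0]] integral_J_marginal(2)[OF L2_spaceD(1)[OF h0]] z
      prob_space.prob_space[OF prob_J] prob_space.finite_measure[OF prob_J]
    by (simp add: finite_measure.integrable_const)
  also have "(\<integral>z. f0 (fst z) * h0 (snd z) \<partial>J) = (\<integral>x. f0 x \<bullet> kernel_op P h0 x \<partial>\<nu>)"
    using kernel_op_pairing[OF h0 f0] by simp
  also have "\<dots> \<le> L2_norm \<nu> f0 * L2_norm \<nu> (kernel_op P h0)"
    using L2_Cauchy_Schwarz[OF f0 kernel_op_L2(1)[OF h0]] by linarith
  also have "\<dots> \<le> L2_norm \<nu> f0 * (L2_beta \<nu> P * L2_norm \<nu> h0)"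
    by (intro mult_left_mono kernel_op_L2_beta h0 z) simp
  also have "\<dots> \<le> L2_beta \<nu> P / 2 * ((L2_norm \<nu> f0)\<^sup>2 + (L2_norm \<nu> h0)\<^sup>2)"
    using mult_left_mono[OF sum_squares_bound[of "L2_norm \<nu> f0" "L2_norm \<nu> h0"] \<beta>] by (simp add: algebra_simps)
  also have "(L2_norm \<nu> f0)\<^sup>2 = var_of \<nu> f"
    unfolding f0_def F_def by (rule var_of_eq[OF prob_space_axioms f])
  also have "(L2_norm \<nu> h0)\<^sup>2 = var_of \<nu> h"
    unfolding h0_def H_def by (rule var_of_eq[OF prob_space_axioms h])
  finally show ?thesis by (simp add: F_def H_def)
qed

end

section \<open>Lazy kernels\<close>

lemma nn_integral_sum_measure:
  assumes N: "\<And>A. A \<in> sets N \<Longrightarrow> emeasure N A = emeasure D1 A + emeasure D2 A"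
    and s: "sets D1 = sets N" "sets D2 = sets N" and f: "f \<in> borel_measurable N"
  shows "(\<integral>\<^sup>+x. f x \<partial>N) = (\<integral>\<^sup>+x. f x \<partial>D1) + (\<integral>\<^sup>+x. f x \<partial>D2)"
proof -
  note sp = sets_eq_imp_space_eq[OF s(1)] sets_eq_imp_space_eq[OF s(2)]
  have m: "borel_measurable D1 = (borel_measurable N :: ('a \<Rightarrow> ennreal) set)" "borel_measurable D2 = (borel_measurable N :: ('a \<Rightarrow> ennreal) set)"
    by (intro measurable_cong_sets s refl)+
  show ?thesis
    using f
  proof (induction rule: borel_measurable_induct)
    case (cong f g)
    have "(\<integral>\<^sup>+x. f x \<partial>K) = (\<integral>\<^sup>+x. g x \<partial>K)" if "space K = space N" for K
      by (rule nn_integral_cong) (use cong that in auto)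
    then show ?case using cong sp by metis
  next
    case (set A) then show ?case using N s by simp
  next
    case (mult u c) then show ?case by (simp add: nn_integral_cmult m distrib_left)
  next
    case (add u v) then show ?case by (simp add: nn_integral_add m)
  next
    case (seq U)
    have "(\<integral>\<^sup>+x. (SUP i. U i) x \<partial>K) = (SUP i. \<integral>\<^sup>+x. U i x \<partial>K)"
      if "borel_measurable K = (borel_measurable N :: ('a \<Rightarrow> ennreal) set)" for K
      unfolding SUP_apply using seq that by (intro nn_integral_monotone_convergence_SUP) auto
    then have "(\<integral>\<^sup>+x. (SUP i. U i) x \<partial>D1) + (\<integral>\<^sup>+x. (SUP i. U i) x \<partial>D2)
        = (SUP i. \<integral>\<^sup>+x. U i x \<partial>D1) + (SUP i. \<integral>\<^sup>+x. U i x \<partial>D2)" using m by simp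
    also have "\<dots> = (SUP i. (\<integral>\<^sup>+x. U i x \<partial>D1) + (\<integral>\<^sup>+x. U i x \<partial>D2))"
      by (rule ennreal_SUP_add[symmetric]) (use seq in \<open>auto simp: incseq_def le_fun_def intro!: nn_integral_mono\<close>)
    also have "\<dots> = (\<integral>\<^sup>+x. (SUP i. U i) x \<partial>N)"
      unfolding SUP_apply using seq by (subst nn_integral_monotone_convergence_SUP) auto
    finally show ?case by simp
  qed
qed

lemma integral_sum_measure:
  fixes f :: "'a \<Rightarrow> real"
  assumes N: "\<And>A. A \<in> sets N \<Longrightarrow> emeasure N A = emeasure D1 A + emeasure D2 A"
    and s: "sets D1 = sets N" "sets D2 = sets N" and f: "integrable D1 f" "integrable D2 f"
  shows "integrable N f" "(\<integral>x. f x \<partial>N) = (\<integral>x. f x \<partial>D1) + (\<integral>x. f x \<partial>D2)"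
proof -
  have fm [measurable]: "f \<in> borel_measurable N"
    using borel_measurable_integrable[OF f(1)] measurable_cong_sets[OF s(1) refl] by blast
  have nn: "(\<integral>\<^sup>+x. ennreal (f x) \<partial>N) = (\<integral>\<^sup>+x. ennreal (f x) \<partial>D1) + (\<integral>\<^sup>+x. ennreal (f x) \<partial>D2)"
    "(\<integral>\<^sup>+x. ennreal (- f x) \<partial>N) = (\<integral>\<^sup>+x. ennreal (- f x) \<partial>D1) + (\<integral>\<^sup>+x. ennreal (- f x) \<partial>D2)"
    by (rule nn_integral_sum_measure[OF _ s]; auto simp: N)+
  have fin: "(\<integral>\<^sup>+x. ennreal (f x) \<partial>D1) < top" "(\<integral>\<^sup>+x. ennreal (f x) \<partial>D2) < top"
    "(\<integral>\<^sup>+x. ennreal (- f x) \<partial>D1) < top" "(\<integral>\<^sup>+x. ennreal (- f x) \<partial>D2) < top"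
    using f by (auto simp: real_integrable_def less_top)
  show i: "integrable N f" using fin fm by (auto simp: real_integrable_def nn)
  show "(\<integral>x. f x \<partial>N) = (\<integral>x. f x \<partial>D1) + (\<integral>x. f x \<partial>D2)"
    unfolding real_lebesgue_integral_def[OF i] real_lebesgue_integral_def[OF f(1)] real_lebesgue_integral_def[OF f(2)] nn
    using fin by (simp add: enn2real_plus)
qed

text \<open>The lazy and the Metropolis-Hastings kernels are given by explicit set functions. Each is the sum of an absolutely
  continuous part and an atom, and a sum of two measures is a measure.\<close>

lemma measure_of_sum:
  assumes s: "sets D1 = sets M" "sets D2 = sets M"
    and F: "\<And>A. A \<in> sets M \<Longrightarrow> F A = emeasure D1 A + emeasure D2 A"
  defines "N \<equiv> measure_of (space M) (sets M) F"
  shows "sets N = sets M" "A \<in> sets M \<Longrightarrow> emeasure N A = emeasure D1 A + emeasure D2 A"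
proof -
  show sN: "sets N = sets M" unfolding N_def by simp
  assume A: "A \<in> sets M"
  have "emeasure N A = F A"
  proof (rule emeasure_measure_of[OF N_def[THEN meta_eq_to_obj_eq]])
    show "sets M \<subseteq> Pow (space M)" by (rule sets.space_closed)
    show "positive (sets N) F" unfolding sN positive_def using F[of "{}"] by simp
    show "countably_additive (sets N) F"
      unfolding countably_additive_def sN
    proof (intro allI impI)
      fix B :: "nat \<Rightarrow> _" assume B: "range B \<subseteq> sets M" "disjoint_family B" "(\<Union>i. B i) \<in> sets M"
      have "(\<Sum>i. F (B i)) = (\<Sum>i. emeasure D1 (B i) + emeasure D2 (B i))"
        using B(1) by (intro suminf_cong F) auto
      also have "\<dots> = (\<Sum>i. emeasure D1 (B i)) + (\<Sum>i. emeasure D2 (B i))"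
        by (intro suminf_add[symmetric] summableI)
      also have "\<dots> = emeasure D1 (\<Union>i. B i) + emeasure D2 (\<Union>i. B i)"
        using B s by (simp add: suminf_emeasure)
      also have "\<dots> = F (\<Union>i. B i)" using F B by simp
      finally show "(\<Sum>i. F (B i)) = F (\<Union>i. B i)" .
    qed
    show "A \<in> sets N" using A sN by simp
  qed
  then show "emeasure N A = emeasure D1 A + emeasure D2 A" using F A by simp
qed

lemma sum_measure_const:
  assumes u: "u \<in> space M"
  shows "sets (density (return M u) (\<lambda>_. c)) = sets M"
    "A \<in> sets M \<Longrightarrow> emeasure (density (return M u) (\<lambda>_. c)) A = indicator A u * c"
    "f \<in> borel_measurable M \<Longrightarrow> (\<integral>\<^sup>+x. f x \<partial>density (return M u) (\<lambda>_. c)) = f u * c"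
proof -
  show "A \<in> sets M \<Longrightarrow> emeasure (density (return M u) (\<lambda>_. c)) A = indicator A u * c"
    by (subst emeasure_density) (use u in \<open>auto simp: nn_integral_return mult.commute\<close>)
  show "f \<in> borel_measurable M \<Longrightarrow> (\<integral>\<^sup>+x. f x \<partial>density (return M u) (\<lambda>_. c)) = f u * c"
    by (subst nn_integral_density) (use u in \<open>auto simp: nn_integral_return mult.commute\<close>)
qed simp

context markov_prob
begin

definition lazy_part :: "'a \<Rightarrow> 'a measure" where
  "lazy_part u = density (return \<nu> u) (\<lambda>_. ennreal (1/2))"

definition move_part :: "'a \<Rightarrow> 'a measure" where
  "move_part u = density (P u) (\<lambda>_. ennreal (1/2))"

lemma lazy_kernel_sum:
  assumes u: "u \<in> space \<nu>"
  shows "sets (lazy_kernel \<nu> P u) = sets \<nu>"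
    "A \<in> sets \<nu> \<Longrightarrow> emeasure (lazy_kernel \<nu> P u) A = emeasure (lazy_part u) A + emeasure (move_part u) A"
proof -
  have s: "sets (lazy_part u) = sets \<nu>" "sets (move_part u) = sets \<nu>"
    using sets_P[OF u] by (auto simp: lazy_part_def move_part_def)
  have F: "ennreal (1/2) * indicator A u + ennreal (1/2) * emeasure (P u) A
      = emeasure (lazy_part u) A + emeasure (move_part u) A" if A: "A \<in> sets \<nu>" for A
    using sum_measure_const(2)[OF u A] A sets_P[OF u]
    by (simp add: lazy_part_def move_part_def emeasure_density_const mult.commute)
  show "sets (lazy_kernel \<nu> P u) = sets \<nu>"
    "A \<in> sets \<nu> \<Longrightarrow> emeasure (lazy_kernel \<nu> P u) A = emeasure (lazy_part u) A + emeasure (move_part u) A"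
    unfolding lazy_kernel_def using measure_of_sum[OF s F] by auto
qed

lemma emeasure_lazy_kernel:
  assumes u: "u \<in> space \<nu>" and A: "A \<in> sets \<nu>"
  shows "emeasure (lazy_kernel \<nu> P u) A = ennreal (1/2) * indicator A u + ennreal (1/2) * emeasure (P u) A"
  unfolding lazy_kernel_sum(2)[OF u A]
  using sum_measure_const(2)[OF u A] A sets_P[OF u]
  by (simp add: lazy_part_def move_part_def emeasure_density_const mult.commute)

lemma markov_kernel_lazy: "markov_kernel \<nu> (lazy_kernel \<nu> P)"
  unfolding markov_kernel_def
proof (rule measurable_prob_algebraI)
  have "ennreal (1/2) + ennreal (1/2) = ennreal (1/2 + 1/2)" by (rule ennreal_plus[symmetric]) auto
  then have half: "ennreal (1/2) + ennreal (1/2) = 1" by simp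
  show pr: "prob_space (lazy_kernel \<nu> P u)" if u: "u \<in> space \<nu>" for u
  proof
    have sp: "space (lazy_kernel \<nu> P u) = space \<nu>" by (rule sets_eq_imp_space_eq[OF lazy_kernel_sum(1)[OF u]])
    have "emeasure (P u) (space \<nu>) = 1"
      using prob_space.emeasure_space_1[OF prob_P[OF u]] sets_eq_imp_space_eq[OF sets_P[OF u]] by simp
    then show "emeasure (lazy_kernel \<nu> P u) (space (lazy_kernel \<nu> P u)) = 1"
      unfolding sp using emeasure_lazy_kernel[OF u sets.top] u half by simp
  qed
  show "lazy_kernel \<nu> P \<in> \<nu> \<rightarrow>\<^sub>M subprob_algebra \<nu>"
  proof (rule measurable_subprob_algebra)
    show "subprob_space (lazy_kernel \<nu> P u)" if "u \<in> space \<nu>" for u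
      using pr[OF that] by (rule prob_space_imp_subprob_space)
    fix A assume A[measurable]: "A \<in> sets \<nu>"
    have "(\<lambda>u. ennreal (1/2) * indicator A u + ennreal (1/2) * emeasure (P u) A) \<in> borel_measurable \<nu>"
      using measurable_emeasure_kernel[OF kernel_subprob A] by measurable
    then show "(\<lambda>u. emeasure (lazy_kernel \<nu> P u) A) \<in> borel_measurable \<nu>"
      by (rule measurable_cong[THEN iffD2, rotated]) (rule emeasure_lazy_kernel[OF _ A])
  qed (rule lazy_kernel_sum(1))
qed

lemma kernel_op_lazy:
  assumes u: "u \<in> space \<nu>" and f: "f \<in> borel_measurable \<nu>" "integrable (P u) f"
  shows "kernel_op (lazy_kernel \<nu> P) f u = (f u + kernel_op P f u) / 2"
proof -
  have fr: "f \<in> borel_measurable (return \<nu> u)" using f(1) by simp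
  have fP: "f \<in> borel_measurable (P u)" using f(1) measurable_P[OF u] by auto
  have 1: "integrable (lazy_part u) f"
  proof (rule integrableI_bounded)
    have "(\<integral>\<^sup>+x. ennreal (norm (f x)) \<partial>lazy_part u) = ennreal (norm (f u)) * ennreal (1/2)"
      unfolding lazy_part_def by (rule sum_measure_const(3)[OF u]) (use f(1) in measurable)
    then show "(\<integral>\<^sup>+x. ennreal (norm (f x)) \<partial>lazy_part u) < \<infinity>"
      by (metis ennreal_less_top ennreal_mult infinity_ennreal_def norm_ge_zero zero_le_divide_1_iff zero_le_numeral)
  qed (use f(1) in \<open>simp add: lazy_part_def\<close>)
  have 2: "integrable (move_part u) f"
    unfolding move_part_def using f(2) fP by (subst integrable_density) auto
  have "kernel_op (lazy_kernel \<nu> P) f u = (\<integral>x. f x \<partial>lazy_part u) + (\<integral>x. f x \<partial>move_part u)"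
    unfolding kernel_op_def
  proof (rule integral_sum_measure(2)[OF _ _ _ 1 2])
    show "emeasure (lazy_kernel \<nu> P u) A = emeasure (lazy_part u) A + emeasure (move_part u) A"
      if "A \<in> sets (lazy_kernel \<nu> P u)" for A
      using lazy_kernel_sum(2)[OF u] that unfolding lazy_kernel_sum(1)[OF u] by simp
  qed (use lazy_kernel_sum(1)[OF u] sets_P[OF u] in \<open>auto simp: lazy_part_def move_part_def\<close>)
  also have "(\<integral>x. f x \<partial>lazy_part u) = f u / 2"
    unfolding lazy_part_def using fr u f(1) by (subst integral_density) (auto simp: integral_return)
  also have "(\<integral>x. f x \<partial>move_part u) = kernel_op P f u / 2"
    unfolding move_part_def kernel_op_def using fP by (subst integral_density) auto
  finally show ?thesis by simp
qed

end

context reversible_prob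
begin

text \<open>The quadratic form \<open>\<langle>f, (I + P) h\<rangle> / 2\<close> of the lazy kernel, which is symmetric and positive.\<close>

definition lazy_form :: "('a \<Rightarrow> real) \<Rightarrow> ('a \<Rightarrow> real) \<Rightarrow> real" where
  "lazy_form f h = (\<integral>x. f x * h x \<partial>\<nu>) / 2 + (\<integral>z. f (fst z) * h (snd z) \<partial>J) / 2"

lemma integral_square_J:
  fixes f :: "'a \<Rightarrow> real"
  assumes f: "f \<in> L2_space \<nu>"
  shows "integrable J (\<lambda>z. (f (fst z) - f (snd z))\<^sup>2)"
    "(\<integral>z. (f (fst z) - f (snd z))\<^sup>2 \<partial>J) = 2 * (L2_norm \<nu> f)\<^sup>2 - 2 * (\<integral>z. f (fst z) * f (snd z) \<partial>J)"
    "0 \<le> (L2_norm \<nu> f)\<^sup>2 + (\<integral>z. f (fst z) * f (snd z) \<partial>J)"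
proof -
  have sq: "(\<lambda>x. (f x)\<^sup>2) \<in> borel_measurable \<nu>" using L2_spaceD(1)[OF f] by measurable
  have i: "integrable J (\<lambda>z. (f (fst z))\<^sup>2)" "integrable J (\<lambda>z. (f (snd z))\<^sup>2)"
    "(\<integral>z. (f (fst z))\<^sup>2 \<partial>J) = (L2_norm \<nu> f)\<^sup>2" "(\<integral>z. (f (snd z))\<^sup>2 \<partial>J) = (L2_norm \<nu> f)\<^sup>2"
    using integral_J_marginal[OF sq] L2_spaceD(2)[OF f] by (auto simp: L2_norm_power2)
  note p = J_product_integrable[OF f f]
  have e: "(\<lambda>z. (f (fst z) - f (snd z))\<^sup>2) = (\<lambda>z. (f (fst z))\<^sup>2 + (f (snd z))\<^sup>2 - 2 * (f (fst z) * f (snd z)))"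
    by (auto simp: fun_eq_iff power2_diff)
  show "integrable J (\<lambda>z. (f (fst z) - f (snd z))\<^sup>2)" unfolding e using i p by auto
  show "(\<integral>z. (f (fst z) - f (snd z))\<^sup>2 \<partial>J) = 2 * (L2_norm \<nu> f)\<^sup>2 - 2 * (\<integral>z. f (fst z) * f (snd z) \<partial>J)"
    unfolding e using i p by simp
  have "0 \<le> (\<integral>z. (f (fst z) + f (snd z))\<^sup>2 \<partial>J)" by simp
  also have "(\<lambda>z. (f (fst z) + f (snd z))\<^sup>2) = (\<lambda>z. (f (fst z))\<^sup>2 + (f (snd z))\<^sup>2 + 2 * (f (fst z) * f (snd z)))"
    by (auto simp: fun_eq_iff power2_sum)
  finally show "0 \<le> (L2_norm \<nu> f)\<^sup>2 + (\<integral>z. f (fst z) * f (snd z) \<partial>J)" using i p by simp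
qed

text \<open>For a positive form with \<open>\<langle>S k, k\<rangle> \<le> s |k|\<^sup>2\<close> on mean-zero functions, positivity at \<open>s f - S f\<close> gives
  \<open>0 \<le> s\<^sup>3 |f|\<^sup>2 - s |S f|\<^sup>2\<close>. So the quadratic-form bound is also a bound for the operator norm, without
  any spectral theory.\<close>

lemma lazy_contraction:
  assumes gap: "\<And>f. f \<in> L2_space \<nu> \<Longrightarrow> (\<integral>x. f x \<partial>\<nu>) = 0 \<Longrightarrow>
      \<kappa> * (L2_norm \<nu> f)\<^sup>2 \<le> (\<integral>z. (f (fst z) - f (snd z))\<^sup>2 \<partial>J) / 2"
    and \<kappa>: "\<kappa> \<le> 1" and f: "f \<in> L2_space \<nu>" "(\<integral>x. f x \<partial>\<nu>) = 0"
  shows "L2_norm \<nu> (kernel_op (lazy_kernel \<nu> P) f) \<le> (1 - \<kappa> / 2) * L2_norm \<nu> f"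
proof -
  define s where "s = 1 - \<kappa> / 2"
  have s: "s > 0" using \<kappa> by (simp add: s_def)
  define h where "h x = (1/2) * f x + (1/2) * kernel_op P f x" for x
  have half: "(\<lambda>x. (1/2) * k x) \<in> L2_space \<nu>" if "k \<in> L2_space \<nu>" for k :: "'a \<Rightarrow> real"
    using L2_space_cmult[OF that, of "1/2"] by simp
  have h: "h \<in> L2_space \<nu>" unfolding h_def by (intro L2_space_add half f kernel_op_L2)
  have hz: "(\<integral>x. h x \<partial>\<nu>) = 0"
    unfolding h_def using f integral_kernel_op[OF f(1)] L2_space_integrable[OF finite_measure_axioms f(1)]
      L2_space_integrable[OF finite_measure_axioms kernel_op_L2(1)[OF f(1)]] by simp
  have up: "lazy_form k k \<le> s * (L2_norm \<nu> k)\<^sup>2" if k: "k \<in> L2_space \<nu>" "(\<integral>x. k x \<partial>\<nu>) = 0" for k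
  proof -
    have "(\<integral>x. k x * k x \<partial>\<nu>) = (L2_norm \<nu> k)\<^sup>2" unfolding L2_norm_power2 by (simp add: power2_eq_square)
    then show ?thesis
      using gap[OF k] unfolding lazy_form_def integral_square_J(2)[OF k(1)] s_def by (simp add: field_simps)
  qed
  have lo: "0 \<le> lazy_form k k" if k: "k \<in> L2_space \<nu>" for k
  proof -
    have "(\<integral>x. k x * k x \<partial>\<nu>) = (L2_norm \<nu> k)\<^sup>2" unfolding L2_norm_power2 by (simp add: power2_eq_square)
    then show ?thesis using integral_square_J(3)[OF k] unfolding lazy_form_def by simp
  qed
  have ph: "lazy_form h f = (L2_norm \<nu> h)\<^sup>2"
  proof -
    have i: "integrable \<nu> (\<lambda>x. h x * f x)" "integrable \<nu> (\<lambda>x. h x * kernel_op P f x)"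
      using L2_inner_integrable[OF h f(1)] L2_inner_integrable[OF h kernel_op_L2(1)[OF f(1)]] by auto
    have "(L2_norm \<nu> h)\<^sup>2 = (\<integral>x. h x * h x \<partial>\<nu>)" unfolding L2_norm_power2 by (simp add: power2_eq_square)
    also have "\<dots> = (\<integral>x. (1/2) * (h x * f x) + (1/2) * (h x * kernel_op P f x) \<partial>\<nu>)"
      by (intro Bochner_Integration.integral_cong refl) (simp add: h_def algebra_simps)
    also have "\<dots> = (\<integral>x. h x * f x \<partial>\<nu>) / 2 + (\<integral>x. h x * kernel_op P f x \<partial>\<nu>) / 2"
      using i by simp
    finally show ?thesis by (simp add: lazy_form_def kernel_op_pairing[OF f(1) h])
  qed
  \<comment> \<open>The function \<open>s f - S f\<close> at which the positivity of the form is used.\<close>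
  define g where "g x = s * f x - h x" for x
  have sf: "(\<lambda>x. s * f x) \<in> L2_space \<nu>" using L2_space_cmult[OF f(1), of s] by simp
  have g: "g \<in> L2_space \<nu>" unfolding g_def by (intro L2_space_diff sf h)
  have expand: "lazy_form g g = s\<^sup>2 * lazy_form f f - 2 * s * lazy_form h f + lazy_form h h"
  proof -
    have i: "integrable \<nu> (\<lambda>x. f x * f x)" "integrable \<nu> (\<lambda>x. h x * f x)" "integrable \<nu> (\<lambda>x. h x * h x)"
      using L2_inner_integrable[OF f(1) f(1)] L2_inner_integrable[OF h f(1)] L2_inner_integrable[OF h h] by auto
    note j = J_product_integrable[OF f(1) f(1)] J_product_integrable[OF h f(1)] J_product_integrable[OF f(1) h] J_product_integrable[OF h h]
    have 1: "(\<integral>x. g x * g x \<partial>\<nu>) = s\<^sup>2 * (\<integral>x. f x * f x \<partial>\<nu>) - 2 * s * (\<integral>x. h x * f x \<partial>\<nu>) + (\<integral>x. h x * h x \<partial>\<nu>)"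
    proof -
      have "(\<integral>x. g x * g x \<partial>\<nu>) = (\<integral>x. s\<^sup>2 * (f x * f x) - 2 * s * (h x * f x) + h x * h x \<partial>\<nu>)"
        by (intro Bochner_Integration.integral_cong refl) (simp add: g_def algebra_simps power2_eq_square)
      then show ?thesis using i by simp
    qed
    have 2: "(\<integral>z. g (fst z) * g (snd z) \<partial>J) = s\<^sup>2 * (\<integral>z. f (fst z) * f (snd z) \<partial>J) - 2 * s * (\<integral>z. h (fst z) * f (snd z) \<partial>J) + (\<integral>z. h (fst z) * h (snd z) \<partial>J)"
    proof -
      have "(\<integral>z. g (fst z) * g (snd z) \<partial>J) = (\<integral>z. s\<^sup>2 * (f (fst z) * f (snd z)) - s * (h (fst z) * f (snd z)) - s * (f (fst z) * h (snd z)) + h (fst z) * h (snd z) \<partial>J)"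
        by (intro Bochner_Integration.integral_cong refl) (simp add: g_def algebra_simps power2_eq_square)
      also have "\<dots> = s\<^sup>2 * (\<integral>z. f (fst z) * f (snd z) \<partial>J) - s * (\<integral>z. h (fst z) * f (snd z) \<partial>J) - s * (\<integral>z. f (fst z) * h (snd z) \<partial>J) + (\<integral>z. h (fst z) * h (snd z) \<partial>J)"
        using j by simp
      finally show ?thesis using J_product_commute[OF f(1) h] by simp
    qed
    show ?thesis unfolding lazy_form_def 1 2 by (simp add: field_simps)
  qed
  define F H where "F = (L2_norm \<nu> f)\<^sup>2" and "H = (L2_norm \<nu> h)\<^sup>2"
  have "0 \<le> s\<^sup>2 * lazy_form f f - 2 * s * H + lazy_form h h"
    using lo[OF g] expand ph by (simp add: H_def)
  also have "\<dots> \<le> s\<^sup>2 * (s * F) - 2 * s * H + s * H"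
    using up[OF f] up[OF h hz] s by (intro add_mono diff_mono mult_left_mono) (auto simp: F_def H_def)
  finally have "s * H \<le> s * (s\<^sup>2 * F)" by (simp add: algebra_simps power2_eq_square)
  then have "H \<le> (s * L2_norm \<nu> f)\<^sup>2" using s by (simp add: F_def power_mult_distrib)
  then have le: "L2_norm \<nu> h \<le> s * L2_norm \<nu> f"
    unfolding H_def by (rule power2_le_imp_le) (use s in simp)
  have "AE x in \<nu>. integrable (P x) f"
    using integral_J(1)[of "\<lambda>z. 1 * f (snd z)"] J_product_integrable[OF L2_space_const[OF finite_measure_axioms, of 1] f(1)] by simp
  then have "AE x in \<nu>. kernel_op (lazy_kernel \<nu> P) f x = h x"
    using AE_space
  proof eventually_elim
    case (elim x)
    then show ?case using kernel_op_lazy[OF _ L2_spaceD(1)[OF f(1)]] by (simp add: h_def add_divide_distrib)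
  qed
  moreover have "kernel_op (lazy_kernel \<nu> P) f \<in> borel_measurable \<nu>"
  proof -
    interpret lazy: markov_prob \<nu> "lazy_kernel \<nu> P"
      by standard (rule markov_kernel_lazy)
    show ?thesis by (rule lazy.kernel_op_measurable[OF L2_spaceD(1)[OF f(1)]])
  qed
  ultimately have "L2_norm \<nu> (kernel_op (lazy_kernel \<nu> P) f) = L2_norm \<nu> h"
    using L2_spaceD(1)[OF h] by (intro L2_norm_cong_AE)
  with le show ?thesis by (simp add: s_def)
qed

lemma lazy_spectral_gap:
  assumes gap: "\<And>f. f \<in> L2_space \<nu> \<Longrightarrow> (\<integral>x. f x \<partial>\<nu>) = 0 \<Longrightarrow>
      \<kappa> * (L2_norm \<nu> f)\<^sup>2 \<le> (\<integral>z. (f (fst z) - f (snd z))\<^sup>2 \<partial>J) / 2"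
    and \<kappa>: "\<kappa> \<le> 1" and A: "A \<in> sets \<nu>" "0 < prob A" "prob A < 1"
  shows "L2_beta \<nu> (lazy_kernel \<nu> P) \<le> 1 - \<kappa> / 2"
  unfolding L2_beta_def
proof (rule cSup_least)
  show "{L2_norm \<nu> (kernel_op (lazy_kernel \<nu> P) f) / L2_norm \<nu> f | f.
     f \<in> L2_space \<nu> \<and> L2_norm \<nu> f \<noteq> 0 \<and> (\<integral>x. f x \<partial>\<nu>) = 0} \<noteq> {}"
    using L2_centered_event[OF A] by blast
  fix r assume "r \<in> {L2_norm \<nu> (kernel_op (lazy_kernel \<nu> P) f) / L2_norm \<nu> f | f.
     f \<in> L2_space \<nu> \<and> L2_norm \<nu> f \<noteq> 0 \<and> (\<integral>x. f x \<partial>\<nu>) = 0}"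
  then obtain f where r: "r = L2_norm \<nu> (kernel_op (lazy_kernel \<nu> P) f) / L2_norm \<nu> f"
    and f: "f \<in> L2_space \<nu>" "L2_norm \<nu> f \<noteq> 0" "(\<integral>x. f x \<partial>\<nu>) = 0" by auto
  then have "L2_norm \<nu> f > 0" by (simp add: less_le)
  then show "r \<le> 1 - \<kappa> / 2" unfolding r using lazy_contraction[OF gap \<kappa> f(1,3)] by (simp add: field_simps)
qed

end

section \<open>Metropolis-Hastings kernels\<close>

locale metropolis_hastings = Q: reversible_prob \<nu> Q for \<nu> :: "'a measure" and Q +
  fixes L :: "'a \<Rightarrow> real" and m M :: real
  assumes L_measurable [measurable]: "L \<in> borel_measurable \<nu>"
    and m_pos: "m > 0" and L_bounds: "\<And>u. u \<in> space \<nu> \<Longrightarrow> m \<le> L u \<and> L u \<le> M"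
begin

abbreviation "\<mu> \<equiv> posterior \<nu> L"
abbreviation "P \<equiv> MH_kernel \<mu> L Q"

definition Z :: real where "Z = (\<integral>w. L w \<partial>\<nu>)"

lemma L_pos: "u \<in> space \<nu> \<Longrightarrow> 0 < L u"
  using L_bounds m_pos by fastforce

lemma L_integrable: "integrable \<nu> L"
  by (rule Q.integrable_const_bound[where B=M]) (use L_bounds L_pos in \<open>auto simp: abs_of_pos\<close>)

lemma Z_bounds: "m \<le> Z" "Z \<le> M" "0 < Z" "0 < M"
proof -
  have "(\<integral>w. m \<partial>\<nu>) \<le> Z" unfolding Z_def using L_bounds by (intro integral_mono L_integrable) auto
  then show 1: "m \<le> Z" by (simp add: Q.prob_space)
  have "Z \<le> (\<integral>w. M \<partial>\<nu>)" unfolding Z_def using L_bounds by (intro integral_mono L_integrable) auto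
  then show 2: "Z \<le> M" by (simp add: Q.prob_space)
  show "0 < Z" "0 < M" using 1 2 m_pos by auto
qed

lemma posterior_density: "\<mu> = density \<nu> (\<lambda>u. ennreal (L u / Z))"
  by (simp add: posterior_def Z_def)

lemma sets_posterior [measurable_cong, simp]: "sets \<mu> = sets \<nu>"
  and space_posterior [simp]: "space \<mu> = space \<nu>"
  by (auto simp: posterior_density)

lemma nn_integral_posterior:
  "f \<in> borel_measurable \<nu> \<Longrightarrow> (\<integral>\<^sup>+u. f u \<partial>\<mu>) = (\<integral>\<^sup>+u. ennreal (L u / Z) * f u \<partial>\<nu>)"
  unfolding posterior_density by (rule nn_integral_density) auto

lemma integral_posterior:
  fixes f :: "'a \<Rightarrow> real"
  assumes "f \<in> borel_measurable \<nu>"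
  shows "(\<integral>u. f u \<partial>\<mu>) = (\<integral>u. L u / Z * f u \<partial>\<nu>)" "integrable \<mu> f \<longleftrightarrow> integrable \<nu> (\<lambda>u. L u / Z * f u)"
proof -
  have nn: "AE u in \<nu>. 0 \<le> L u / Z" using L_pos Z_bounds(3) by (intro AE_I2) (auto intro: less_imp_le)
  show "(\<integral>u. f u \<partial>\<mu>) = (\<integral>u. L u / Z * f u \<partial>\<nu>)" "integrable \<mu> f \<longleftrightarrow> integrable \<nu> (\<lambda>u. L u / Z * f u)"
    unfolding posterior_density using integral_density[OF assms _ nn] integrable_density[OF assms _ nn] by auto
qed

lemma prob_posterior: "prob_space \<mu>"
proof
  have "emeasure \<mu> (space \<mu>) = (\<integral>\<^sup>+u. ennreal (L u / Z) \<partial>\<nu>)"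
    by (simp add: posterior_density emeasure_density cong: nn_integral_cong)
  also have "\<dots> = ennreal (\<integral>u. L u / Z \<partial>\<nu>)"
  proof (rule nn_integral_eq_integral)
    show "AE u in \<nu>. 0 \<le> L u / Z" using L_pos Z_bounds(3) by (intro AE_I2) (auto intro: less_imp_le)
  qed (use L_integrable in simp)
  also have "(\<integral>u. L u / Z \<partial>\<nu>) = 1" using Z_bounds(3) by (simp add: Z_def[symmetric])
  finally show "emeasure \<mu> (space \<mu>) = 1" by simp
qed

definition acc :: "'a \<Rightarrow> 'a \<Rightarrow> ennreal" where "acc u v = ennreal (MH_accept L u v)"

lemma acc_le_1: "acc u v \<le> 1"
  by (simp add: acc_def MH_accept_def)

lemma acc_measurable [measurable]: "(\<lambda>z. acc (fst z) (snd z)) \<in> borel_measurable (\<nu> \<Otimes>\<^sub>M \<nu>)"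
  unfolding acc_def MH_accept_def by measurable

lemma acc_measurable2: "u \<in> space \<nu> \<Longrightarrow> acc u \<in> borel_measurable \<nu>"
  unfolding acc_def[abs_def] MH_accept_def by measurable

text \<open>Detailed balance: the acceptance probability turns the weight \<open>L u\<close> into the symmetric weight
  \<open>min (L u) (L v)\<close>.\<close>

lemma weight_acc:
  assumes "u \<in> space \<nu>" "v \<in> space \<nu>"
  shows "ennreal (L u / Z) * acc u v = ennreal (min (L u) (L v) / Z)"
proof -
  have "L u / Z * min 1 (L v / L u) = min (L u) (L v) / Z"
    using L_pos[OF assms(1)] Z_bounds(3) by (simp add: min_def field_simps)
  moreover have "0 \<le> L u / Z" using L_pos[OF assms(1)] Z_bounds(3) by simp
  ultimately show ?thesis
    unfolding acc_def MH_accept_def by (subst ennreal_mult'[symmetric]) auto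
qed

definition accepted :: "'a \<Rightarrow> ennreal" where "accepted u = (\<integral>\<^sup>+v. acc u v \<partial>Q u)"

lemma accepted_le_1: "u \<in> space \<nu> \<Longrightarrow> accepted u \<le> 1"
  using nn_integral_mono[of "Q u" "acc u" "\<lambda>_. 1"] acc_le_1 prob_space.emeasure_space_1[OF Q.prob_P]
  by (simp add: accepted_def)

lemma accepted_measurable [measurable]: "accepted \<in> borel_measurable \<nu>"
  using Q.nn_integral_P_measurable[OF acc_measurable] by (simp add: accepted_def[abs_def])

definition "move u = density (Q u) (acc u)"
definition "stay u = density (return \<nu> u) (\<lambda>_. 1 - accepted u)"

lemma sets_move_stay: "u \<in> space \<nu> \<Longrightarrow> sets (move u) = sets \<nu>" "sets (stay u) = sets \<nu>"
  using Q.sets_P by (auto simp: move_def stay_def)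

lemma MH_kernel_sum:
  assumes u: "u \<in> space \<nu>"
  shows "sets (P u) = sets \<nu>"
    "A \<in> sets \<nu> \<Longrightarrow> emeasure (P u) A = emeasure (move u) A + emeasure (stay u) A"
proof -
  have am: "acc u \<in> borel_measurable (Q u)"
    unfolding Q.measurable_P[OF u] by (rule acc_measurable2[OF u])
  have F: "(\<integral>\<^sup>+v. ennreal (MH_accept L u v) * indicator A v \<partial>Q u)
      + indicator A u * (1 - (\<integral>\<^sup>+w. ennreal (MH_accept L u w) \<partial>Q u)) = emeasure (move u) A + emeasure (stay u) A"
    if A: "A \<in> sets \<nu>" for A
  proof -
    have "emeasure (move u) A = (\<integral>\<^sup>+v. acc u v * indicator A v \<partial>Q u)"
      unfolding move_def by (rule emeasure_density[OF am]) (use A Q.sets_P[OF u] in simp)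
    then show ?thesis
      using sum_measure_const(2)[OF u A] by (simp add: stay_def acc_def accepted_def)
  qed
  show "sets (P u) = sets \<nu>"
    "A \<in> sets \<nu> \<Longrightarrow> emeasure (P u) A = emeasure (move u) A + emeasure (stay u) A"
    unfolding MH_kernel_def sets_posterior space_posterior
    using measure_of_sum[OF sets_move_stay(1)[OF u] sets_move_stay(2) F] by auto
qed

lemma nn_integral_P:
  assumes u: "u \<in> space \<nu>" and f: "f \<in> borel_measurable \<nu>"
  shows "(\<integral>\<^sup>+v. f v \<partial>P u) = (\<integral>\<^sup>+v. acc u v * f v \<partial>Q u) + f u * (1 - accepted u)"
proof -
  have am: "acc u \<in> borel_measurable (Q u)" and fm: "f \<in> borel_measurable (Q u)"
    unfolding Q.measurable_P[OF u] using acc_measurable2[OF u] f by auto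
  have "(\<integral>\<^sup>+v. f v \<partial>P u) = (\<integral>\<^sup>+v. f v \<partial>move u) + (\<integral>\<^sup>+v. f v \<partial>stay u)"
  proof (rule nn_integral_sum_measure)
    show "emeasure (P u) A = emeasure (move u) A + emeasure (stay u) A" if "A \<in> sets (P u)" for A
      using MH_kernel_sum(2)[OF u] that unfolding MH_kernel_sum(1)[OF u] by simp
    show "f \<in> borel_measurable (P u)"
      using f measurable_cong_sets[OF MH_kernel_sum(1)[OF u] refl] by blast
  qed (use MH_kernel_sum(1)[OF u] sets_move_stay(1)[OF u] sets_move_stay(2) in auto)
  also have "(\<integral>\<^sup>+v. f v \<partial>move u) = (\<integral>\<^sup>+v. acc u v * f v \<partial>Q u)"
    unfolding move_def by (rule nn_integral_density[OF am fm])
  also have "(\<integral>\<^sup>+v. f v \<partial>stay u) = f u * (1 - accepted u)"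
    unfolding stay_def by (rule sum_measure_const(3)[OF u f])
  finally show ?thesis .
qed

lemma markov_kernel_MH: "markov_kernel \<mu> P"
  unfolding markov_kernel_def
proof (rule measurable_prob_algebraI)
  show pr: "prob_space (P u)" if "u \<in> space \<mu>" for u
  proof
    have u: "u \<in> space \<nu>" using that by simp
    have "emeasure (P u) (space (P u)) = (\<integral>\<^sup>+v. 1 \<partial>P u)" by simp
    also have "\<dots> = accepted u + (1 - accepted u)"
      using nn_integral_P[OF u, of "\<lambda>_. 1"] by (simp add: accepted_def)
    also have "\<dots> = 1" using accepted_le_1[OF u] by (simp add: add_diff_inverse_ennreal)
    finally show "emeasure (P u) (space (P u)) = 1" .
  qed
  show "P \<in> \<mu> \<rightarrow>\<^sub>M subprob_algebra \<mu>"
  proof (rule measurable_subprob_algebra)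
    show "subprob_space (P u)" if "u \<in> space \<mu>" for u
      using pr[OF that] by (rule prob_space_imp_subprob_space)
    show "sets (P u) = sets \<mu>" if "u \<in> space \<mu>" for u
      using MH_kernel_sum(1)[of u] that by simp
    fix A assume "A \<in> sets \<mu>"
    then have A[measurable]: "A \<in> sets \<nu>" by simp
    have "(\<lambda>u. (\<integral>\<^sup>+v. acc u v * indicator A v \<partial>Q u) + indicator A u * (1 - accepted u)) \<in> borel_measurable \<nu>"
    proof -
      have "(\<lambda>z. acc (fst z) (snd z) * indicator A (snd z)) \<in> borel_measurable (\<nu> \<Otimes>\<^sub>M \<nu>)" by measurable
      from Q.nn_integral_P_measurable[OF this]
      have [measurable]: "(\<lambda>u. \<integral>\<^sup>+v. acc u v * indicator A v \<partial>Q u) \<in> borel_measurable \<nu>" by simp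
      show ?thesis by measurable
    qed
    then have "(\<lambda>u. emeasure (P u) A) \<in> borel_measurable \<nu>"
    proof (rule measurable_cong[THEN iffD1, rotated])
      fix u assume u: "u \<in> space \<nu>"
      have "emeasure (P u) A = (\<integral>\<^sup>+v. indicator A v \<partial>P u)" using A MH_kernel_sum(1)[OF u] by simp
      then show "(\<integral>\<^sup>+v. acc u v * indicator A v \<partial>Q u) + indicator A u * (1 - accepted u) = emeasure (P u) A"
        using nn_integral_P[OF u, of "indicator A"] A by simp
    qed
    then show "(\<lambda>u. emeasure (P u) A) \<in> borel_measurable \<mu>" by (simp cong: measurable_cong_sets)
  qed
qed

sublocale MH: markov_prob \<mu> P
  using prob_posterior markov_kernel_MH by (simp add: markov_prob_def markov_prob_axioms_def)

text \<open>A stationary pair of the Metropolis-Hastings kernel either moves, with a symmetric density relative to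
  the pairs of the proposal, or stays on the diagonal. Reversibility and the comparison of Dirichlet forms are
  both read off from this identity.\<close>

lemma nn_integral_MH_joint:
  assumes F[measurable]: "F \<in> borel_measurable (\<nu> \<Otimes>\<^sub>M \<nu>)"
  shows "(\<integral>\<^sup>+z. F z \<partial>MH.J) = (\<integral>\<^sup>+z. ennreal (min (L (fst z)) (L (snd z)) / Z) * F z \<partial>Q.J)
      + (\<integral>\<^sup>+u. F (u, u) * (1 - accepted u) \<partial>\<mu>)"
proof -
  have Fu: "(\<lambda>v. F (u, v)) \<in> borel_measurable \<nu>" if "u \<in> space \<nu>" for u
    using that by measurable
  have "(\<integral>\<^sup>+z. F z \<partial>MH.J) = (\<integral>\<^sup>+u. \<integral>\<^sup>+v. F (u, v) \<partial>P u \<partial>\<mu>)"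
    by (rule MH.nn_integral_J) (simp cong: measurable_cong_sets)
  also have "\<dots> = (\<integral>\<^sup>+u. (\<integral>\<^sup>+v. acc u v * F (u, v) \<partial>Q u) + F (u, u) * (1 - accepted u) \<partial>\<mu>)"
    by (intro nn_integral_cong nn_integral_P Fu) auto
  also have "\<dots> = (\<integral>\<^sup>+u. (\<integral>\<^sup>+v. acc u v * F (u, v) \<partial>Q u) \<partial>\<mu>) + (\<integral>\<^sup>+u. F (u, u) * (1 - accepted u) \<partial>\<mu>)"
  proof (rule nn_integral_add)
    show "(\<lambda>u. \<integral>\<^sup>+v. acc u v * F (u, v) \<partial>Q u) \<in> borel_measurable \<mu>"
      using Q.nn_integral_P_measurable[of "\<lambda>z. acc (fst z) (snd z) * F z"] by (simp cong: measurable_cong_sets)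
    show "(\<lambda>u. F (u, u) * (1 - accepted u)) \<in> borel_measurable \<mu>" by measurable
  qed
  also have "(\<integral>\<^sup>+u. (\<integral>\<^sup>+v. acc u v * F (u, v) \<partial>Q u) \<partial>\<mu>)
      = (\<integral>\<^sup>+u. ennreal (L u / Z) * (\<integral>\<^sup>+v. acc u v * F (u, v) \<partial>Q u) \<partial>\<nu>)"
    using Q.nn_integral_P_measurable[of "\<lambda>z. acc (fst z) (snd z) * F z"] by (intro nn_integral_posterior) simp
  also have "\<dots> = (\<integral>\<^sup>+u. \<integral>\<^sup>+v. ennreal (min (L u) (L v) / Z) * F (u, v) \<partial>Q u \<partial>\<nu>)"
  proof (rule nn_integral_cong)
    fix u assume u: "u \<in> space \<nu>"
    have m: "(\<lambda>v. acc u v * F (u, v)) \<in> borel_measurable (Q u)"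
      unfolding Q.measurable_P[OF u] using acc_measurable2[OF u] Fu[OF u] by measurable
    have "ennreal (L u / Z) * (\<integral>\<^sup>+v. acc u v * F (u, v) \<partial>Q u) = (\<integral>\<^sup>+v. ennreal (L u / Z) * (acc u v * F (u, v)) \<partial>Q u)"
      by (rule nn_integral_cmult[symmetric, OF m])
    also have "\<dots> = (\<integral>\<^sup>+v. ennreal (min (L u) (L v) / Z) * F (u, v) \<partial>Q u)"
      using weight_acc[OF u] sets_eq_imp_space_eq[OF Q.sets_P[OF u]]
      by (intro nn_integral_cong) (simp add: mult.assoc[symmetric])
    finally show "ennreal (L u / Z) * (\<integral>\<^sup>+v. acc u v * F (u, v) \<partial>Q u) = (\<integral>\<^sup>+v. ennreal (min (L u) (L v) / Z) * F (u, v) \<partial>Q u)" .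
  qed
  also have "\<dots> = (\<integral>\<^sup>+z. ennreal (min (L (fst z)) (L (snd z)) / Z) * F z \<partial>Q.J)"
    by (subst Q.nn_integral_J) auto
  finally show ?thesis .
qed

lemma reversible_MH: "reversible \<mu> P"
  unfolding reversible_def
proof (rule measure_eqI)
  have sw: "(\<lambda>(x, y). (y, x)) \<in> MH.J \<rightarrow>\<^sub>M \<mu> \<Otimes>\<^sub>M \<mu>"
    using measurable_cong_sets[OF MH.sets_J refl] measurable_pair_swap' by blast
  fix A assume "A \<in> sets MH.J"
  then have A: "A \<in> sets (\<mu> \<Otimes>\<^sub>M \<mu>)" by simp
  then have A'[measurable]: "A \<in> sets (\<nu> \<Otimes>\<^sub>M \<nu>)"
    using sets_pair_measure_cong[OF sets_posterior sets_posterior] by simp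
  have "emeasure (distr MH.J (\<mu> \<Otimes>\<^sub>M \<mu>) (\<lambda>(x, y). (y, x))) A = (\<integral>\<^sup>+z. indicator A z \<partial>distr MH.J (\<mu> \<Otimes>\<^sub>M \<mu>) (\<lambda>(x, y). (y, x)))"
    using A by simp
  also have "\<dots> = (\<integral>\<^sup>+z. indicator A (case z of (x, y) \<Rightarrow> (y, x)) \<partial>MH.J)"
    by (rule nn_integral_distr[OF sw]) (use A in auto)
  also have "\<dots> = (\<integral>\<^sup>+z. indicator A (snd z, fst z) \<partial>MH.J)" by (simp add: case_prod_unfold)
  also have "\<dots> = (\<integral>\<^sup>+z. ennreal (min (L (fst z)) (L (snd z)) / Z) * indicator A (snd z, fst z) \<partial>Q.J)
      + (\<integral>\<^sup>+u. indicator A (snd (u, u), fst (u, u)) * (1 - accepted u) \<partial>\<mu>)"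
    by (rule nn_integral_MH_joint) measurable
  also have "(\<integral>\<^sup>+z. ennreal (min (L (fst z)) (L (snd z)) / Z) * indicator A (snd z, fst z) \<partial>Q.J)
      = (\<integral>\<^sup>+z. ennreal (min (L (fst z)) (L (snd z)) / Z) * indicator A z \<partial>Q.J)"
    using Q.nn_integral_J_swap[of "\<lambda>z. ennreal (min (L (fst z)) (L (snd z)) / Z) * indicator A z"]
    by (simp add: min.commute)
  also have "\<dots> + (\<integral>\<^sup>+u. indicator A (snd (u, u), fst (u, u)) * (1 - accepted u) \<partial>\<mu>) = (\<integral>\<^sup>+z. indicator A z \<partial>MH.J)"
    by (subst nn_integral_MH_joint) auto
  also have "\<dots> = emeasure MH.J A" using A by simp
  finally show "emeasure MH.J A = emeasure (distr MH.J (\<mu> \<Otimes>\<^sub>M \<mu>) (\<lambda>(x, y). (y, x))) A" ..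
qed simp

sublocale MH: reversible_prob \<mu> P
  by standard (rule reversible_MH)

lemma L2_posterior_prior:
  assumes f: "f \<in> L2_space \<mu>"
  shows "(f :: 'a \<Rightarrow> real) \<in> L2_space \<nu>"
proof (rule L2_dominated)
  show fm: "f \<in> borel_measurable \<nu>" using L2_spaceD(1)[OF f] by (simp cong: measurable_cong_sets)
  have "integrable \<nu> (\<lambda>u. L u / Z * (norm (f u))\<^sup>2)"
    using integral_posterior(2)[of "\<lambda>u. (norm (f u))\<^sup>2"] L2_spaceD(2)[OF f] fm by simp
  then show "integrable \<nu> (\<lambda>u. Z / m * (L u / Z * (norm (f u))\<^sup>2))" by (rule integrable_mult_right)
  show "AE u in \<nu>. (norm (f u))\<^sup>2 \<le> Z / m * (L u / Z * (norm (f u))\<^sup>2)"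
  proof (rule AE_I2)
    fix u assume u: "u \<in> space \<nu>"
    have "1 \<le> L u / m" using L_bounds[OF u] m_pos by simp
    then have "1 * (norm (f u))\<^sup>2 \<le> L u / m * (norm (f u))\<^sup>2" by (intro mult_right_mono) auto
    then show "(norm (f u))\<^sup>2 \<le> Z / m * (L u / Z * (norm (f u))\<^sup>2)" using Z_bounds(3) by simp
  qed
qed

text \<open>On the diagonal the increments vanish, so the Dirichlet form only sees the moves.\<close>

lemma Dirichlet_comparison:
  assumes gap: "\<And>f. f \<in> L2_space \<nu> \<Longrightarrow> \<delta> * var_of \<nu> f \<le> (\<integral>z. (f (fst z) - f (snd z))\<^sup>2 \<partial>Q.J) / 2"
    and \<delta>: "\<delta> \<ge> 0" and f: "f \<in> L2_space \<mu>" "(\<integral>u. f u \<partial>\<mu>) = 0"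
  shows "m / M * \<delta> * (L2_norm \<mu> f)\<^sup>2 \<le> (\<integral>z. (f (fst z) - f (snd z))\<^sup>2 \<partial>MH.J) / 2"
proof -
  have f\<nu>: "f \<in> L2_space \<nu>" by (rule L2_posterior_prior[OF f(1)])
  have fm[measurable]: "f \<in> borel_measurable \<nu>" using f\<nu> by (rule L2_spaceD)
  define c where "c = (\<integral>u. f u \<partial>\<nu>)"
  note fi = L2_space_integrable[OF MH.finite_measure_axioms f(1)] L2_spaceD(2)[OF f(1)]
  have fc\<nu>: "(\<lambda>u. f u - c) \<in> L2_space \<nu>"
    by (intro L2_space_diff f\<nu> L2_space_const Q.finite_measure_axioms)
  have fc\<mu>: "(\<lambda>u. f u - c) \<in> L2_space \<mu>"
    by (intro L2_space_diff f L2_space_const MH.finite_measure_axioms)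
  have "(L2_norm \<mu> (\<lambda>u. f u - c))\<^sup>2 = (\<integral>u. (f u)\<^sup>2 - 2 * c * f u + c\<^sup>2 \<partial>\<mu>)"
    unfolding L2_norm_power2 by (intro Bochner_Integration.integral_cong) (auto simp: power2_diff)
  also have "\<dots> = (L2_norm \<mu> f)\<^sup>2 + c\<^sup>2"
    unfolding L2_norm_power2 using fi f(2) MH.prob_space[unfolded space_posterior] by simp
  finally have "(L2_norm \<mu> f)\<^sup>2 \<le> (L2_norm \<mu> (\<lambda>u. f u - c))\<^sup>2" by simp
  also have "\<dots> = (\<integral>u. L u / Z * (norm (f u - c))\<^sup>2 \<partial>\<nu>)"
    unfolding L2_norm_power2 by (rule integral_posterior(1)) measurable
  also have "\<dots> \<le> (\<integral>u. M / Z * (norm (f u - c))\<^sup>2 \<partial>\<nu>)"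
  proof (rule integral_mono)
    show "integrable \<nu> (\<lambda>u. L u / Z * (norm (f u - c))\<^sup>2)"
      using integral_posterior(2)[of "\<lambda>u. (norm (f u - c))\<^sup>2"] L2_spaceD(2)[OF fc\<mu>] by simp
    show "integrable \<nu> (\<lambda>u. M / Z * (norm (f u - c))\<^sup>2)"
      using L2_spaceD(2)[OF fc\<nu>] by (rule integrable_mult_right)
    show "L u / Z * (norm (f u - c))\<^sup>2 \<le> M / Z * (norm (f u - c))\<^sup>2" if "u \<in> space \<nu>" for u
      using L_bounds[OF that] Z_bounds(3) by (intro mult_right_mono divide_right_mono) auto
  qed
  also have "\<dots> = M / Z * var_of \<nu> f"
    using var_of_eq[OF Q.prob_space_axioms f\<nu>] by (simp add: L2_norm_power2 c_def)
  finally have var: "(L2_norm \<mu> f)\<^sup>2 \<le> M / Z * var_of \<nu> f" .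
  define DQ DP where "DQ = (\<integral>z. (f (fst z) - f (snd z))\<^sup>2 \<partial>Q.J)" and "DP = (\<integral>z. (f (fst z) - f (snd z))\<^sup>2 \<partial>MH.J)"
  have "ennreal (m / Z * DQ) = ennreal (m / Z) * (\<integral>\<^sup>+z. ennreal ((f (fst z) - f (snd z))\<^sup>2) \<partial>Q.J)"
    unfolding DQ_def using Q.integral_square_J(1)[OF f\<nu>] m_pos Z_bounds(3)
    by (subst nn_integral_eq_integral) (auto simp: ennreal_mult'[symmetric])
  also have "\<dots> = (\<integral>\<^sup>+z. ennreal (m / Z) * ennreal ((f (fst z) - f (snd z))\<^sup>2) \<partial>Q.J)"
    by (rule nn_integral_cmult[symmetric]) measurable
  also have "\<dots> \<le> (\<integral>\<^sup>+z. ennreal (min (L (fst z)) (L (snd z)) / Z) * ennreal ((f (fst z) - f (snd z))\<^sup>2) \<partial>Q.J)"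
    using L_bounds Z_bounds(3) unfolding Q.space_J
    by (intro nn_integral_mono mult_right_mono ennreal_leI divide_right_mono) (auto simp: Q.space_J)
  also have "\<dots> \<le> (\<integral>\<^sup>+z. ennreal ((f (fst z) - f (snd z))\<^sup>2) \<partial>MH.J)"
    by (subst nn_integral_MH_joint) auto
  also have "\<dots> = ennreal DP"
    unfolding DP_def using MH.integral_square_J(1)[OF f(1)] by (intro nn_integral_eq_integral) auto
  finally have "m / Z * DQ \<le> DP"
    by (subst (asm) ennreal_le_iff) (auto simp: DP_def)
  have "m / M * \<delta> * (L2_norm \<mu> f)\<^sup>2 \<le> m / M * \<delta> * (M / Z * var_of \<nu> f)"
    using var m_pos Z_bounds(4) \<delta> by (intro mult_left_mono) auto
  also have "\<dots> = m / Z * (\<delta> * var_of \<nu> f)" using Z_bounds(4) by simp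
  also have "\<dots> \<le> m / Z * (DQ / 2)"
    unfolding DQ_def using gap[OF f\<nu>] m_pos Z_bounds(3) by (intro mult_left_mono) auto
  also have "\<dots> \<le> DP / 2" using \<open>m / Z * DQ \<le> DP\<close> by simp
  finally show ?thesis by (simp add: DP_def)
qed

lemma posterior_event:
  assumes A: "A \<in> sets \<nu>" "0 < measure \<nu> A" "measure \<nu> A < 1"
  shows "A \<in> sets \<mu>" "0 < measure \<mu> A" "measure \<mu> A < 1"
proof -
  have *: "0 < measure \<mu> B" if B: "B \<in> sets \<nu>" "0 < measure \<nu> B" for B
  proof -
    have i: "integrable \<nu> (\<lambda>u. indicator B u :: real)"
      by (rule integrable_real_indicator) (use B Q.emeasure_finite[of B] in \<open>auto simp: less_top[symmetric]\<close>)
    have "0 < m / Z * measure \<nu> B" using B m_pos Z_bounds(3) by simp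
    also have "\<dots> = (\<integral>u. m / Z * indicator B u \<partial>\<nu>)" using B by simp
    also have "\<dots> \<le> (\<integral>u. L u / Z * indicator B u \<partial>\<nu>)"
    proof (rule integral_mono)
      show "integrable \<nu> (\<lambda>u. L u / Z * indicator B u)"
        using integrable_mult_indicator[OF B(1), of "\<lambda>u. L u / Z"] L_integrable by (simp add: mult.commute)
      show "m / Z * indicator B u \<le> L u / Z * indicator B u" if "u \<in> space \<nu>" for u
        using L_bounds[OF that] Z_bounds(3) by (intro mult_right_mono divide_right_mono) auto
    qed (use i in auto)
    also have "\<dots> = (\<integral>u. indicator B u \<partial>\<mu>)"
      by (rule integral_posterior(1)[symmetric]) (use B in simp)
    also have "\<dots> = measure \<mu> B" using B by simp
    finally show ?thesis .
  qed
  show "A \<in> sets \<mu>" "0 < measure \<mu> A" using A *[OF A(1,2)] by auto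
  have "0 < measure \<nu> (space \<nu> - A)" using A(3) Q.prob_compl[OF A(1)] by simp
  with A(1) have "0 < measure \<mu> (space \<nu> - A)" by (intro *) auto
  then have "0 < measure \<mu> (space \<mu> - A)" by simp
  then show "measure \<mu> A < 1" using MH.prob_compl[of A] A(1) by simp
qed

lemma lazy_MH_gap:
  assumes gap: "\<And>f. f \<in> L2_space \<nu> \<Longrightarrow> \<delta> * var_of \<nu> f \<le> (\<integral>z. (f (fst z) - f (snd z))\<^sup>2 \<partial>Q.J) / 2"
    and \<delta>: "0 \<le> \<delta>" "\<delta> \<le> 1" and A: "A \<in> sets \<nu>" "0 < measure \<nu> A" "measure \<nu> A < 1"
  shows "markov_kernel \<mu> (lazy_kernel \<mu> P)" "L2_beta \<mu> (lazy_kernel \<mu> P) \<le> 1 - m / M * \<delta> / 2"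
proof -
  show "markov_kernel \<mu> (lazy_kernel \<mu> P)" by (rule MH.markov_kernel_lazy)
  have "m / M * \<delta> \<le> 1 * 1"
    using Z_bounds m_pos \<delta> by (intro mult_mono) auto
  then have le: "m / M * \<delta> \<le> 1" by simp
  have "m / M * \<delta> * (L2_norm \<mu> f)\<^sup>2 \<le> (\<integral>z. (f (fst z) - f (snd z))\<^sup>2 \<partial>MH.J) / 2"
    if "f \<in> L2_space \<mu>" "(\<integral>u. f u \<partial>\<mu>) = 0" for f
    by (rule Dirichlet_comparison[OF gap \<delta>(1) that])
  from MH.lazy_spectral_gap[OF this le posterior_event[OF A]]
  show "L2_beta \<mu> (lazy_kernel \<mu> P) \<le> 1 - m / M * \<delta> / 2" .
qed

end

section \<open>Product kernels\<close>

lemma product_prob_const: "prob_space N \<Longrightarrow> product_prob_space (\<lambda>_. N)"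
  by (intro product_prob_spaceI)

lemma emeasure_PiM_Collect_prob:
  assumes M: "\<And>i. i \<in> I \<Longrightarrow> prob_space (M i)" and K: "K \<subseteq> I" "finite K" and A: "\<And>i. i \<in> K \<Longrightarrow> A i \<in> sets (M i)"
  shows "emeasure (PiM I M) {x \<in> space (PiM I M). \<forall>i\<in>K. x i \<in> A i} = (\<Prod>i\<in>K. emeasure (M i) (A i))"
proof -
  have "{x \<in> space (PiM I M). \<forall>i\<in>K. x i \<in> A i} = prod_emb I M K (Pi\<^sub>E K A)"
    unfolding prod_emb_def using K by (auto simp: space_PiM Pi_iff)
  then show ?thesis using emeasure_PiM_emb[OF M K A] by simp
qed

text \<open>Applying a map in every coordinate commutes with taking product measures. This yields the marginals of the product
  joint law as well as its symmetry.\<close>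

lemma distr_PiM_map:
  assumes M: "prob_space M" and g[measurable]: "g \<in> M \<rightarrow>\<^sub>M N"
  shows "distr (PiM I (\<lambda>_. M)) (PiM I (\<lambda>_. N)) (\<lambda>w. \<lambda>i\<in>I. g (w i)) = PiM I (\<lambda>_. distr M N g)"
proof -
  interpret D: prob_space "distr M N g" by (rule prob_space.prob_space_distr[OF M g])
  interpret P: product_prob_space "\<lambda>_. distr M N g" I by (rule product_prob_const) unfold_locales
  have meas: "(\<lambda>w. \<lambda>i\<in>I. g (w i)) \<in> PiM I (\<lambda>_. M) \<rightarrow>\<^sub>M PiM I (\<lambda>_. N)" by measurable
  have sN: "sets (PiM I (\<lambda>_. distr M N g)) = sets (PiM I (\<lambda>_. N))" by (intro sets_PiM_cong) auto
  show ?thesis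
  proof (rule P.PiM_eq)
    show "sets (distr (PiM I (\<lambda>_. M)) (PiM I (\<lambda>_. N)) (\<lambda>w. \<lambda>i\<in>I. g (w i))) = sets (PiM I (\<lambda>_. distr M N g))"
      using sN by simp
    fix K F assume K: "finite K" "K \<subseteq> I" and F: "\<And>j. j \<in> K \<Longrightarrow> F j \<in> sets (distr M N g)"
    have emb: "prod_emb I (\<lambda>_. distr M N g) K (Pi\<^sub>E K F) \<in> sets (PiM I (\<lambda>_. N))"
      unfolding sN[symmetric] using K F by (intro sets_PiM_I) auto
    have "(\<lambda>w. \<lambda>i\<in>I. g (w i)) -` prod_emb I (\<lambda>_. distr M N g) K (Pi\<^sub>E K F) \<inter> space (PiM I (\<lambda>_. M))
        = {w \<in> space (PiM I (\<lambda>_. M)). \<forall>i\<in>K. w i \<in> g -` F i \<inter> space M}"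
      using K measurable_space[OF g] by (auto simp: prod_emb_def space_PiM PiE_iff extensional_def subset_iff)
    then have "emeasure (distr (PiM I (\<lambda>_. M)) (PiM I (\<lambda>_. N)) (\<lambda>w. \<lambda>i\<in>I. g (w i))) (prod_emb I (\<lambda>_. distr M N g) K (Pi\<^sub>E K F))
        = emeasure (PiM I (\<lambda>_. M)) {w \<in> space (PiM I (\<lambda>_. M)). \<forall>i\<in>K. w i \<in> g -` F i \<inter> space M}"
      using emeasure_distr[OF meas emb] by simp
    also have "\<dots> = (\<Prod>i\<in>K. emeasure M (g -` F i \<inter> space M))"
      using K F by (intro emeasure_PiM_Collect_prob M) auto
    also have "\<dots> = (\<Prod>i\<in>K. emeasure (distr M N g) (F i))"
      using F by (intro prod.cong refl) (simp add: emeasure_distr)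
    finally show "emeasure (distr (PiM I (\<lambda>_. M)) (PiM I (\<lambda>_. N)) (\<lambda>w. \<lambda>i\<in>I. g (w i))) (prod_emb I (\<lambda>_. distr M N g) K (Pi\<^sub>E K F))
        = (\<Prod>i\<in>K. emeasure (distr M N g) (F i))" .
  qed
qed

text \<open>The index set is arbitrary, so that finitely and infinitely many coordinates are treated at once.\<close>

locale product_kernel_setup = Q: reversible_prob \<nu> Q for \<nu> :: "'a measure" and Q +
  fixes I :: "'i set"
begin

abbreviation "N \<equiv> PiM I (\<lambda>_. \<nu>)"
abbreviation "PJ \<equiv> PiM I (\<lambda>_. Q.J)"
definition tensor :: "('i \<Rightarrow> 'a) \<Rightarrow> ('i \<Rightarrow> 'a) measure" where "tensor u = PiM I (\<lambda>j. Q (u j))"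
definition first_coords :: "('i \<Rightarrow> 'a \<times> 'a) \<Rightarrow> 'i \<Rightarrow> 'a" where "first_coords w = (\<lambda>i\<in>I. fst (w i))"
definition second_coords :: "('i \<Rightarrow> 'a \<times> 'a) \<Rightarrow> 'i \<Rightarrow> 'a" where "second_coords w = (\<lambda>i\<in>I. snd (w i))"
definition zip_coords :: "('i \<Rightarrow> 'a) \<times> ('i \<Rightarrow> 'a) \<Rightarrow> 'i \<Rightarrow> 'a \<times> 'a" where "zip_coords z = (\<lambda>i\<in>I. (fst z i, snd z i))"

lemma prob_N: "prob_space N"
  by (intro prob_space_PiM Q.prob_space_axioms)

lemma N_component: "u \<in> space N \<Longrightarrow> j \<in> I \<Longrightarrow> u j \<in> space \<nu>"
  by (auto simp: space_PiM)

lemma first_coords_measurable [measurable]: "first_coords \<in> PJ \<rightarrow>\<^sub>M N" and second_coords_measurable [measurable]: "second_coords \<in> PJ \<rightarrow>\<^sub>M N"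
  unfolding first_coords_def[abs_def] second_coords_def[abs_def] by measurable

lemma zip_coords_measurable: "zip_coords \<in> N \<Otimes>\<^sub>M N \<rightarrow>\<^sub>M PJ"
  unfolding zip_coords_def[abs_def]
proof (rule measurable_restrict)
  fix i assume i[measurable]: "i \<in> I"
  have "(\<lambda>z. (fst z i, snd z i)) \<in> N \<Otimes>\<^sub>M N \<rightarrow>\<^sub>M \<nu> \<Otimes>\<^sub>M \<nu>" by measurable
  then show "(\<lambda>z. (fst z i, snd z i)) \<in> N \<Otimes>\<^sub>M N \<rightarrow>\<^sub>M Q.J"
    using measurable_cong_sets[OF refl Q.sets_J] by blast
qed

lemma sets_tensor: "u \<in> space N \<Longrightarrow> sets (tensor u) = sets N"
  unfolding tensor_def by (intro sets_PiM_cong refl Q.sets_P N_component)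

lemma space_tensor: "u \<in> space N \<Longrightarrow> space (tensor u) = space N"
  by (rule sets_eq_imp_space_eq[OF sets_tensor])

lemma prob_tensor: "u \<in> space N \<Longrightarrow> prob_space (tensor u)"
  unfolding tensor_def by (intro prob_space_PiM Q.prob_P N_component)

lemma emeasure_tensor:
  assumes u: "u \<in> space N" and K: "K \<subseteq> I" "finite K" and A: "\<And>j. j \<in> K \<Longrightarrow> A j \<in> sets \<nu>"
  shows "emeasure (tensor u) {v \<in> space N. \<forall>j\<in>K. v j \<in> A j} = (\<Prod>j\<in>K. emeasure (Q (u j)) (A j))"
proof -
  have "emeasure (PiM I (\<lambda>j. Q (u j))) {v \<in> space (PiM I (\<lambda>j. Q (u j))). \<forall>j\<in>K. v j \<in> A j} = (\<Prod>j\<in>K. emeasure (Q (u j)) (A j))"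
    using A K(1) Q.sets_P[OF N_component[OF u]] by (intro emeasure_PiM_Collect_prob Q.prob_P N_component u K) auto
  then show ?thesis using space_tensor[OF u] by (simp add: tensor_def)
qed

lemma markov_tensor: "markov_kernel N tensor"
  unfolding markov_kernel_def
proof (rule measurable_prob_algebra_generated[OF sets_PiM Int_stable_prod_algebra prod_algebra_sets_into_space])
  fix A assume "A \<in> prod_algebra I (\<lambda>_. \<nu>)"
  then obtain K E where A: "A = prod_emb I (\<lambda>_. \<nu>) K (\<Pi>\<^sub>E j\<in>K. E j)" and K: "finite K" "K \<subseteq> I"
    and E: "\<And>i. i \<in> K \<Longrightarrow> E i \<in> sets \<nu>"
    by (auto elim!: prod_algebraE)
  have A': "A = {v \<in> space N. \<forall>j\<in>K. v j \<in> E j}"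
    unfolding A prod_emb_def using K by (auto simp: space_PiM Pi_iff)
  have "(\<lambda>u. \<Prod>j\<in>K. emeasure (Q (u j)) (E j)) \<in> borel_measurable N"
  proof (rule borel_measurable_prod_ennreal)
    fix j assume j: "j \<in> K"
    show "(\<lambda>u. emeasure (Q (u j)) (E j)) \<in> borel_measurable N"
    proof -
      have "(\<lambda>u. u j) \<in> N \<rightarrow>\<^sub>M \<nu>" by (rule measurable_component_singleton) (use K j in auto)
      from measurable_compose[OF this measurable_emeasure_kernel[OF Q.kernel_subprob E[OF j]]] show ?thesis .
    qed
  qed
  then show "(\<lambda>u. emeasure (tensor u) A) \<in> borel_measurable N"
    by (rule measurable_cong[THEN iffD2, rotated]) (simp add: A' emeasure_tensor K E)
qed (use prob_tensor sets_tensor in auto)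

sublocale T: markov_prob N tensor
  using prob_N markov_tensor by (simp add: markov_prob_def markov_prob_axioms_def)

text \<open>A stationary pair of the product kernel is a family of independent stationary pairs of the factors: this is checked on
  finite-dimensional cylinders, where the inner integral factorises over the coordinates.\<close>

lemma distr_zip_coords: "distr T.J PJ zip_coords = PJ"
proof -
  interpret PP: product_prob_space "\<lambda>_. Q.J" I by (rule product_prob_const[OF Q.prob_J])
  interpret PN: product_prob_space "\<lambda>_. \<nu>" I by (rule product_prob_const[OF Q.prob_space_axioms])
  have zm: "zip_coords \<in> T.J \<rightarrow>\<^sub>M PJ" using zip_coords_measurable measurable_cong_sets[OF T.sets_J refl] by blast
  show ?thesis
  proof (rule PP.PiM_eq)
    fix K F assume K: "finite K" "K \<subseteq> I" and F: "\<And>j. j \<in> K \<Longrightarrow> F j \<in> sets Q.J"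
    then have F\<nu>[measurable]: "\<And>j. j \<in> K \<Longrightarrow> F j \<in> sets (\<nu> \<Otimes>\<^sub>M \<nu>)" by simp
    define X where "X = zip_coords -` prod_emb I (\<lambda>_. Q.J) K (Pi\<^sub>E K F) \<inter> space T.J"
    have X: "X = {z \<in> space N \<times> space N. \<forall>j\<in>K. (fst z j, snd z j) \<in> F j}"
      unfolding X_def T.space_J using K
      by (auto simp: prod_emb_def zip_coords_def space_PiM PiE_iff extensional_def Q.space_J subset_iff)
    have emb: "prod_emb I (\<lambda>_. Q.J) K (Pi\<^sub>E K F) \<in> sets PJ" using K F by (intro sets_PiM_I) auto
    have Xs: "X \<in> sets T.J" unfolding X_def by (rule measurable_sets[OF zm emb])
    define q where "q j x = emeasure (Q x) (Pair x -` F j)" for j x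
    have q_eq: "(\<integral>\<^sup>+y. indicator (F j) (x, y) \<partial>Q x) = q j x" if "j \<in> K" and x: "x \<in> space \<nu>" for j x
    proof -
      have "Pair x -` F j \<in> sets (Q x)"
        unfolding Q.sets_P[OF x] by (rule sets_Pair1[OF F\<nu>[OF that(1)]])
      moreover have "(\<integral>\<^sup>+y. indicator (F j) (x, y) \<partial>Q x) = (\<integral>\<^sup>+y. indicator (Pair x -` F j) y \<partial>Q x)"
        by (intro nn_integral_cong) (auto simp: indicator_def)
      ultimately show ?thesis by (simp add: q_def)
    qed
    have qm: "q j \<in> borel_measurable \<nu>" if "j \<in> K" for j
    proof -
      have "(\<lambda>x. \<integral>\<^sup>+y. indicator (F j) (x, y) \<partial>Q x) \<in> borel_measurable \<nu>"
        using F\<nu>[OF that] by (intro Q.nn_integral_P_measurable) auto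
      then show ?thesis by (rule measurable_cong[THEN iffD1, rotated]) (rule q_eq[OF that])
    qed
    have qJ: "(\<integral>\<^sup>+x. q j x \<partial>\<nu>) = emeasure Q.J (F j)" if "j \<in> K" for j
    proof -
      have "emeasure Q.J (F j) = (\<integral>\<^sup>+x. \<integral>\<^sup>+y. indicator (F j) (x, y) \<partial>Q x \<partial>\<nu>)"
        using F[OF that] F\<nu>[OF that] by (subst Q.nn_integral_J[symmetric]) auto
      also have "\<dots> = (\<integral>\<^sup>+x. q j x \<partial>\<nu>)" by (rule nn_integral_cong[OF q_eq[OF that]])
      finally show ?thesis ..
    qed
    have "emeasure (distr T.J PJ zip_coords) (prod_emb I (\<lambda>_. Q.J) K (Pi\<^sub>E K F)) = emeasure T.J X"
      unfolding X_def by (rule emeasure_distr[OF zm emb])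
    also have "\<dots> = (\<integral>\<^sup>+u. \<integral>\<^sup>+v. indicator X (u, v) \<partial>tensor u \<partial>N)"
      using Xs T.sets_J by (subst T.nn_integral_J[symmetric]) auto
    also have "\<dots> = (\<integral>\<^sup>+u. (\<Prod>j\<in>K. q j (u j)) \<partial>N)"
    proof (rule nn_integral_cong)
      fix u assume u: "u \<in> space N"
      have s: "Pair (u j) -` F j \<in> sets \<nu>" if "j \<in> K" for j by (rule sets_Pair1[OF F\<nu>[OF that]])
      have "(\<integral>\<^sup>+v. indicator X (u, v) \<partial>tensor u) = (\<integral>\<^sup>+v. indicator {v \<in> space N. \<forall>j\<in>K. v j \<in> Pair (u j) -` F j} v \<partial>tensor u)"
        using u by (intro nn_integral_cong) (auto simp: X indicator_def)
      also have "\<dots> = emeasure (tensor u) {v \<in> space N. \<forall>j\<in>K. v j \<in> Pair (u j) -` F j}"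
      proof (rule nn_integral_indicator)
        have "{v \<in> space N. \<forall>j\<in>K. v j \<in> Pair (u j) -` F j} = prod_emb I (\<lambda>_. \<nu>) K (Pi\<^sub>E K (\<lambda>j. Pair (u j) -` F j))"
          unfolding prod_emb_def using K by (auto simp: space_PiM Pi_iff)
        then show "{v \<in> space N. \<forall>j\<in>K. v j \<in> Pair (u j) -` F j} \<in> sets (tensor u)"
          unfolding sets_tensor[OF u] using K s by (simp add: sets_PiM_I)
      qed
      also have "\<dots> = (\<Prod>j\<in>K. q j (u j))"
        unfolding q_def by (rule emeasure_tensor[OF u K(2,1) s])
      finally show "(\<integral>\<^sup>+v. indicator X (u, v) \<partial>tensor u) = (\<Prod>j\<in>K. q j (u j))" .
    qed
    also have "\<dots> = (\<integral>\<^sup>+u. (\<Prod>j\<in>K. q j (restrict u K j)) \<partial>N)" by simp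
    also have "\<dots> = (\<integral>\<^sup>+u. (\<Prod>j\<in>K. q j (u j)) \<partial>distr N (PiM K (\<lambda>_. \<nu>)) (\<lambda>u. restrict u K))"
    proof (rule nn_integral_distr[symmetric])
      show "(\<lambda>u. restrict u K) \<in> N \<rightarrow>\<^sub>M PiM K (\<lambda>_. \<nu>)" by (rule measurable_restrict_subset[OF K(2)])
      show "(\<lambda>u. \<Prod>j\<in>K. q j (u j)) \<in> borel_measurable (distr N (PiM K (\<lambda>_. \<nu>)) (\<lambda>u. restrict u K))"
        unfolding measurable_distr_eq1
      proof (rule borel_measurable_prod_ennreal)
        fix j assume j: "j \<in> K"
        have "(\<lambda>u. u j) \<in> PiM K (\<lambda>_. \<nu>) \<rightarrow>\<^sub>M \<nu>" by (rule measurable_component_singleton[OF j])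
        from measurable_compose[OF this qm[OF j]] show "(\<lambda>u. q j (u j)) \<in> borel_measurable (PiM K (\<lambda>_. \<nu>))" .
      qed
    qed
    also have "\<dots> = (\<integral>\<^sup>+u. (\<Prod>j\<in>K. q j (u j)) \<partial>PiM K (\<lambda>_. \<nu>))"
      by (simp only: PN.distr_PiM_restrict_finite[OF K])
    also have "\<dots> = (\<Prod>j\<in>K. \<integral>\<^sup>+x. q j x \<partial>\<nu>)"
      by (rule PN.product_nn_integral_prod[OF K(1) qm])
    also have "\<dots> = (\<Prod>j\<in>K. emeasure Q.J (F j))" by (intro prod.cong refl qJ)
    finally show "emeasure (distr T.J PJ zip_coords) (prod_emb I (\<lambda>_. Q.J) K (Pi\<^sub>E K F)) = (\<Prod>j\<in>K. emeasure Q.J (F j))" .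
  qed simp
qed

lemma joint_eq_distr: "T.J = distr PJ (N \<Otimes>\<^sub>M N) (\<lambda>w. (first_coords w, second_coords w))"
proof -
  have zm: "zip_coords \<in> T.J \<rightarrow>\<^sub>M PJ" using zip_coords_measurable measurable_cong_sets[OF T.sets_J refl] by blast
  have "distr PJ (N \<Otimes>\<^sub>M N) (\<lambda>w. (first_coords w, second_coords w)) = distr (distr T.J PJ zip_coords) (N \<Otimes>\<^sub>M N) (\<lambda>w. (first_coords w, second_coords w))"
    by (simp only: distr_zip_coords)
  also have "\<dots> = distr T.J (N \<Otimes>\<^sub>M N) ((\<lambda>w. (first_coords w, second_coords w)) \<circ> zip_coords)"
    by (rule distr_distr[OF _ zm]) measurable
  also have "\<dots> = distr T.J (N \<Otimes>\<^sub>M N) (\<lambda>z. z)"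
  proof (rule distr_cong)
    fix z assume "z \<in> space T.J"
    then have "fst z \<in> extensional I" "snd z \<in> extensional I"
      by (auto simp: T.space_J space_PiM PiE_iff)
    then show "((\<lambda>w. (first_coords w, second_coords w)) \<circ> zip_coords) z = z"
      by (auto simp: first_coords_def second_coords_def zip_coords_def prod_eq_iff extensional_def fun_eq_iff)
  qed auto
  also have "\<dots> = T.J" by (rule distr_id2) simp
  finally show ?thesis ..
qed

lemma reversible_tensor: "reversible N tensor"
proof -
  define sw where "sw w = (\<lambda>i\<in>I. (snd (w i), fst (w i)))" for w :: "'i \<Rightarrow> 'a \<times> 'a"
  have s1: "(\<lambda>z. (snd z, fst z)) \<in> Q.J \<rightarrow>\<^sub>M Q.J"
    using measurable_cong_sets[OF Q.sets_J Q.sets_J] by simp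
  have swm[measurable]: "sw \<in> PJ \<rightarrow>\<^sub>M PJ"
    unfolding sw_def[abs_def]
  proof (rule measurable_restrict)
    fix i assume "i \<in> I"
    then have "(\<lambda>w. w i) \<in> PJ \<rightarrow>\<^sub>M Q.J" by (rule measurable_component_singleton)
    from measurable_compose[OF this s1] show "(\<lambda>w. (snd (w i), fst (w i))) \<in> PJ \<rightarrow>\<^sub>M Q.J" .
  qed
  have "distr Q.J Q.J (\<lambda>z. (snd z, fst z)) = distr Q.J (\<nu> \<Otimes>\<^sub>M \<nu>) (\<lambda>z. (snd z, fst z))"
    by (rule distr_cong) auto
  also have "\<dots> = Q.J" using Q.rev by (simp add: reversible_def case_prod_unfold)
  finally have "distr PJ PJ sw = PJ"
    using distr_PiM_map[OF Q.prob_J s1, of I] by (simp add: sw_def[abs_def])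
  then have "T.J = distr (distr PJ PJ sw) (N \<Otimes>\<^sub>M N) (\<lambda>w. (first_coords w, second_coords w))"
    using joint_eq_distr by simp
  also have "\<dots> = distr PJ (N \<Otimes>\<^sub>M N) ((\<lambda>w. (first_coords w, second_coords w)) \<circ> sw)"
    by (rule distr_distr) measurable
  also have "(\<lambda>w. (first_coords w, second_coords w)) \<circ> sw = (\<lambda>(x, y). (y, x)) \<circ> (\<lambda>w. (first_coords w, second_coords w))"
    by (auto simp: fun_eq_iff first_coords_def second_coords_def sw_def)
  also have "distr PJ (N \<Otimes>\<^sub>M N) \<dots> = distr (distr PJ (N \<Otimes>\<^sub>M N) (\<lambda>w. (first_coords w, second_coords w))) (N \<Otimes>\<^sub>M N) (\<lambda>(x, y). (y, x))"
    by (rule distr_distr[symmetric]) measurable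
  also have "\<dots> = distr T.J (N \<Otimes>\<^sub>M N) (\<lambda>(x, y). (y, x))" by (simp only: joint_eq_distr[symmetric])
  finally show ?thesis unfolding reversible_def .
qed

sublocale T: reversible_prob N tensor
  by standard (rule reversible_tensor)

end

section \<open>Tensorisation of the spectral gap\<close>

definition bdd_meas :: "'a measure \<Rightarrow> ('a \<Rightarrow> real) \<Rightarrow> bool" where
  "bdd_meas M f \<longleftrightarrow> f \<in> borel_measurable M \<and> (\<exists>B. \<forall>x\<in>space M. \<bar>f x\<bar> \<le> B)"

lemma bdd_measD: "bdd_meas M f \<Longrightarrow> f \<in> borel_measurable M" by (simp add: bdd_meas_def)

lemma bdd_meas_L2: "finite_measure M \<Longrightarrow> bdd_meas M f \<Longrightarrow> f \<in> L2_space M"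
  unfolding bdd_meas_def using L2_space_bounded[of M f] by auto

lemma bdd_meas_integrable: "finite_measure M \<Longrightarrow> bdd_meas M f \<Longrightarrow> integrable M f"
  by (rule L2_space_integrable[OF _ bdd_meas_L2])

lemma bdd_meas_mult:
  assumes "bdd_meas M f" "bdd_meas M g" shows "bdd_meas M (\<lambda>x. f x * g x)"
proof -
  obtain A B where AB: "\<forall>x\<in>space M. \<bar>f x\<bar> \<le> A" "\<forall>x\<in>space M. \<bar>g x\<bar> \<le> B"
    using assms by (auto simp: bdd_meas_def)
  have "\<bar>f x * g x\<bar> \<le> \<bar>A\<bar> * \<bar>B\<bar>" if "x \<in> space M" for x
  proof -
    have "\<bar>f x\<bar> \<le> \<bar>A\<bar>" "\<bar>g x\<bar> \<le> \<bar>B\<bar>" using AB that by fastforce+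
    then show ?thesis unfolding abs_mult by (intro mult_mono) auto
  qed
  then show ?thesis using assms by (auto simp: bdd_meas_def)
qed

lemma bdd_meas_lincomb:
  assumes "bdd_meas M f" "bdd_meas M g" shows "bdd_meas M (\<lambda>x. f x + c * g x)"
proof -
  obtain A B where AB: "\<forall>x\<in>space M. \<bar>f x\<bar> \<le> A" "\<forall>x\<in>space M. \<bar>g x\<bar> \<le> B"
    using assms by (auto simp: bdd_meas_def)
  have "\<bar>f x + c * g x\<bar> \<le> A + \<bar>c\<bar> * B" if "x \<in> space M" for x
  proof -
    have "\<bar>f x + c * g x\<bar> \<le> \<bar>f x\<bar> + \<bar>c\<bar> * \<bar>g x\<bar>" by (metis abs_mult abs_triangle_ineq)
    also have "\<dots> \<le> A + \<bar>c\<bar> * B" using AB that by (intro add_mono mult_left_mono) auto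
    finally show ?thesis .
  qed
  then show ?thesis using assms by (auto simp: bdd_meas_def)
qed

lemma bdd_meas_compose:
  assumes g: "g \<in> M \<rightarrow>\<^sub>M N" and f: "bdd_meas N f" shows "bdd_meas M (\<lambda>x. f (g x))"
  using f measurable_compose[OF g, of f borel] measurable_space[OF g] by (fastforce simp: bdd_meas_def)

lemma bdd_meas_average:
  assumes M: "prob_space M" and F: "bdd_meas (N \<Otimes>\<^sub>M M) F"
  shows "bdd_meas N (\<lambda>u. \<integral>y. F (u, y) \<partial>M)"
proof -
  interpret M: prob_space M by fact
  obtain B where B: "\<forall>x\<in>space (N \<Otimes>\<^sub>M M). \<bar>F x\<bar> \<le> B" using F by (auto simp: bdd_meas_def)
  have [measurable]: "F \<in> borel_measurable (N \<Otimes>\<^sub>M M)" using F by (rule bdd_measD)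
  have "\<bar>\<integral>y. F (u, y) \<partial>M\<bar> \<le> B" if u: "u \<in> space N" for u
  proof -
    have Fu: "\<bar>F (u, y)\<bar> \<le> B" if "y \<in> space M" for y using B u that by (auto simp: space_pair_measure)
    then have i: "integrable M (\<lambda>y. F (u, y))"
      using u by (intro M.integrable_const_bound[where B=B]) auto
    have "\<bar>\<integral>y. F (u, y) \<partial>M\<bar> \<le> (\<integral>y. \<bar>F (u, y)\<bar> \<partial>M)" using integral_norm_bound[of M "\<lambda>y. F (u, y)"] by simp
    also have "\<dots> \<le> (\<integral>y. B \<partial>M)" using i Fu by (intro integral_mono) auto
    finally show ?thesis by (simp add: M.prob_space)
  qed
  moreover have "(\<lambda>u. \<integral>y. F (u, y) \<partial>M) \<in> borel_measurable N" by measurable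
  ultimately show ?thesis by (auto simp: bdd_meas_def)
qed

lemma var_of_alt: "var_of M f = (\<integral>x. f x * f x \<partial>M) - (\<integral>x. f x \<partial>M)\<^sup>2"
  by (simp add: var_of_def power2_eq_square)

context reversible_prob
begin

text \<open>Induction on the number of coordinates. For fixed values of the other coordinates, the one-dimensional bound applies
  to the sections; integrating the product of the sections' means is the induction
  hypothesis, and the variances add up by the law of total variance.\<close>

lemma tensor_correlation:
  assumes \<beta>: "0 \<le> L2_beta \<nu> P" and I: "finite I"
    and f: "bdd_meas (PiM I (\<lambda>_. \<nu>)) f" and h: "bdd_meas (PiM I (\<lambda>_. \<nu>)) h"
  shows "(\<integral>w. f (\<lambda>i\<in>I. fst (w i)) * h (\<lambda>i\<in>I. snd (w i)) \<partial>PiM I (\<lambda>_. J))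
    \<le> (\<integral>u. f u \<partial>PiM I (\<lambda>_. \<nu>)) * (\<integral>u. h u \<partial>PiM I (\<lambda>_. \<nu>))
      + L2_beta \<nu> P / 2 * (var_of (PiM I (\<lambda>_. \<nu>)) f + var_of (PiM I (\<lambda>_. \<nu>)) h)"
  using I f h
proof (induction I arbitrary: f h rule: finite_induct)
  case empty
  interpret PN: product_prob_space "\<lambda>_. \<nu>" "{} :: 'b set" by (rule product_prob_const[OF prob_space_axioms])
  interpret PJ: product_prob_space "\<lambda>_. J" "{} :: 'b set" by (rule product_prob_const[OF prob_J])
  have N: "(\<integral>u. k u \<partial>PiM {} (\<lambda>_. \<nu>)) = k (\<lambda>_. undefined)" for k :: "('b \<Rightarrow> 'a) \<Rightarrow> real"
    by (simp add: PiM_empty lebesgue_integral_count_space_finite)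
  have "(\<integral>w. k w \<partial>PiM {} (\<lambda>_. J)) = k (\<lambda>_. undefined)" for k :: "('b \<Rightarrow> 'a \<times> 'a) \<Rightarrow> real"
    by (simp add: PiM_empty lebesgue_integral_count_space_finite)
  then show ?case by (simp add: N var_of_def restrict_def PJ.P.prob_space)
next
  case (insert i I)
  interpret PN: product_prob_space "\<lambda>_. \<nu>" I by (rule product_prob_const[OF prob_space_axioms])
  interpret PJ: product_prob_space "\<lambda>_. J" I by (rule product_prob_const[OF prob_J])
  let ?N = "PiM I (\<lambda>_. \<nu>)" and ?N' = "PiM (insert i I) (\<lambda>_. \<nu>)"
  let ?W = "PiM I (\<lambda>_. J)" and ?W' = "PiM (insert i I) (\<lambda>_. J)"
  have pN: "prob_space ?N" and pN': "prob_space ?N'" and pW: "prob_space ?W" and pW': "prob_space ?W'"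
    by (intro prob_space_PiM prob_space_axioms prob_J)+
  note fin = pN[THEN prob_space.finite_measure] pN'[THEN prob_space.finite_measure]
    pW[THEN prob_space.finite_measure] pW'[THEN prob_space.finite_measure]
  define fs sn where "fs w = (\<lambda>i\<in>I. fst (w i))" and "sn w = (\<lambda>i\<in>I. snd (w i))" for w :: "'b \<Rightarrow> 'a \<times> 'a"
  define fs' sn' where "fs' w = (\<lambda>i\<in>insert i I. fst (w i))" and "sn' w = (\<lambda>i\<in>insert i I. snd (w i))" for w :: "'b \<Rightarrow> 'a \<times> 'a"
  have fsm: "fs \<in> ?W \<rightarrow>\<^sub>M ?N" "sn \<in> ?W \<rightarrow>\<^sub>M ?N" "fs' \<in> ?W' \<rightarrow>\<^sub>M ?N'" "sn' \<in> ?W' \<rightarrow>\<^sub>M ?N'"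
    unfolding fs_def[abs_def] sn_def[abs_def] fs'_def[abs_def] sn'_def[abs_def] by measurable
  have distr: "distr ?W ?N fs = ?N" "distr ?W ?N sn = ?N"
    using distr_PiM_map[OF prob_J measurable_fst_J, of I] distr_PiM_map[OF prob_J measurable_snd_J, of I]
    unfolding fs_def[abs_def] sn_def[abs_def] distr_J_fst distr_J_snd by auto
  have upd: "(\<lambda>z. (fst z)(i := snd z)) \<in> ?N \<Otimes>\<^sub>M \<nu> \<rightarrow>\<^sub>M ?N'" "(\<lambda>z. (fst z)(i := snd z)) \<in> ?W \<Otimes>\<^sub>M J \<rightarrow>\<^sub>M ?W'"
    using measurable_add_dim[of i I "\<lambda>_. \<nu>"] measurable_add_dim[of i I "\<lambda>_. J"] by (auto simp: case_prod_unfold)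
  have avg: "bdd_meas ?N (\<lambda>u. \<integral>y. k (u(i := y)) \<partial>\<nu>)" if "bdd_meas ?N' k" for k
    using bdd_meas_average[OF prob_space_axioms bdd_meas_compose[OF upd(1) that]] by simp
  have slice: "bdd_meas \<nu> (\<lambda>y. k (u(i := y)))" if "bdd_meas ?N' k" "u \<in> space ?N" for k u
    using bdd_meas_compose[OF measurable_Pair1'[OF that(2)] bdd_meas_compose[OF upd(1) that(1)]] by simp
  have fold: "(\<integral>u. k u \<partial>?N') = (\<integral>u. \<integral>y. k (u(i := y)) \<partial>\<nu> \<partial>?N)" if "bdd_meas ?N' k" for k
    using PN.product_integral_insert[OF insert.hyps bdd_meas_integrable[OF fin(2) that]] .
  define av vs where "av k u = (\<integral>y. k (u(i := y)) \<partial>\<nu>)" and "vs k u = var_of \<nu> (\<lambda>y. k (u(i := y)))"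
    for k :: "('b \<Rightarrow> 'a) \<Rightarrow> real" and u
  have av: "bdd_meas ?N (av k)" if "bdd_meas ?N' k" for k using avg[OF that] by (simp add: av_def[abs_def])
  have vs_eq: "vs k u = av (\<lambda>u. k u * k u) u - av k u * av k u" for k u
    by (simp add: vs_def av_def var_of_alt power2_eq_square)
  have vs: "bdd_meas ?N (vs k)" if k: "bdd_meas ?N' k" for k
    unfolding vs_eq[abs_def]
    using bdd_meas_lincomb[OF av[OF bdd_meas_mult[OF k k]] bdd_meas_mult[OF av[OF k] av[OF k]], of "-1"] by simp
  have total_var: "var_of ?N' k = (\<integral>u. vs k u \<partial>?N) + var_of ?N (av k)" if k: "bdd_meas ?N' k" for k
  proof -
    note i = bdd_meas_integrable[OF fin(1) av[OF bdd_meas_mult[OF k k]]]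
      bdd_meas_integrable[OF fin(1) bdd_meas_mult[OF av[OF k] av[OF k]]]
    have "var_of ?N' k = (\<integral>u. av (\<lambda>u. k u * k u) u \<partial>?N) - (\<integral>u. av k u \<partial>?N)\<^sup>2"
      unfolding var_of_alt fold[OF k] fold[OF bdd_meas_mult[OF k k]] by (simp add: av_def)
    also have "(\<integral>u. av (\<lambda>u. k u * k u) u \<partial>?N) = (\<integral>u. vs k u \<partial>?N) + (\<integral>u. av k u * av k u \<partial>?N)"
      unfolding vs_eq using i by simp
    finally show ?thesis by (simp add: var_of_alt)
  qed
  note f = insert.prems(1) and h = insert.prems(2)
  define G where "G w = f (fs' w) * h (sn' w)" for w
  have G: "bdd_meas ?W' G" unfolding G_def by (intro bdd_meas_mult bdd_meas_compose[OF fsm(3) f] bdd_meas_compose[OF fsm(4) h])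
  have upd_eq: "fs' (w(i := y)) = (fs w)(i := fst y)" "sn' (w(i := y)) = (sn w)(i := snd y)" for w y
    using insert.hyps by (auto simp: fs'_def sn'_def fs_def sn_def fun_eq_iff)
  have wN: "fs w \<in> space ?N" "sn w \<in> space ?N" if "w \<in> space ?W" for w
    using measurable_space[OF fsm(1) that] measurable_space[OF fsm(2) that] by auto
  let ?R = "\<lambda>w. av f (fs w) * av h (sn w) + L2_beta \<nu> P / 2 * (vs f (fs w) + vs h (sn w))"
  have inner: "(\<integral>y. G (w(i := y)) \<partial>J) \<le> ?R w" if w: "w \<in> space ?W" for w
  proof -
    have "(\<integral>y. G (w(i := y)) \<partial>J) = (\<integral>y. f ((fs w)(i := fst y)) * h ((sn w)(i := snd y)) \<partial>J)"
      by (simp add: G_def upd_eq)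
    also have "\<dots> \<le> ?R w"
      unfolding av_def vs_def
      by (rule correlation_bound[OF bdd_meas_L2[OF finite_measure_axioms slice[OF f wN(1)[OF w]]]
            bdd_meas_L2[OF finite_measure_axioms slice[OF h wN(2)[OF w]]] \<beta>])
    finally show ?thesis .
  qed
  have bR1: "bdd_meas ?W (\<lambda>w. av f (fs w) * av h (sn w))"
    by (intro bdd_meas_mult bdd_meas_compose[OF fsm(1) av[OF f]] bdd_meas_compose[OF fsm(2) av[OF h]])
  have bR2: "bdd_meas ?W (\<lambda>w. vs f (fs w))" and bR3: "bdd_meas ?W (\<lambda>w. vs h (sn w))"
    by (intro bdd_meas_compose[OF fsm(1) vs[OF f]] bdd_meas_compose[OF fsm(2) vs[OF h]])+
  note iR = bdd_meas_integrable[OF fin(3) bR1] bdd_meas_integrable[OF fin(3) bR2] bdd_meas_integrable[OF fin(3) bR3]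
  have e2: "(\<integral>w. vs f (fs w) \<partial>?W) = (\<integral>u. vs f u \<partial>?N)"
    using integral_distr[OF fsm(1) bdd_measD[OF vs[OF f]]] by (simp add: distr)
  have e3: "(\<integral>w. vs h (sn w) \<partial>?W) = (\<integral>u. vs h u \<partial>?N)"
    using integral_distr[OF fsm(2) bdd_measD[OF vs[OF h]]] by (simp add: distr)
  have "(\<integral>w. G w \<partial>?W') = (\<integral>w. \<integral>y. G (w(i := y)) \<partial>J \<partial>?W)"
    by (rule PJ.product_integral_insert[OF insert.hyps bdd_meas_integrable[OF fin(4) G]])
  also have "\<dots> \<le> (\<integral>w. ?R w \<partial>?W)"
  proof (rule integral_mono)
    have "bdd_meas ?W (\<lambda>w. \<integral>y. G (w(i := y)) \<partial>J)"
      using bdd_meas_average[OF prob_J bdd_meas_compose[OF upd(2) G]] by simp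
    then show "integrable ?W (\<lambda>w. \<integral>y. G (w(i := y)) \<partial>J)" by (rule bdd_meas_integrable[OF fin(3)])
  qed (use iR inner in auto)
  also have "\<dots> = (\<integral>w. av f (fs w) * av h (sn w) \<partial>?W) + L2_beta \<nu> P / 2 * ((\<integral>u. vs f u \<partial>?N) + (\<integral>u. vs h u \<partial>?N))"
    using iR by (simp add: e2 e3)
  also have "(\<integral>w. av f (fs w) * av h (sn w) \<partial>?W) \<le> (\<integral>u. av f u \<partial>?N) * (\<integral>u. av h u \<partial>?N)
      + L2_beta \<nu> P / 2 * (var_of ?N (av f) + var_of ?N (av h))"
    unfolding fs_def sn_def by (rule insert.IH[OF av[OF f] av[OF h]])
  finally have "(\<integral>w. G w \<partial>?W') \<le> (\<integral>u. av f u \<partial>?N) * (\<integral>u. av h u \<partial>?N)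
      + L2_beta \<nu> P / 2 * (var_of ?N' f + var_of ?N' h)"
    unfolding total_var[OF f] total_var[OF h] by (simp add: algebra_simps add_divide_distrib)
  then show ?case
    unfolding fold[OF f] fold[OF h] G_def fs'_def sn'_def av_def .
qed

end

section \<open>Density of cylinder functions\<close>

definition cylinder_approx :: "'i set \<Rightarrow> 'a measure \<Rightarrow> (('i \<Rightarrow> 'a) \<Rightarrow> real) \<Rightarrow> bool" where
  "cylinder_approx I M f \<longleftrightarrow> (\<forall>e>0. \<exists>K g. finite K \<and> K \<subseteq> I \<and> bdd_meas (PiM K (\<lambda>_. M)) g \<and>
      L2_norm (PiM I (\<lambda>_. M)) (\<lambda>u. f u - g (restrict u K)) < e)"

lemma cylinder_L2:
  assumes M: "prob_space M" and K: "K \<subseteq> I" and g: "bdd_meas (PiM K (\<lambda>_. M)) g"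
  shows "(\<lambda>u. g (restrict u K)) \<in> L2_space (PiM I (\<lambda>_. M))"
proof -
  have "prob_space (PiM I (\<lambda>_. M))" by (intro prob_space_PiM M)
  from bdd_meas_L2[OF prob_space.finite_measure[OF this] bdd_meas_compose[OF measurable_restrict_subset[OF K] g]]
  show ?thesis .
qed

lemma cylinder_approx_lincomb:
  assumes M: "prob_space M" and f: "f \<in> L2_space (PiM I (\<lambda>_. M))" "cylinder_approx I M f"
    and h: "h \<in> L2_space (PiM I (\<lambda>_. M))" "cylinder_approx I M h"
  shows "cylinder_approx I M (\<lambda>u. f u + c * h u)"
  unfolding cylinder_approx_def
proof (intro allI impI)
  fix e :: real assume e: "e > 0"
  define d where "d = e / (1 + \<bar>c\<bar>)"
  have d: "d > 0" using e by (simp add: d_def add_pos_nonneg)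
  obtain K g where K: "finite K" "K \<subseteq> I" "bdd_meas (PiM K (\<lambda>_. M)) g"
    "L2_norm (PiM I (\<lambda>_. M)) (\<lambda>u. f u - g (restrict u K)) < d"
    using f(2) d unfolding cylinder_approx_def by blast
  obtain K' g' where K': "finite K'" "K' \<subseteq> I" "bdd_meas (PiM K' (\<lambda>_. M)) g'"
    "L2_norm (PiM I (\<lambda>_. M)) (\<lambda>u. h u - g' (restrict u K')) < d"
    using h(2) d unfolding cylinder_approx_def by blast
  define k where "k v = g (restrict v K) + c * g' (restrict v K')" for v
  have k: "bdd_meas (PiM (K \<union> K') (\<lambda>_. M)) k"
    unfolding k_def
    by (intro bdd_meas_lincomb bdd_meas_compose[OF measurable_restrict_subset K(3)] bdd_meas_compose[OF measurable_restrict_subset K'(3)]) auto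
  have kr: "k (restrict u (K \<union> K')) = g (restrict u K) + c * g' (restrict u K')" for u
    by (simp add: k_def Int_absorb2 Un_Int_distrib Int_commute)
  note L = L2_space_diff[OF f(1) cylinder_L2[OF M K(2,3)]] L2_space_diff[OF h(1) cylinder_L2[OF M K'(2,3)]]
  have "L2_norm (PiM I (\<lambda>_. M)) (\<lambda>u. (f u - g (restrict u K)) + c *\<^sub>R (h u - g' (restrict u K')))
      \<le> L2_norm (PiM I (\<lambda>_. M)) (\<lambda>u. f u - g (restrict u K)) + \<bar>c\<bar> * L2_norm (PiM I (\<lambda>_. M)) (\<lambda>u. h u - g' (restrict u K'))"
    using L2_triangle[OF L(1) L2_space_cmult[OF L(2)]] unfolding L2_norm_cmult .
  also have "\<dots> < d + \<bar>c\<bar> * d"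
    using K(4) K'(4) by (intro add_less_le_mono mult_left_mono) auto
  also have "\<dots> = e" unfolding d_def by (simp add: field_simps add_pos_nonneg less_imp_neq[symmetric])
  finally have "L2_norm (PiM I (\<lambda>_. M)) (\<lambda>u. (f u + c * h u) - k (restrict u (K \<union> K'))) < e"
    unfolding kr by (simp add: algebra_simps)
  then show "\<exists>K g. finite K \<and> K \<subseteq> I \<and> bdd_meas (PiM K (\<lambda>_. M)) g \<and>
      L2_norm (PiM I (\<lambda>_. M)) (\<lambda>u. (f u + c * h u) - g (restrict u K)) < e"
    using K(1,2) K'(1,2) k by (intro exI[of _ "K \<union> K'"] exI[of _ k]) auto
qed

lemma cylinder_approx_limit:
  assumes M: "prob_space M" and f: "f \<in> L2_space (PiM I (\<lambda>_. M))"
    and s: "\<And>n. s n \<in> L2_space (PiM I (\<lambda>_. M))" "\<And>n::nat. cylinder_approx I M (s n)"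
    and lim: "(\<lambda>n. L2_norm (PiM I (\<lambda>_. M)) (\<lambda>u. s n u - f u)) \<longlonglongrightarrow> 0"
  shows "cylinder_approx I M f"
  unfolding cylinder_approx_def
proof (intro allI impI)
  fix e :: real assume e: "e > 0"
  then have "\<forall>\<^sub>F n in sequentially. L2_norm (PiM I (\<lambda>_. M)) (\<lambda>u. s n u - f u) < e / 2"
    using order_tendstoD(2)[OF lim, of "e/2"] by simp
  then obtain n where n: "L2_norm (PiM I (\<lambda>_. M)) (\<lambda>u. s n u - f u) < e / 2"
    using eventually_happens trivial_limit_sequentially by blast
  obtain K g where K: "finite K" "K \<subseteq> I" "bdd_meas (PiM K (\<lambda>_. M)) g"
    "L2_norm (PiM I (\<lambda>_. M)) (\<lambda>u. s n u - g (restrict u K)) < e / 2"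
    using s(2)[of n] e unfolding cylinder_approx_def by (meson half_gt_zero)
  have "L2_norm (PiM I (\<lambda>_. M)) (\<lambda>u. f u - g (restrict u K))
      \<le> L2_norm (PiM I (\<lambda>_. M)) (\<lambda>u. f u - s n u) + L2_norm (PiM I (\<lambda>_. M)) (\<lambda>u. s n u - g (restrict u K))"
    by (rule L2_triangle_diff[OF f s(1) cylinder_L2[OF M K(2,3)]])
  also have "\<dots> < e" using n K(4) L2_norm_minus_commute[of "PiM I (\<lambda>_. M)" f "s n"] by simp
  finally show "\<exists>K g. finite K \<and> K \<subseteq> I \<and> bdd_meas (PiM K (\<lambda>_. M)) g \<and>
      L2_norm (PiM I (\<lambda>_. M)) (\<lambda>u. f u - g (restrict u K)) < e" using K by blast
qed

lemma cylinder_approx_cylinder: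
  assumes "finite K" "K \<subseteq> I" "bdd_meas (PiM K (\<lambda>_. M)) g"
    and eq: "\<And>u. u \<in> space (PiM I (\<lambda>_. M)) \<Longrightarrow> f u = g (restrict u K)"
  shows "cylinder_approx I M f"
proof -
  have "L2_norm (PiM I (\<lambda>_. M)) (\<lambda>u. f u - g (restrict u K)) = L2_norm (PiM I (\<lambda>_. M)) (\<lambda>u. 0 :: real)"
    unfolding L2_norm_def by (intro arg_cong[where f=sqrt] Bochner_Integration.integral_cong refl) (simp add: eq)
  also have "\<dots> = 0" by (simp add: L2_norm_def)
  finally show ?thesis using assms(1-3) unfolding cylinder_approx_def by force
qed

lemma indicator_L2:
  assumes "finite_measure M" "A \<in> sets M"
  shows "(indicator A :: 'a \<Rightarrow> real) \<in> L2_space M"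
  by (rule L2_space_bounded[OF assms(1), where B=1]) (use assms in \<open>auto simp: indicator_def\<close>)

lemma cylinder_approx_sum:
  assumes M: "prob_space M" and fin: "finite Y"
    and f: "\<And>y. y \<in> Y \<Longrightarrow> f y \<in> L2_space (PiM I (\<lambda>_. M)) \<and> cylinder_approx I M (f y)"
  shows "(\<lambda>u. \<Sum>y\<in>Y. c y * f y u) \<in> L2_space (PiM I (\<lambda>_. M)) \<and> cylinder_approx I M (\<lambda>u. \<Sum>y\<in>Y. c y * f y u)"
  using fin f
proof (induction Y rule: finite_induct)
  case empty
  have "bdd_meas (PiM {} (\<lambda>_. M)) (\<lambda>_. 0)" by (auto simp: bdd_meas_def)
  then show ?case by (auto simp: L2_space_def intro!: cylinder_approx_cylinder[of "{}"])
next
  case (insert y Y)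
  have IH: "(\<lambda>u. \<Sum>y\<in>Y. c y * f y u) \<in> L2_space (PiM I (\<lambda>_. M))" "cylinder_approx I M (\<lambda>u. \<Sum>y\<in>Y. c y * f y u)"
    and fy: "f y \<in> L2_space (PiM I (\<lambda>_. M))" "cylinder_approx I M (f y)"
    using insert by auto
  show ?case
    using cylinder_approx_lincomb[OF M IH fy, of "c y"] L2_space_add[OF IH(1) L2_space_cmult[OF fy(1), of "c y"]] insert.hyps
    by (simp add: add.commute)
qed

text \<open>The sets with approximable indicator form a Dynkin system, and it contains the
  cylinders that generate the product \<open>\<sigma>\<close>-algebra.\<close>

lemma cylinder_approx_indicator:
  assumes M: "prob_space M" and A: "A \<in> sets (PiM I (\<lambda>_. M))"
  shows "cylinder_approx I M (indicator A)"
proof -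
  let ?N = "PiM I (\<lambda>_. M)" and ?G = "prod_algebra I (\<lambda>_. M)"
  have pN: "prob_space ?N" by (intro prob_space_PiM M)
  note fN = prob_space.finite_measure[OF pN]
  have one: "cylinder_approx I M (\<lambda>_. 1)"
    by (rule cylinder_approx_cylinder[of "{}" _ _ "\<lambda>_. 1"]) (auto simp: bdd_meas_def)
  have "A \<in> sigma_sets (\<Pi>\<^sub>E i\<in>I. space M) ?G" using A by (simp add: sets_PiM)
  with Int_stable_prod_algebra prod_algebra_sets_into_space show ?thesis
  proof (induction rule: sigma_sets_induct_disjoint)
    case (basic A)
    then obtain K E where A: "A = prod_emb I (\<lambda>_. M) K (\<Pi>\<^sub>E j\<in>K. E j)" and K: "finite K" "K \<subseteq> I"
      and E: "\<And>i. i \<in> K \<Longrightarrow> E i \<in> sets M"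
      by (auto elim!: prod_algebraE)
    have "Pi\<^sub>E K E \<in> sets (PiM K (\<lambda>_. M))" using K E by (intro sets_PiM_I_finite) auto
    then have "bdd_meas (PiM K (\<lambda>_. M)) (indicator (Pi\<^sub>E K E))"
      by (auto simp: bdd_meas_def indicator_def intro!: exI[of _ 1])
    then show ?case
      by (rule cylinder_approx_cylinder[OF K]) (auto simp: A prod_emb_def space_PiM indicator_def)
  next
    case empty
    have "indicator {} = (\<lambda>u. 1 + (-1) * (1::real))" by auto
    then show ?case
      using cylinder_approx_lincomb[OF M L2_space_const[OF fN] one L2_space_const[OF fN] one, of "-1"] by simp
  next
    case (compl A)
    then have As: "A \<in> sets ?N" by (simp add: sets_PiM)
    have c: "cylinder_approx I M (\<lambda>u. 1 + (-1) * indicator A u)"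
      by (rule cylinder_approx_lincomb[OF M L2_space_const[OF fN] one indicator_L2[OF fN As] compl.IH])
    show ?case
    proof (rule cylinder_approx_limit[OF M _ _ c])
      let ?s = "\<lambda>u. 1 + (-1) * indicator A u :: real"
      have "(\<Pi>\<^sub>E i\<in>I. space M) - A \<in> sets ?N" using sets.compl_sets[OF As] by (simp add: space_PiM)
      then show "(indicator ((\<Pi>\<^sub>E i\<in>I. space M) - A) :: _ \<Rightarrow> real) \<in> L2_space ?N"
        by (rule indicator_L2[OF fN])
      show "?s \<in> L2_space ?N"
        using L2_space_diff[OF L2_space_const[OF fN, of 1] indicator_L2[OF fN As]] by simp
      have "L2_norm ?N (\<lambda>u. ?s u - indicator ((\<Pi>\<^sub>E i\<in>I. space M) - A) u) = L2_norm ?N (\<lambda>u. 0::real)"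
        unfolding L2_norm_def by (intro arg_cong[where f=sqrt] Bochner_Integration.integral_cong refl)
          (auto simp: space_PiM indicator_def)
      then show "(\<lambda>n. L2_norm ?N (\<lambda>u. ?s u - indicator ((\<Pi>\<^sub>E i\<in>I. space M) - A) u)) \<longlonglongrightarrow> 0"
        by (simp add: L2_norm_def)
    qed
  next
    case (union A)
    then have As: "A i \<in> sets ?N" for i by (auto simp: sets_PiM)
    then have Us: "(\<Union>i. A i) \<in> sets ?N" by auto
    have s: "(\<lambda>i. indicator (A i) x :: real) sums indicator (\<Union>i. A i) x" for x
      by (rule indicator_sums) (use union(1) in \<open>auto simp: disjoint_family_on_def\<close>)
    have bnd: "(norm ((\<Sum>i<n. 1 * indicator (A i) x) - indicator (\<Union>i. A i) x :: real))\<^sup>2 \<le> 1" for n x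
    proof -
      have "(\<Sum>i<n. indicator (A i) x :: real) \<le> (\<Sum>i. indicator (A i) x)"
        using s[of x] by (intro sum_le_suminf) (auto simp: sums_iff)
      also have "\<dots> = indicator (\<Union>i. A i) x" using s[of x] by (simp add: sums_iff)
      finally have a: "(\<Sum>i<n. indicator (A i) x :: real) \<le> indicator (\<Union>i. A i) x" .
      have b: "0 \<le> (\<Sum>i<n. indicator (A i) x :: real)" by (simp add: sum_nonneg)
      have c: "(indicator (\<Union>i. A i) x :: real) \<le> 1" by (simp add: indicator_def)
      have d: "q\<^sup>2 \<le> 1" if "p \<le> r" "0 \<le> p" "r \<le> 1" "q = norm (p - r)" for p q r :: real
        using that by (simp add: power2_le_iff_abs_le abs_square_le_1)
      show ?thesis unfolding mult_1 by (rule d[OF a b c refl])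
    qed
    have sm: "(\<lambda>u. \<Sum>i<n. 1 * indicator (A i) u :: real) \<in> L2_space ?N \<and> cylinder_approx I M (\<lambda>u. \<Sum>i<n. 1 * indicator (A i) u)" for n
      by (rule cylinder_approx_sum[OF M]) (auto intro: indicator_L2[OF fN As] union.IH)
    show ?case
    proof (rule cylinder_approx_limit[OF M indicator_L2[OF fN Us]])
      show "(\<lambda>u. \<Sum>i<n. 1 * indicator (A i) u :: real) \<in> L2_space ?N"
        "cylinder_approx I M (\<lambda>u. \<Sum>i<n. 1 * indicator (A i) u)" for n
        using sm[of n] by auto
      show "(\<lambda>n. L2_norm ?N (\<lambda>u. (\<Sum>i<n. 1 * indicator (A i) u) - indicator (\<Union>i. A i) u :: real)) \<longlonglongrightarrow> 0"
      proof (rule L2_dominated_convergence[where g="\<lambda>_. 1"])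
        show "AE x in ?N. (norm ((\<Sum>i<n. 1 * indicator (A i) x) - indicator (\<Union>i. A i) x :: real))\<^sup>2 \<le> 1" for n
          by (rule AE_I2) (rule bnd)
        show "AE x in ?N. (\<lambda>n. \<Sum>i<n. 1 * indicator (A i) x :: real) \<longlonglongrightarrow> indicator (\<Union>i. A i) x"
          using s by (simp add: sums_def)
        show "integrable ?N (\<lambda>_. 1 :: real)" by (rule finite_measure.integrable_const[OF fN])
      qed (use As Us in auto)
    qed
  qed
qed

lemma cylinder_dense:
  assumes M: "prob_space M" and f: "f \<in> L2_space (PiM I (\<lambda>_. M))"
  shows "cylinder_approx I M f"
proof -
  let ?N = "PiM I (\<lambda>_. M)"
  have pN: "prob_space ?N" by (intro prob_space_PiM M)
  note fN = prob_space.finite_measure[OF pN]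
  have fm: "f \<in> borel_measurable ?N" using f by (rule L2_spaceD)
  obtain s where s: "\<And>i. simple_function ?N (s i)" "\<And>x. x \<in> space ?N \<Longrightarrow> (\<lambda>i. s i x) \<longlonglongrightarrow> f x"
    "\<And>i x. x \<in> space ?N \<Longrightarrow> norm (s i x) \<le> 2 * norm (f x)"
  proof -
    from borel_measurable_implies_sequence_metric[OF fm, of 0] obtain s where
      "(\<forall>i. simple_function ?N (s i)) \<and> (\<forall>x\<in>space ?N. (\<lambda>i. s i x) \<longlonglongrightarrow> f x) \<and>
        (\<forall>i. \<forall>x\<in>space ?N. dist (s i x) 0 \<le> 2 * dist (f x) 0)" ..
    then show ?thesis by (intro that[of s]) auto
  qed
  define t where "t i u = (\<Sum>y\<in>s i ` space ?N. y * indicator (s i -` {y} \<inter> space ?N) u)" for i u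
  have ts: "t i u = s i u" if "u \<in> space ?N" for i u
  proof -
    have "t i u = (\<Sum>y\<in>s i ` space ?N. indicator (s i -` {y} \<inter> space ?N) u *\<^sub>R y)"
      unfolding t_def by (simp add: mult.commute)
    also have "\<dots> = s i u" by (rule simple_function_indicator_representation_banach[OF s(1) that, symmetric])
    finally show ?thesis .
  qed
  have t: "t i \<in> L2_space ?N \<and> cylinder_approx I M (t i)" for i
    unfolding t_def
  proof (rule cylinder_approx_sum[OF M])
    show "finite (s i ` space ?N)" by (rule simple_functionD(1)[OF s(1)])
    fix y
    have "s i -` {y} \<inter> space ?N \<in> sets ?N" by (rule simple_functionD(2)[OF s(1)])
    from indicator_L2[OF fN this] cylinder_approx_indicator[OF M this]
    show "(indicator (s i -` {y} \<inter> space ?N) :: _ \<Rightarrow> real) \<in> L2_space ?N \<and> cylinder_approx I M (indicator (s i -` {y} \<inter> space ?N))" ..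
  qed
  show ?thesis
  proof (rule cylinder_approx_limit[OF M f])
    show "t n \<in> L2_space ?N" "cylinder_approx I M (t n)" for n using t by auto
    show "(\<lambda>n. L2_norm ?N (\<lambda>u. t n u - f u)) \<longlonglongrightarrow> 0"
    proof (rule L2_dominated_convergence[where g="\<lambda>u. 9 * (norm (f u))\<^sup>2"])
      show "t n \<in> borel_measurable ?N" for n using t by (auto dest: L2_spaceD)
      show "AE x in ?N. (\<lambda>n. t n x) \<longlonglongrightarrow> f x" using s(2) by (intro AE_I2) (simp add: ts)
      show "AE x in ?N. (norm (t n x - f x))\<^sup>2 \<le> 9 * (norm (f x))\<^sup>2" for n
      proof (rule AE_I2)
        fix x assume x: "x \<in> space ?N"
        have "norm (t n x - f x) \<le> norm (t n x) + norm (f x)" by (rule norm_triangle_ineq4)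
        also have "\<dots> \<le> 3 * norm (f x)" using s(3)[OF x, of n] by (simp add: ts[OF x])
        finally have "(norm (t n x - f x))\<^sup>2 \<le> (3 * norm (f x))\<^sup>2" by (intro power_mono) auto
        then show "(norm (t n x - f x))\<^sup>2 \<le> 9 * (norm (f x))\<^sup>2" by (simp add: power_mult_distrib)
      qed
    qed (use fm L2_spaceD(2)[OF f] in auto)
  qed
qed

section \<open>The Poincare inequality for product kernels\<close>

context product_kernel_setup
begin

lemma Poincare_cylinder:
  assumes \<beta>: "0 \<le> L2_beta \<nu> Q" and K: "finite K" "K \<subseteq> I" and g: "bdd_meas (PiM K (\<lambda>_. \<nu>)) g"
  defines "f \<equiv> \<lambda>u. g (restrict u K)"
  shows "(1 - L2_beta \<nu> Q) * var_of N f \<le> (\<integral>z. (f (fst z) - f (snd z))\<^sup>2 \<partial>T.J) / 2"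
proof -
  interpret PP: product_prob_space "\<lambda>_. Q.J" I by (rule product_prob_const[OF Q.prob_J])
  interpret PN: product_prob_space "\<lambda>_. \<nu>" I by (rule product_prob_const[OF Q.prob_space_axioms])
  have pK: "prob_space (PiM K (\<lambda>_. \<nu>))" "prob_space (PiM K (\<lambda>_. Q.J))"
    by (intro prob_space_PiM Q.prob_space_axioms Q.prob_J)+
  have fL: "f \<in> L2_space N" unfolding f_def by (rule cylinder_L2[OF Q.prob_space_axioms K(2) g])
  have rN: "(\<lambda>u. restrict u K) \<in> N \<rightarrow>\<^sub>M PiM K (\<lambda>_. \<nu>)" by (rule measurable_restrict_subset[OF K(2)])
  have rJ: "(\<lambda>u. restrict u K) \<in> PJ \<rightarrow>\<^sub>M PiM K (\<lambda>_. Q.J)" by (rule measurable_restrict_subset[OF K(2)])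
  have gm: "g \<in> borel_measurable (PiM K (\<lambda>_. \<nu>))" using g by (rule bdd_measD)
  have I1: "(\<integral>u. k (restrict u K) \<partial>N) = (\<integral>u. k u \<partial>PiM K (\<lambda>_. \<nu>))" if "k \<in> borel_measurable (PiM K (\<lambda>_. \<nu>))" for k :: "_ \<Rightarrow> real"
    using integral_distr[OF rN that] unfolding PN.distr_PiM_restrict_finite[OF K] by simp
  have v: "var_of N f = var_of (PiM K (\<lambda>_. \<nu>)) g"
    unfolding var_of_def f_def using gm by (subst (1 2) I1) auto
  have fm: "f \<in> borel_measurable N" using fL by (rule L2_spaceD)
  have "(\<integral>z. f (fst z) * f (snd z) \<partial>T.J) = (\<integral>w. f (first_coords w) * f (second_coords w) \<partial>PJ)"
    unfolding joint_eq_distr using fm by (subst integral_distr) auto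
  also have "\<dots> = (\<integral>w. g (\<lambda>i\<in>K. fst (restrict w K i)) * g (\<lambda>i\<in>K. snd (restrict w K i)) \<partial>PJ)"
  proof -
    have "restrict (first_coords w) K = (\<lambda>i\<in>K. fst (restrict w K i))" "restrict (second_coords w) K = (\<lambda>i\<in>K. snd (restrict w K i))" for w
      using K(2) by (auto simp: first_coords_def second_coords_def fun_eq_iff restrict_def)
    then show ?thesis by (simp add: f_def)
  qed
  also have "\<dots> = (\<integral>w. g (\<lambda>i\<in>K. fst (w i)) * g (\<lambda>i\<in>K. snd (w i)) \<partial>distr PJ (PiM K (\<lambda>_. Q.J)) (\<lambda>w. restrict w K))"
  proof (rule integral_distr[OF rJ, symmetric])
    have "(\<lambda>w. \<lambda>i\<in>K. fst (w i)) \<in> PiM K (\<lambda>_. Q.J) \<rightarrow>\<^sub>M PiM K (\<lambda>_. \<nu>)" "(\<lambda>w. \<lambda>i\<in>K. snd (w i)) \<in> PiM K (\<lambda>_. Q.J) \<rightarrow>\<^sub>M PiM K (\<lambda>_. \<nu>)"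
      by measurable
    from measurable_compose[OF this(1) gm] measurable_compose[OF this(2) gm]
    show "(\<lambda>w. g (\<lambda>i\<in>K. fst (w i)) * g (\<lambda>i\<in>K. snd (w i))) \<in> borel_measurable (PiM K (\<lambda>_. Q.J))"
      by (rule borel_measurable_times)
  qed
  also have "\<dots> = (\<integral>w. g (\<lambda>i\<in>K. fst (w i)) * g (\<lambda>i\<in>K. snd (w i)) \<partial>PiM K (\<lambda>_. Q.J))"
    by (simp only: PP.distr_PiM_restrict_finite[OF K])
  also have "\<dots> \<le> (\<integral>u. g u \<partial>PiM K (\<lambda>_. \<nu>)) * (\<integral>u. g u \<partial>PiM K (\<lambda>_. \<nu>))
      + L2_beta \<nu> Q / 2 * (var_of (PiM K (\<lambda>_. \<nu>)) g + var_of (PiM K (\<lambda>_. \<nu>)) g)"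
    by (rule Q.tensor_correlation[OF \<beta> K(1) g g])
  also have "(\<integral>u. g u \<partial>PiM K (\<lambda>_. \<nu>)) = (\<integral>u. f u \<partial>N)" unfolding f_def by (rule I1[OF gm, symmetric])
  finally have le: "(\<integral>z. f (fst z) * f (snd z) \<partial>T.J) \<le> (\<integral>u. f u \<partial>N)\<^sup>2 + L2_beta \<nu> Q * var_of N f"
    by (simp add: v power2_eq_square)
  have "(L2_norm N f)\<^sup>2 = var_of N f + (\<integral>u. f u \<partial>N)\<^sup>2" by (simp add: L2_norm_power2 var_of_def)
  then have "(\<integral>z. (f (fst z) - f (snd z))\<^sup>2 \<partial>T.J) / 2 = var_of N f + (\<integral>u. f u \<partial>N)\<^sup>2 - (\<integral>z. f (fst z) * f (snd z) \<partial>T.J)"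
    unfolding T.integral_square_J(2)[OF fL] by simp
  then show ?thesis using le by (simp add: algebra_simps)
qed

text \<open>Both sides are squares of seminorms that are continuous in \<open>L\<^sup>2\<close>, so the inequality
  extends from cylinder functions to their closure.\<close>

lemma Poincare_product:
  assumes \<beta>: "0 \<le> L2_beta \<nu> Q" "L2_beta \<nu> Q \<le> 1" and f: "f \<in> L2_space N"
  shows "(1 - L2_beta \<nu> Q) * var_of N f \<le> (\<integral>z. (f (fst z) - f (snd z))\<^sup>2 \<partial>T.J) / 2"
proof -
  note pN = T.prob_space_axioms and fN = T.finite_measure_axioms
  define c where "c = sqrt (2 * (1 - L2_beta \<nu> Q))"
  have c: "c \<ge> 0" "c\<^sup>2 = 2 * (1 - L2_beta \<nu> Q)" using \<beta> by (auto simp: c_def)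
  define sd where "sd k = L2_norm N (\<lambda>u. k u - (\<integral>u. k u \<partial>N))" for k :: "_ \<Rightarrow> real"
  define E where "E k = L2_norm T.J (\<lambda>z. k (fst z) - k (snd z))" for k :: "_ \<Rightarrow> real"
  have E2: "(E k)\<^sup>2 = (\<integral>z. (k (fst z) - k (snd z))\<^sup>2 \<partial>T.J)" for k by (simp add: E_def L2_norm_power2)
  have "c * sd f \<le> E f"
  proof (rule field_le_epsilon)
    fix e :: real assume "e > 0"
    \<comment> \<open>An error \<open>d\<close> in \<open>L\<^sup>2\<close> changes the left-hand side by at most \<open>c d\<close> and the right-hand side by at most \<open>2 d\<close>.\<close>
    define d where "d = e / (c + 2)"
    have d: "d > 0" using \<open>e > 0\<close> c(1) by (simp add: d_def)
    obtain K g where K: "finite K" "K \<subseteq> I" "bdd_meas (PiM K (\<lambda>_. \<nu>)) g"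
      "L2_norm N (\<lambda>u. f u - g (restrict u K)) < d"
      using cylinder_dense[OF Q.prob_space_axioms f] d unfolding cylinder_approx_def by blast
    define k where "k u = g (restrict u K)" for u
    have k: "k \<in> L2_space N" unfolding k_def by (rule cylinder_L2[OF Q.prob_space_axioms K(2,3)])
    define r where "r u = f u - k u" for u
    have r: "r \<in> L2_space N" unfolding r_def by (rule L2_space_diff[OF f k])
    have rn: "L2_norm N r \<le> d" unfolding r_def k_def using K(4) by simp
    have cen: "(\<lambda>u. h u - (\<integral>u. h u \<partial>N)) \<in> L2_space N" if "h \<in> L2_space N" for h :: "_ \<Rightarrow> real"
      by (rule L2_space_diff[OF that L2_space_const[OF fN]])
    have "sd r \<le> L2_norm N r"
    proof (rule power2_le_imp_le)
      show "(sd r)\<^sup>2 \<le> (L2_norm N r)\<^sup>2"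
        unfolding sd_def var_of_eq[OF pN r] by (simp add: var_of_def L2_norm_power2)
    qed simp
    have "sd f \<le> sd k + sd r"
    proof -
      have m: "(\<integral>u. f u \<partial>N) = (\<integral>u. k u \<partial>N) + (\<integral>u. r u \<partial>N)"
      proof -
        have "(\<integral>u. r u \<partial>N) = (\<integral>u. f u - k u \<partial>N)"
          by (rule Bochner_Integration.integral_cong[OF refl r_def])
        also have "\<dots> = (\<integral>u. f u \<partial>N) - (\<integral>u. k u \<partial>N)"
          by (rule Bochner_Integration.integral_diff[OF L2_space_integrable[OF fN f] L2_space_integrable[OF fN k]])
        finally show ?thesis by simp
      qed
      have e: "(\<lambda>u. f u - (\<integral>u. f u \<partial>N)) = (\<lambda>u. (k u - (\<integral>u. k u \<partial>N)) + (r u - (\<integral>u. r u \<partial>N)))"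
      proof (rule ext)
        fix u
        have "f u = k u + r u" by (simp add: r_def)
        then show "f u - (\<integral>u. f u \<partial>N) = (k u - (\<integral>u. k u \<partial>N)) + (r u - (\<integral>u. r u \<partial>N))"
          using m by linarith
      qed
      show ?thesis unfolding sd_def e by (rule L2_triangle[OF cen[OF k] cen[OF r]])
    qed
    with \<open>sd r \<le> L2_norm N r\<close> rn have s: "sd f \<le> sd k + d" by simp
    have "(c * sd k)\<^sup>2 \<le> (E k)\<^sup>2"
      using Poincare_cylinder[OF \<beta>(1) K(1-3), folded k_def]
      unfolding E2 power_mult_distrib c(2) sd_def var_of_eq[OF pN k] by (simp add: algebra_simps)
    then have ck: "c * sd k \<le> E k" by (rule power2_le_imp_le) (simp add: E_def)
    have dl: "(\<lambda>z. h (fst z) - h (snd z)) \<in> L2_space T.J" if "h \<in> L2_space N" for h :: "_ \<Rightarrow> real"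
      by (rule L2_space_diff[OF T.L2_lift(1)[OF that] T.L2_lift(2)[OF that]])
    have Er: "E r \<le> 2 * d"
    proof -
      have "E r \<le> L2_norm T.J (\<lambda>z. r (fst z)) + L2_norm T.J (\<lambda>z. (-1) *\<^sub>R r (snd z))"
        unfolding E_def using L2_triangle[OF T.L2_lift(1)[OF r] L2_space_cmult[OF T.L2_lift(2)[OF r], of "-1"]] by simp
      also have "\<dots> = 2 * L2_norm N r" unfolding L2_norm_cmult T.L2_lift(3,4)[OF r] by simp
      finally show ?thesis using rn by simp
    qed
    have "E k \<le> E f + E r"
    proof -
      have e: "(\<lambda>z. k (fst z) - k (snd z)) = (\<lambda>z. (f (fst z) - f (snd z)) + (-1) *\<^sub>R (r (fst z) - r (snd z)))"
        by (auto simp: r_def fun_eq_iff)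
      have "E k \<le> L2_norm T.J (\<lambda>z. f (fst z) - f (snd z)) + L2_norm T.J (\<lambda>z. (-1) *\<^sub>R (r (fst z) - r (snd z)))"
        unfolding E_def e by (rule L2_triangle[OF dl[OF f] L2_space_cmult[OF dl[OF r]]])
      then show ?thesis unfolding L2_norm_cmult by (simp add: E_def)
    qed
    have "c * sd f \<le> c * sd k + c * d" using mult_left_mono[OF s c(1)] by (simp add: algebra_simps)
    also have "\<dots> \<le> E f + (c + 2) * d" using ck \<open>E k \<le> E f + E r\<close> Er by (simp add: algebra_simps)
    also have "(c + 2) * d = e" using c(1) by (simp add: d_def)
    finally show "c * sd f \<le> E f + e" .
  qed
  then have "(c * sd f)\<^sup>2 \<le> (E f)\<^sup>2" using c(1) by (intro power_mono) (auto simp: sd_def)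
  then show ?thesis unfolding E2 power_mult_distrib c(2) sd_def var_of_eq[OF pN f] by (simp add: algebra_simps)
qed

end

section \<open>The dimension-independent spectral gap\<close>

lemma onorm_matrix_inv_pos:
  fixes \<Gamma> :: "real ^ 'n::finite ^ 'n"
  assumes "pos_def_matrix \<Gamma>"
  shows "0 < onorm ((*v) (matrix_inv \<Gamma>))"
proof -
  have "x = 0" if "\<Gamma> *v x = 0" for x
    using assms that unfolding pos_def_matrix_def by (metis inner_zero_right less_irrefl)
  then have "\<exists>B. B ** \<Gamma> = mat 1" unfolding matrix_left_invertible_ker by blast
  then have inv: "invertible \<Gamma>" by (simp add: invertible_left_inverse)
  have bl: "bounded_linear ((*v) (matrix_inv \<Gamma>))" by (rule matrix_vector_mul_bounded_linear)
  show ?thesis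
  proof (rule ccontr)
    assume "\<not> 0 < onorm ((*v) (matrix_inv \<Gamma>))"
    then have "onorm ((*v) (matrix_inv \<Gamma>)) = 0" using onorm_pos_le[OF bl] by linarith
    then have z: "matrix_inv \<Gamma> *v x = 0" for x using onorm_eq_0[OF bl] by blast
    have "(1 :: real ^ 'n) = (\<Gamma> ** matrix_inv \<Gamma>) *v 1"
      using someI_ex[OF inv[unfolded invertible_def]] unfolding matrix_inv_def[symmetric] by simp
    also have "\<dots> = 0" unfolding matrix_vector_mul_assoc[symmetric] z by simp
    finally show False by simp
  qed
qed

lemma measure_unif_half: "{0..1} \<in> sets unif" "measure unif {0..1} = 1 / 2"
proof -
  have s: "{0..1::real} \<in> sets (restrict_space lborel {-1..1})"
    by (auto simp: sets_restrict_space_iff)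
  show "{0..1} \<in> sets unif" unfolding unif_def using s by simp
  have "emeasure unif {0..1} = emeasure (restrict_space lborel {-1..1}) ({-1..1} \<inter> {0..1::real}) / emeasure (restrict_space lborel {-1..1}) {-1..1::real}"
    unfolding unif_def by (rule emeasure_uniform_measure) (use s in \<open>auto simp: sets_restrict_space_iff\<close>)
  also have "{-1..1} \<inter> {0..1::real} = {0..1}" by auto
  also have "emeasure (restrict_space lborel {-1..1}) {0..1::real} = ennreal 1"
    by (subst emeasure_restrict_space) auto
  also have "emeasure (restrict_space lborel {-1..1}) {-1..1::real} = ennreal 2"
    by (subst emeasure_restrict_space) auto
  also have "ennreal 1 / ennreal 2 = ennreal (1 / 2)" by (rule divide_ennreal) auto
  finally show "measure unif {0..1} = 1 / 2"
    by (metis enn2real_ennreal measure_def zero_le_divide_1_iff zero_le_numeral)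
qed

text \<open>The event that the first coordinate is nonnegative has prior probability one half; it witnesses that the mean-zero functions are
  nontrivial, which needs at least one coordinate.\<close>

lemma lazy_MH_product_gap:
  assumes Q: "markov_kernel unif Q" "reversible unif Q" "L2_beta unif Q < 1"
    and J: "J \<ge> 1" and L: "L \<in> borel_measurable (prior J)" "m > 0" "\<And>u. u \<in> space (prior J) \<Longrightarrow> m \<le> L u \<and> L u \<le> M"
  defines "K \<equiv> lazy_kernel (posterior (prior J) L) (MH_kernel (posterior (prior J) L) L (product_kernel J Q))"
  shows "0 \<le> L2_beta unif Q" "markov_kernel (posterior (prior J) L) K"
    "L2_beta (posterior (prior J) L) K \<le> 1 - m / M * (1 - L2_beta unif Q) / 2"
proof -
  interpret Q: reversible_prob unif Q
    using prob_space_unif Q by (simp add: reversible_prob_def reversible_prob_axioms_def markov_prob_def markov_prob_axioms_def)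
  interpret product_kernel_setup unif Q "coords J" ..
  show \<beta>: "0 \<le> L2_beta unif Q"
    using measure_unif_half by (intro Q.L2_beta_nonneg[of "{0..1}"]) auto
  have tensor: "tensor = product_kernel J Q" by (auto simp: fun_eq_iff tensor_def product_kernel_def)
  interpret MHP: metropolis_hastings "prior J" "product_kernel J Q" L m M
  proof (rule metropolis_hastings.intro)
    show "reversible_prob (prior J) (product_kernel J Q)"
      using T.reversible_prob_axioms by (simp add: prior_def tensor)
    show "metropolis_hastings_axioms (prior J) L m M"
      using L by unfold_locales auto
  qed
  have 0: "0 \<in> coords J" using J by (cases J) (auto simp: coords_def one_enat_def zero_enat_def)
  define A where "A = {u \<in> space (prior J). u 0 \<in> {0..1}}"
  have "emeasure (prior J) {u \<in> space (prior J). \<forall>j\<in>{0}. u j \<in> {0..1}} = (\<Prod>j\<in>{0::nat}. emeasure unif {0..1})"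
    unfolding prior_def using 0 measure_unif_half by (intro emeasure_PiM_Collect_prob prob_space_unif) auto
  then have "emeasure (prior J) A = emeasure unif {0..1}" by (simp add: A_def)
  then have mA: "measure (prior J) A = 1 / 2" using measure_unif_half(2) by (simp add: measure_def)
  have "(\<lambda>u. u 0) \<in> prior J \<rightarrow>\<^sub>M unif" unfolding prior_def by (rule measurable_component_singleton[OF 0])
  from measurable_sets[OF this measure_unif_half(1)] have A: "A \<in> sets (prior J)"
    by (simp add: A_def vimage_def Int_def conj_commute)
  have gap: "(1 - L2_beta unif Q) * var_of (prior J) f \<le> (\<integral>z. (f (fst z) - f (snd z))\<^sup>2 \<partial>kernel_joint (prior J) (product_kernel J Q)) / 2"
    if "f \<in> L2_space (prior J)" for f
    using Poincare_product[OF \<beta> less_imp_le[OF Q(3)], of f] that by (simp add: prior_def tensor)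
  have "0 \<le> 1 - L2_beta unif Q" "1 - L2_beta unif Q \<le> 1" using \<beta> Q(3) by auto
  note * = MHP.lazy_MH_gap[OF gap this A]
  show "markov_kernel (posterior (prior J) L) K" "L2_beta (posterior (prior J) L) K \<le> 1 - m / M * (1 - L2_beta unif Q) / 2"
    unfolding K_def using * mA by auto
qed

theorem corollary4p2:
  fixes D :: "'a::euclidean_space set"
    and g :: "('a \<Rightarrow> real) \<Rightarrow> real"
    and l :: "'n::finite \<Rightarrow> ('a \<Rightarrow> real) \<Rightarrow> real"
    and abar :: "'a \<Rightarrow> real"
    and \<gamma> :: "nat \<Rightarrow> real"
    and \<psi> :: "nat \<Rightarrow> 'a \<Rightarrow> real"
    and astar :: real
    and y :: "real ^ 'n"
    and \<Gamma> :: "real ^ 'n ^ 'n"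
  defines "a \<equiv> coefficient abar \<gamma> \<psi>"
  defines "L \<equiv> \<lambda>J. likelihood (forward_map D g l) \<Gamma> y (a J)"
  defines "\<mu> \<equiv> \<lambda>J. posterior (prior J) (L J)"
  assumes "open D" "connected D" "bounded D" "D \<noteq> {}"
    and "g \<in> Hm1_space D"
    and "\<And>i. l i \<in> Hm1_space D"
    and "abar \<in> Linf_space (lebesgue_on D)"
    and "\<And>j. \<psi> j \<in> Linf_space (lebesgue_on D)"
    and "\<And>j. Linf_norm (lebesgue_on D) (\<psi> j) = 1"
    and series_converges_Linf: "\<And>u. (\<And>j. u j \<in> {-1..1}) \<Longrightarrow>
          (\<lambda>n. Linf_norm (lebesgue_on D) (\<lambda>x. a \<infinity> u x - a (enat n) u x)) \<longlonglongrightarrow> 0"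
    and "astar > 0"
    and "\<And>J u. (\<And>j. j \<in> coords J \<Longrightarrow> u j \<in> {-1..1}) \<Longrightarrow>
          AE x in lebesgue_on D. a J u x \<ge> astar"
    and "pos_def_matrix \<Gamma>"
  shows "\<exists>C>0. \<forall>Q.
           markov_kernel unif Q \<and> reversible unif Q \<and> has_L2_spectral_gap unif Q \<longrightarrow>
           (\<forall>J\<ge>1.
              has_L2_spectral_gap (\<mu> J)
                (lazy_kernel (\<mu> J) (MH_kernel (\<mu> J) (L J) (product_kernel J Q))) \<and>
              1 - L2_beta (\<mu> J)
                (lazy_kernel (\<mu> J) (MH_kernel (\<mu> J) (L J) (product_kernel J Q)))
              \<ge> 1/2 * exp (- 8 * C\<^sup>2 * onorm ((*v) (matrix_inv \<Gamma>)) * (real CARD('n))\<^sup>2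
                          * (Max (range (\<lambda>i. Hm1_norm D (l i))))\<^sup>2 * (1 / astar\<^sup>2))
                 * (1 - L2_beta unif Q)\<^sup>2)"
proof -
  interpret elliptic_problem D g l abar \<gamma> \<psi> astar
    by unfold_locales (use assms in \<open>simp_all add: a_def\<close>)
  define \<kappa> where "\<kappa> = onorm ((*v) (matrix_inv \<Gamma>)) * (real CARD('n))\<^sup>2 * (Max (range (\<lambda>i. Hm1_norm D (l i))))\<^sup>2 * (1 / astar\<^sup>2)"
  have L_measurable: "L J \<in> borel_measurable (prior J)" for J
    unfolding L_def a_def by (rule likelihood_measurable)
  have "\<exists>C m M. C > 0 \<and> m > 0 \<and> (\<forall>J. \<forall>u\<in>space (prior J). m \<le> L J u \<and> L J u \<le> M) \<and> exp (- 8 * C\<^sup>2 * \<kappa>) \<le> m / M"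
  proof (cases "Max (range (\<lambda>i. Hm1_norm D (l i))) = 0")
    case True
    have "Hm1_norm D (l i) = 0" for i
    proof -
      have "Hm1_norm D (l i) \<le> Max (range (\<lambda>i. Hm1_norm D (l i)))" by (rule Max_ge) auto
      then show ?thesis using True Hm1_norm_nonneg[OF l_dual, of i] by simp
    qed
    then have L: "L J u = exp (- (1/2) * (cov_norm \<Gamma> y)\<^sup>2)" if "u \<in> space (prior J)" for J u
      unfolding L_def a_def using that by (rule likelihood_const)
    show ?thesis
      by (rule exI[of _ 1], rule exI[of _ "exp (- (1/2) * (cov_norm \<Gamma> y)\<^sup>2)"], rule exI[of _ "exp (- (1/2) * (cov_norm \<Gamma> y)\<^sup>2)"])
        (use L True in \<open>auto simp: \<kappa>_def\<close>)
  next
    case False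
    then have \<kappa>: "\<kappa> > 0"
      unfolding \<kappa>_def using onorm_matrix_inv_pos[OF \<open>pos_def_matrix \<Gamma>\<close>] astar_pos by simp
    obtain m where m: "m > 0" "\<And>J u. u \<in> space (prior J) \<Longrightarrow> m \<le> L J u" "\<And>J u. L J u \<le> 1"
      unfolding L_def a_def using likelihood_bounds[of \<Gamma> y] by blast
    \<comment> \<open>The summand one keeps \<open>C\<close> positive also when \<open>m = 1\<close>.\<close>
    define C where "C = sqrt ((\<bar>ln m\<bar> + 1) / (8 * \<kappa>))"
    have "C > 0" using \<kappa> by (simp add: C_def add_nonneg_pos)
    have "8 * C\<^sup>2 * \<kappa> = \<bar>ln m\<bar> + 1" using \<kappa> by (simp add: C_def)
    then have "- 8 * C\<^sup>2 * \<kappa> \<le> ln m" by simp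
    then have "exp (- 8 * C\<^sup>2 * \<kappa>) \<le> exp (ln m)" by (simp only: exp_le_cancel_iff)
    then have "exp (- 8 * C\<^sup>2 * \<kappa>) \<le> m / 1" using m(1) by simp
    with \<open>C > 0\<close> m show ?thesis by (intro exI[of _ C] exI[of _ m] exI[of _ 1]) auto
  qed
  then obtain C m M where C: "C > 0" "m > 0" and bounds: "\<And>J u. u \<in> space (prior J) \<Longrightarrow> m \<le> L J u \<and> L J u \<le> M"
    and e: "exp (- 8 * C\<^sup>2 * \<kappa>) \<le> m / M" by blast
  have exp_pos: "0 < m / M" using e exp_gt_zero[of "- 8 * C\<^sup>2 * \<kappa>"] by linarith
  have exponent: "- 8 * C\<^sup>2 * onorm ((*v) (matrix_inv \<Gamma>)) * (real CARD('n))\<^sup>2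
      * (Max (range (\<lambda>i. Hm1_norm D (l i))))\<^sup>2 * (1 / astar\<^sup>2) = - 8 * C\<^sup>2 * \<kappa>"
    by (simp add: \<kappa>_def)
  show ?thesis
  proof (intro exI[of _ C] conjI allI impI C(1))
    fix Q :: "real \<Rightarrow> real measure" and J :: enat
    assume Q: "markov_kernel unif Q \<and> reversible unif Q \<and> has_L2_spectral_gap unif Q" and J: "J \<ge> 1"
    define \<beta> where "\<beta> = L2_beta unif Q"
    let ?K = "lazy_kernel (\<mu> J) (MH_kernel (\<mu> J) (L J) (product_kernel J Q))"
    have "\<beta> < 1" using Q by (simp add: has_L2_spectral_gap_def \<beta>_def)
    have K: "0 \<le> \<beta>" "markov_kernel (\<mu> J) ?K" "L2_beta (\<mu> J) ?K \<le> 1 - m / M * (1 - \<beta>) / 2"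
      using lazy_MH_product_gap[of Q J "L J" m M] Q J L_measurable[of J] C(2) bounds[of _ J] \<open>\<beta> < 1\<close>
      unfolding \<mu>_def \<beta>_def by auto
    define \<delta> where "\<delta> = m / M * (1 - \<beta>)"
    have "0 < \<delta>" unfolding \<delta>_def using exp_pos \<open>\<beta> < 1\<close> by (intro mult_pos_pos) auto
    have le: "L2_beta (\<mu> J) ?K \<le> 1 - \<delta> / 2" using K(3) by (simp only: \<delta>_def)
    with \<open>0 < \<delta>\<close> have "L2_beta (\<mu> J) ?K < 1" by linarith
    with K(2) show "has_L2_spectral_gap (\<mu> J) ?K" by (simp add: has_L2_spectral_gap_def)
    have "exp (- 8 * C\<^sup>2 * \<kappa>) * (1 - \<beta>)\<^sup>2 \<le> \<delta>"
      unfolding \<delta>_def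
    proof (rule mult_mono[OF e])
      have "(1 - \<beta>) * (1 - \<beta>) \<le> 1 * (1 - \<beta>)" using K(1) \<open>\<beta> < 1\<close> by (intro mult_right_mono) auto
      then show "(1 - \<beta>)\<^sup>2 \<le> 1 - \<beta>" by (simp add: power2_eq_square)
    qed (use exp_pos in auto)
    with le show "1 - L2_beta (\<mu> J) ?K \<ge> 1/2 * exp (- 8 * C\<^sup>2 * onorm ((*v) (matrix_inv \<Gamma>))
        * (real CARD('n))\<^sup>2 * (Max (range (\<lambda>i. Hm1_norm D (l i))))\<^sup>2 * (1 / astar\<^sup>2)) * (1 - L2_beta unif Q)\<^sup>2"
      unfolding exponent \<beta>_def by linarith
  qed
qed

end
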